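(* Let the problem data $(A_0,A_1,b_0,b_1,c_0,c_1)$, the parameters $(\xi,\zeta,\hat\gamma)$ with $\hat\gamma\ge 0$, and $(\epsilon,p)$ satisfy: for both $i\in\{0,1\}$, $A_i\in\mathbb S^n$ has at least one negative eigenvalue and $\|A_i\|,\|b_i\|,|c_i|\le 1$; $N\ge n$, where $N$ is the number of nonzero entries in $A_0$ and $A_1$ combined; $\gamma_+\le\zeta$; $A(\hat\gamma)\succeq\xi I$; $0<\xi\le 1\le\zeta$; and $\epsilon,p\in(0,1)$. Then, with probability at least $1-p$, the two-stage procedure described in the context (run ConstructReform; if its output is tagged "regular", run SolveRegular on that output and return its result; otherwise return the point $x$ output by ConstructReform) returns an $\epsilon$-approximate solution to the GTRS $\inf_{x\in\mathbb R^n}\{q_0(x): q_1(x)\le 0\}$ in time $$\tilde O\left(\frac{N\sqrt{\zeta}}{\sqrt{\phi}}\log\left(\frac1\phi\right)\log\left(\frac np\right)\log\left(\frac{\zeta}{\epsilon\xi}\right)\right),$$ where $\phi=\max\left(\min(\mu^*,\xi),\ \epsilon\xi^4/\zeta^4\right)$.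
   Context: **Problem and notation.** $\mathbb S^n$ is the set of real symmetric $n\times n$ matrices; $\|\cdot\|$ is the spectral norm for matrices and the Euclidean norm for vectors. For $i\in\{0,1\}$, $q_i(x)=x^\top A_ix+2b_i^\top x+c_i$ with $A_i\in\mathbb S^n$, $b_i\in\mathbb R^n$, $c_i\in\mathbb R$. The GTRS is $\mathrm{Opt}=\inf_{x\in\mathbb R^n}\{q_0(x): q_1(x)\le 0\}$. A point $x$ is an $\epsilon$-approximate solution (optimizer) if $q_0(x)\le\mathrm{Opt}+\epsilon$ and $q_1(x)\le\epsilon$. Put $A(\gamma)=A_0+\gamma A_1$, $b(\gamma)=b_0+\gamma b_1$, $q(\gamma,x)=q_0(x)+\gamma q_1(x)$, $\mu(\gamma)=\lambda_{\min}(A(\gamma))$, $\Gamma=\{\gamma\ge 0: A(\gamma)\succeq 0\}$ (a closed interval) and $\gamma_+=\sup\Gamma$. For $\gamma\in\mathrm{int}(\Gamma)$, $x(\gamma)=-A(\gamma)^{-1}b(\gamma)$ and $\nu(\gamma)=q_1(x(\gamma))$. The dual function is $\mathbf d(\gamma)=\inf_{x}q(\gamma,x)$ for $\gamma\ge0$. If $\mathbf d$ has a unique maximizer over $\mathbb R_+$, $\gamma^*$ is that maximizer; otherwise $\arg\max_{\gamma\ge0}\mathbf d(\gamma)=\Gamma$ (compact) and $\gamma^*$ is the smallest element of $\arg\max_{\gamma\in\Gamma}\mu(\gamma)$. Set $\mu^*=\mu(\gamma^* )$. Running times count elementary arithmetic operations; $\tilde O$ hides $\log\log$-factors. Below, $T$'s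 use base-2 logarithms. **Black-box subroutines (known).** ApproxEig$(A,\rho,\delta,p)$: for $\|A\|\le\rho$, with probability $\ge 1-p$ returns a unit vector $x$ with $x^\top Ax\le\lambda_{\min}(A)+\delta$, in time $O(N_A\sqrt{\rho/\delta}\log(n/p))$ where $N_A$ is the number of nonzeros of $A$ (Lanczos). Conjugate gradient: for $\mu I\preceq A\preceq\rho I$, returns $x$ with $\|x+A^{-1}b\|\le\delta$ in time $O(N_A\sqrt{\rho/\mu}\log(\|b\|/(\mu\delta)))$. AccMinimax: for two quadratics $x^\top A^{(i)}x+2b^{(i)\top}x+c^{(i)}$ with $\mu I\preceq A^{(i)}\preceq\rho I$, $\|b^{(i)}\|\le\rho$, returns a point whose value for $\max_i(\cdot)$ is within $\delta$ of the minimum, in time $O(N\sqrt{\rho/\mu}\log(\rho/(\delta\mu)))$ (Nesterov's accelerated minimax scheme). **ApproxNu$(\mu,\delta,\gamma)$** (for $A(\gamma)\succeq\mu I$): by conjugate gradient find $\tilde x$ with $\|\tilde x-x(\gamma)\|\le\mu\delta/(10\zeta)$; return $(\tilde x,q_1(\tilde x))$. **ApproxGammaLeft$(\mu,p)$** (for $\mu\in(0,\xi)$): set $\ell_1=0$, $r_1=\hat\gamma$. For $t=1,\dots,T=\lceil\log(5\zeta/\mu)\rceil$: $\gamma_t=(\ell_t+r_t)/2$; $x_t=$ ApproxEig$(A(\gamma_t),2\zeta,\mu/8,p/T)$; $\hat\mu_t=x_t^\top A(\gamma_t)x_t$; if $\hat\mu_t>\mu$ set $(\ell_{t+1},r_{t+1})=(\ell_t,\gamma_t)$;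 else if $\hat\mu_t<\frac58\mu$ set $(\ell_{t+1},r_{t+1})=(\gamma_t,r_t)$; else output $(\gamma_t,x_t)$. ApproxGammaRight is its mirror image, searching $[\hat\gamma,\zeta]$ (start $\ell_1=\hat\gamma$, $r_1=\zeta$; the two interval updates are interchanged). **ConstructReform.** Set $\gamma_0=\hat\gamma$, $\mu_0=\xi$, $(x_0,\nu_0)=$ ApproxNu$(\mu_0,\epsilon/(4\zeta),\gamma_0)$. If $\nu_0+\epsilon/(4\zeta)<0$ run CRLeft; else if $\nu_0-\epsilon/(4\zeta)>0$ run CRRight; else run CRMid. *CRLeft.* Let $T=\lceil\log(3200\zeta^4/(\epsilon\xi^3))\rceil$. For $t=1,\dots,T$: (a) $\mu_t=2^{-t}\xi$; (b) $(\gamma_t,v_t)=$ ApproxGammaLeft$(\mu_t,p/T)$; (c) $(x_t,\nu_t)=$ ApproxNu$(\mu_t/2,\epsilon/(4\zeta),\gamma_t)$; (d) if $\nu_t-\epsilon/(4\zeta)>0$, return "regular", $\gamma_t,\hat\gamma,\mu_t/4$; (e) else if $\nu_t\in[-\epsilon/(4\zeta),\epsilon/(4\zeta)]$: set $\gamma'=\gamma_t-\mu_t/4$, $(x',\nu')=$ ApproxNu$(\mu_t/4,\epsilon/(4\zeta),\gamma')$; if $\nu'-\epsilon/(4\zeta)>0$ return "regular", $\gamma',\hat\gamma,\mu_t/4$; else return "maybe regular", $x_t$. If the loop ends: negate $v_T$ if necessary so that $\langle v_T,A(\gamma_T)x_T+b(\gamma_T)\rangle\le0$, let $\alpha>0$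 with $q_1(x_T+\alpha v_T)=0$, and return "not regular", $x_T+\alpha v_T$. *CRRight* is the mirror image of CRLeft: it uses ApproxGammaRight, reverses the sign tests on $\nu_t$ and $\nu'$ (tests $\nu_t+\epsilon/(4\zeta)<0$ and $\nu'+\epsilon/(4\zeta)<0$), uses $\gamma'=\gamma_t+\mu_t/4$, and its "regular" outputs are $\hat\gamma,\gamma_t,\mu_t/4$, resp. $\hat\gamma,\gamma',\mu_t/4$. *CRMid.* Let $\gamma'=\gamma_0-\xi/2$, $\gamma''=\gamma_0+\xi/2$; $(x',\nu')=$ ApproxNu$(\xi/2,\epsilon/(4\zeta),\gamma')$; $(x'',\nu'')=$ ApproxNu$(\xi/2,\epsilon/(4\zeta),\gamma'')$. If $\nu'-\epsilon/(4\zeta)>0>\nu''+\epsilon/(4\zeta)$ return "regular", $\gamma',\gamma'',\xi/2$; otherwise return "maybe regular", $x_0$. **SolveRegular** (input $\gamma^{(1)},\gamma^{(2)},\tilde\mu$): use AccMinimax to compute a $\tilde\mu(\epsilon\tilde\mu/(10\zeta))^2$-optimal solution $\bar x$ of $\min_x\max(q(\gamma^{(1)},x),q(\gamma^{(2)},x))$; return $\bar x$.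
   Formalization: The factor log(1/φ) in the running time is replaced by 1 + log(1/φ), since φ can be arbitrarily close to 1, where the bound as written would tend to 0 although the procedure always takes some time. *)

theory Defs
  imports "HOL-Probability.Probability" "HOL-Library.Monad_Syntax"
begin

section \<open>Matrices\<close>

definition eigenvalue :: "real^'n^'n \<Rightarrow> real \<Rightarrow> bool" where
  "eigenvalue A l \<longleftrightarrow> (\<exists>v. v \<noteq> 0 \<and> A *v v = l *\<^sub>R v)"

definition lambda_min :: "real^'n^'n \<Rightarrow> real" where
  "lambda_min A = (LEAST l. eigenvalue A l)"

definition spectral_norm :: "real^'n^'n \<Rightarrow> real" where
  "spectral_norm A = onorm ((*v) A)"

definition loewner_le :: "real^'n^'n \<Rightarrow> real^'n^'n \<Rightarrow> bool"  (infix "\<preceq>" 50) where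
  "A \<preceq> B \<longleftrightarrow> (\<forall>x. 0 \<le> x \<bullet> ((B - A) *v x))"

definition nnz :: "real^'n^'n \<Rightarrow> nat" where
  "nnz A = card {(i, j). A $ i $ j \<noteq> 0}"

definition quad :: "real^'n^'n \<Rightarrow> real^'n \<Rightarrow> real \<Rightarrow> real^'n \<Rightarrow> real" where
  "quad A b c x = x \<bullet> (A *v x) + 2 * (b \<bullet> x) + c"


section \<open>The generalized trust region subproblem\<close>

record ('n::finite) gtrs =
  A0 :: "real^'n^'n"
  A1 :: "real^'n^'n"
  b0 :: "real^'n"
  b1 :: "real^'n"
  c0 :: real
  c1 :: real

definition q0 :: "'n::finite gtrs \<Rightarrow> real^'n \<Rightarrow> real" where
  "q0 P = quad (A0 P) (b0 P) (c0 P)"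

definition q1 :: "'n::finite gtrs \<Rightarrow> real^'n \<Rightarrow> real" where
  "q1 P = quad (A1 P) (b1 P) (c1 P)"

definition Opt :: "'n::finite gtrs \<Rightarrow> real" where
  "Opt P = (INF x\<in>{x. q1 P x \<le> 0}. q0 P x)"

definition approx_optimizer :: "'n::finite gtrs \<Rightarrow> real \<Rightarrow> real^'n \<Rightarrow> bool" where
  "approx_optimizer P \<epsilon> x \<longleftrightarrow> q0 P x \<le> Opt P + \<epsilon> \<and> q1 P x \<le> \<epsilon>"

definition Apen :: "'n::finite gtrs \<Rightarrow> real \<Rightarrow> real^'n^'n" where
  "Apen P \<gamma> = A0 P + \<gamma> *\<^sub>R A1 P"

definition bpen :: "'n::finite gtrs \<Rightarrow> real \<Rightarrow> real^'n" where
  "bpen P \<gamma> = b0 P + \<gamma> *\<^sub>R b1 P"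

definition cpen :: "'n::finite gtrs \<Rightarrow> real \<Rightarrow> real" where
  "cpen P \<gamma> = c0 P + \<gamma> * c1 P"

definition qpen :: "'n::finite gtrs \<Rightarrow> real \<Rightarrow> real^'n \<Rightarrow> real" where
  "qpen P \<gamma> x = q0 P x + \<gamma> * q1 P x"

definition mu :: "'n::finite gtrs \<Rightarrow> real \<Rightarrow> real" where
  "mu P \<gamma> = lambda_min (Apen P \<gamma>)"

definition Gamma_set :: "'n::finite gtrs \<Rightarrow> real set" where
  "Gamma_set P = {\<gamma>. 0 \<le> \<gamma> \<and> 0 \<preceq> Apen P \<gamma>}"

definition gamma_plus :: "'n::finite gtrs \<Rightarrow> real" where
  "gamma_plus P = Sup (Gamma_set P)"

text \<open>The dual function takes the value \<open>-\<infinity>\<close>, hence the extended reals.\<close>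

definition dual :: "'n::finite gtrs \<Rightarrow> real \<Rightarrow> ereal" where
  "dual P \<gamma> = (INF x. ereal (qpen P \<gamma> x))"

definition dual_argmax :: "'n::finite gtrs \<Rightarrow> real set" where
  "dual_argmax P = {\<gamma>. 0 \<le> \<gamma> \<and> (\<forall>\<gamma>'\<ge>0. dual P \<gamma>' \<le> dual P \<gamma>)}"

definition gamma_star :: "'n::finite gtrs \<Rightarrow> real" where
  "gamma_star P =
    (if \<exists>!\<gamma>. \<gamma> \<in> dual_argmax P then THE \<gamma>. \<gamma> \<in> dual_argmax P
     else LEAST \<gamma>. \<gamma> \<in> Gamma_set P \<and> (\<forall>\<gamma>'\<in>Gamma_set P. mu P \<gamma>' \<le> mu P \<gamma>))"

definition mu_star :: "'n::finite gtrs \<Rightarrow> real" where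
  "mu_star P = mu P (gamma_star P)"


section \<open>Computations with an operation count\<close>

text \<open>A run consists of a result (\<open>None\<close> if the computation fails to produce one) and the number
  of elementary arithmetic operations spent.\<close>

type_synonym 'a run = "'a option \<times> nat"

definition ret :: "'a \<Rightarrow> 'a run" where
  "ret x = (Some x, 0)"

definition fail :: "'a run" where
  "fail = (None, 0)"

definition charge :: "nat \<Rightarrow> unit run" where
  "charge k = (Some (), k)"

definition call :: "'a \<times> nat \<Rightarrow> 'a run" where
  "call y = (Some (fst y), snd y)"

definition run_bind :: "'a run \<Rightarrow> ('a \<Rightarrow> 'b run) \<Rightarrow> 'b run" where
  "run_bind m f =
    (case fst m of None \<Rightarrow> (None, snd m) | Some x \<Rightarrow> (fst (f x), snd m + snd (f x)))"

adhoc_overloading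
  Monad_Syntax.bind \<rightleftharpoons> run_bind


section \<open>Black-box subroutines\<close>

text \<open>The randomized eigenvector routine takes its random seed as last argument.
  Each routine returns its output together with its operation count.\<close>

record ('s, 'n::finite) solvers =
  approx_eig :: "real^'n^'n \<Rightarrow> real \<Rightarrow> real \<Rightarrow> real \<Rightarrow> 's \<Rightarrow> (real^'n) \<times> nat"
  conj_grad :: "real^'n^'n \<Rightarrow> real^'n \<Rightarrow> real \<Rightarrow> real \<Rightarrow> real \<Rightarrow> (real^'n) \<times> nat"
  acc_minimax :: "real^'n^'n \<Rightarrow> real^'n \<Rightarrow> real \<Rightarrow> real^'n^'n \<Rightarrow> real^'n \<Rightarrow> real
    \<Rightarrow> real \<Rightarrow> real \<Rightarrow> real \<Rightarrow> (real^'n) \<times> nat"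

text \<open>\<open>K\<close> is the constant implicit in the three big-O running times. To keep these contracts
  satisfiable by actual routines, \<open>2 +\<close> is added to the arguments of logarithms (which could
  otherwise be close to or below 1), the number of nonzeros is replaced by its maximum with \<open>n\<close>
  (a sparse or zero matrix still requires work on \<open>n\<close>-vectors), and \<open>\<delta> \<le> \<rho>\<close> is required of the eigenvector
  routine. All of this only weakens what is assumed of the routines.\<close>

definition approx_eig_spec ::
  "real \<Rightarrow> 's measure
    \<Rightarrow> (real^'n^'n \<Rightarrow> real \<Rightarrow> real \<Rightarrow> real \<Rightarrow> 's \<Rightarrow> (real^'n) \<times> nat) \<Rightarrow> bool" where
  "approx_eig_spec K M f \<longleftrightarrow>
    (\<forall>A \<rho> \<delta> q. transpose A = A \<and> spectral_norm A \<le> \<rho> \<and> 0 < \<delta> \<and> \<delta> \<le> \<rho> \<and> 0 < q \<and> q < 1 \<longrightarrow>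
      f A \<rho> \<delta> q \<in> M \<rightarrow>\<^sub>M borel \<Otimes>\<^sub>M count_space UNIV \<and>
      measure M {s \<in> space M.
        norm (fst (f A \<rho> \<delta> q s)) = 1 \<and>
        fst (f A \<rho> \<delta> q s) \<bullet> (A *v fst (f A \<rho> \<delta> q s)) \<le> lambda_min A + \<delta> \<and>
        real (snd (f A \<rho> \<delta> q s))
          \<le> K * real (max CARD('n) (nnz A)) * sqrt (\<rho> / \<delta>) * log 2 (2 + real CARD('n) / q)}
      \<ge> 1 - q)"

definition conj_grad_spec ::
  "real \<Rightarrow> (real^'n^'n \<Rightarrow> real^'n \<Rightarrow> real \<Rightarrow> real \<Rightarrow> real \<Rightarrow> (real^'n) \<times> nat) \<Rightarrow> bool" where
  "conj_grad_spec K f \<longleftrightarrow>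
    (\<forall>A b m \<rho> \<delta>. transpose A = A \<and> 0 < m \<and> mat m \<preceq> A \<and> A \<preceq> mat \<rho> \<and> 0 < \<delta> \<longrightarrow>
      norm (fst (f A b m \<rho> \<delta>) + matrix_inv A *v b) \<le> \<delta> \<and>
      real (snd (f A b m \<rho> \<delta>))
        \<le> K * real (max CARD('n) (nnz A)) * sqrt (\<rho> / m) * log 2 (2 + norm b / (m * \<delta>)))"

definition acc_minimax_spec ::
  "real \<Rightarrow> (real^'n^'n \<Rightarrow> real^'n \<Rightarrow> real \<Rightarrow> real^'n^'n \<Rightarrow> real^'n \<Rightarrow> real
    \<Rightarrow> real \<Rightarrow> real \<Rightarrow> real \<Rightarrow> (real^'n) \<times> nat) \<Rightarrow> bool" where
  "acc_minimax_spec K f \<longleftrightarrow>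
    (\<forall>A b c A' b' c' m \<rho> \<delta>.
      transpose A = A \<and> transpose A' = A' \<and> 0 < m \<and>
      mat m \<preceq> A \<and> A \<preceq> mat \<rho> \<and> mat m \<preceq> A' \<and> A' \<preceq> mat \<rho> \<and>
      norm b \<le> \<rho> \<and> norm b' \<le> \<rho> \<and> 0 < \<delta> \<longrightarrow>
      (let (x, k) = f A b c A' b' c' m \<rho> \<delta> in
        (\<forall>y. max (quad A b c x) (quad A' b' c' x) \<le> max (quad A b c y) (quad A' b' c' y) + \<delta>) \<and>
        real k \<le> K * real (max CARD('n) (nnz A + nnz A')) * sqrt (\<rho> / m)
          * log 2 (2 + \<rho> / (\<delta> * m))))"

definition solvers_spec :: "real \<Rightarrow> 's measure \<Rightarrow> ('s, 'n::finite) solvers \<Rightarrow> bool" where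
  "solvers_spec K M S \<longleftrightarrow>
    approx_eig_spec K M (approx_eig S) \<and> conj_grad_spec K (conj_grad S) \<and>
    acc_minimax_spec K (acc_minimax S)"


section \<open>The algorithm\<close>

text \<open>Operation counts: forming \<open>A(\<gamma>)\<close> and \<open>b(\<gamma>)\<close>, and evaluating a quadratic function with
  matrix \<open>A\<close> at a point. The literal numbers charged below account for scalar operations.\<close>

definition ops_pencil :: "'n::finite gtrs \<Rightarrow> nat" where
  "ops_pencil P = 2 * nnz (A1 P) + 2 * CARD('n)"

definition ops_quad :: "real^'n^'n \<Rightarrow> nat" where
  "ops_quad A = 2 * nnz A + 4 * CARD('n) + 4"

definition approx_nu ::
  "('s, 'n::finite) solvers \<Rightarrow> 'n gtrs \<Rightarrow> real \<Rightarrow> real \<Rightarrow> real \<Rightarrow> real \<Rightarrow> ((real^'n) \<times> real) run" where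
  "approx_nu S P \<zeta> m \<delta> \<gamma> = do {
     charge (ops_pencil P + ops_quad (A1 P) + 10);
     x \<leftarrow> call (conj_grad S (Apen P \<gamma>) (bpen P \<gamma>) m (2 * \<zeta>) (m * \<delta> / (10 * \<zeta>)));
     ret (x, q1 P x)
   }"

text \<open>The left and right variants of a procedure are treated together: \<open>LeftSide\<close> refers to the part of
  \<open>\<Gamma>\<close> to the left of \<open>\<gamma>h\<close>, \<open>RightSide\<close> to the part to the right.\<close>

datatype side = LeftSide | RightSide

text \<open>\<open>bisect_loop \<dots> k l r\<close> performs at most \<open>k\<close> further bisection steps on \<open>[l, r]\<close>;
  \<open>s k\<close> is the seed of the corresponding call.\<close>

primrec bisect_loop ::
  "('s, 'n::finite) solvers \<Rightarrow> 'n gtrs \<Rightarrow> real \<Rightarrow> side \<Rightarrow> real \<Rightarrow> real \<Rightarrow> (nat \<Rightarrow> 's)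
    \<Rightarrow> nat \<Rightarrow> real \<Rightarrow> real \<Rightarrow> (real \<times> (real^'n)) run" where
  "bisect_loop S P \<zeta> d m q s 0 l r = fail"
| "bisect_loop S P \<zeta> d m q s (Suc k) l r = do {
     let \<gamma> = (l + r) / 2;
     charge (ops_pencil P + 10);
     x \<leftarrow> call (approx_eig S (Apen P \<gamma>) (2 * \<zeta>) (m / 8) q (s (Suc k)));
     charge (ops_quad (Apen P \<gamma>));
     let mh = x \<bullet> (Apen P \<gamma> *v x);
     if mh > m then
       (case d of LeftSide \<Rightarrow> bisect_loop S P \<zeta> d m q s k l \<gamma> | RightSide \<Rightarrow> bisect_loop S P \<zeta> d m q s k \<gamma> r)
     else if mh < 5 / 8 * m then
       (case d of LeftSide \<Rightarrow> bisect_loop S P \<zeta> d m q s k \<gamma> r | RightSide \<Rightarrow> bisect_loop S P \<zeta> d m q s k l \<gamma>)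
     else ret (\<gamma>, x)
   }"

text \<open>Rounded logarithms are found by repeated doubling, at a cost proportional to their value.\<close>

definition approx_gamma ::
  "('s, 'n::finite) solvers \<Rightarrow> 'n gtrs \<Rightarrow> real \<Rightarrow> real \<Rightarrow> side \<Rightarrow> real \<Rightarrow> real \<Rightarrow> (nat \<Rightarrow> 's)
    \<Rightarrow> (real \<times> (real^'n)) run" where
  "approx_gamma S P \<zeta> \<gamma>h d m p s = do {
     let T = nat \<lceil>log 2 (5 * \<zeta> / m)\<rceil>;
     charge (2 * T + 10);
     (case d of
        LeftSide \<Rightarrow> bisect_loop S P \<zeta> LeftSide m (p / T) s T 0 \<gamma>h
      | RightSide \<Rightarrow> bisect_loop S P \<zeta> RightSide m (p / T) s T \<gamma>h \<zeta>)
   }"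

datatype ('n::finite) reform =
  Regular real real real
| MaybeRegular "real^'n"
| NotRegular "real^'n"

definition cr_finish ::
  "'n::finite gtrs \<Rightarrow> real \<Rightarrow> real^'n \<Rightarrow> real^'n \<Rightarrow> 'n reform run" where
  "cr_finish P \<gamma> x v = do {
     charge (ops_pencil P + ops_quad (Apen P \<gamma>) + 3 * ops_quad (A1 P) + 4 * CARD('n) + 20);
     let v' = (if v \<bullet> (Apen P \<gamma> *v x + bpen P \<gamma>) \<le> 0 then v else - v);
     let \<alpha> = (SOME \<alpha>. 0 < \<alpha> \<and> q1 P (x + \<alpha> *\<^sub>R v') = 0);
     ret (NotRegular (x + \<alpha> *\<^sub>R v'))
   }"

primrec sgn_side :: "side \<Rightarrow> real" where
  "sgn_side LeftSide = 1"
| "sgn_side RightSide = - 1"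

primrec regular_on :: "side \<Rightarrow> real \<Rightarrow> real \<Rightarrow> real \<Rightarrow> 'n::finite reform" where
  "regular_on LeftSide \<gamma>h \<gamma> m = Regular \<gamma> \<gamma>h m"
| "regular_on RightSide \<gamma>h \<gamma> m = Regular \<gamma>h \<gamma> m"

text \<open>\<open>cr_loop \<dots> T k\<close> performs the iterations \<open>t = T - k + 1, \<dots>, T\<close>. For \<open>RightSide\<close> the tests
  \<open>\<nu> + \<epsilon>/(4\<zeta>) < 0\<close> read \<open>- \<nu> - \<epsilon>/(4\<zeta>) > 0\<close>.\<close>

primrec cr_loop ::
  "('s, 'n::finite) solvers \<Rightarrow> 'n gtrs \<Rightarrow> real \<Rightarrow> real \<Rightarrow> real \<Rightarrow> real \<Rightarrow> real \<Rightarrow> side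
    \<Rightarrow> (nat \<times> nat \<Rightarrow> 's) \<Rightarrow> nat \<Rightarrow> nat \<Rightarrow> 'n reform run" where
  "cr_loop S P \<xi> \<zeta> \<gamma>h \<epsilon> p d \<omega> T 0 = fail"
| "cr_loop S P \<xi> \<zeta> \<gamma>h \<epsilon> p d \<omega> T (Suc k) = do {
     let t = T - k;
     let m = \<xi> / 2 ^ t;
     let \<tau> = \<epsilon> / (4 * \<zeta>);
     charge 10;
     (\<gamma>, v) \<leftarrow> approx_gamma S P \<zeta> \<gamma>h d m (p / T) (\<lambda>j. \<omega> (t, j));
     (x, \<nu>) \<leftarrow> approx_nu S P \<zeta> (m / 2) \<tau> \<gamma>;
     if sgn_side d * \<nu> - \<tau> > 0 then ret (regular_on d \<gamma>h \<gamma> (m / 4))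
     else if \<nu> \<in> {- \<tau>..\<tau>} then do {
       let \<gamma>' = \<gamma> - sgn_side d * (m / 4);
       (x', \<nu>') \<leftarrow> approx_nu S P \<zeta> (m / 4) \<tau> \<gamma>';
       if sgn_side d * \<nu>' - \<tau> > 0 then ret (regular_on d \<gamma>h \<gamma>' (m / 4))
       else ret (MaybeRegular x)
     }
     else if k = 0 then cr_finish P \<gamma> x v
     else cr_loop S P \<xi> \<zeta> \<gamma>h \<epsilon> p d \<omega> T k
   }"

definition cr_side ::
  "('s, 'n::finite) solvers \<Rightarrow> 'n gtrs \<Rightarrow> real \<Rightarrow> real \<Rightarrow> real \<Rightarrow> real \<Rightarrow> real \<Rightarrow> side
    \<Rightarrow> (nat \<times> nat \<Rightarrow> 's) \<Rightarrow> 'n reform run" where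
  "cr_side S P \<xi> \<zeta> \<gamma>h \<epsilon> p d \<omega> = do {
     let T = nat \<lceil>log 2 (3200 * \<zeta> ^ 4 / (\<epsilon> * \<xi> ^ 3))\<rceil>;
     charge (2 * T + 20);
     cr_loop S P \<xi> \<zeta> \<gamma>h \<epsilon> p d \<omega> T T
   }"

definition cr_mid ::
  "('s, 'n::finite) solvers \<Rightarrow> 'n gtrs \<Rightarrow> real \<Rightarrow> real \<Rightarrow> real \<Rightarrow> real \<Rightarrow> real^'n
    \<Rightarrow> 'n reform run" where
  "cr_mid S P \<xi> \<zeta> \<gamma>h \<epsilon> x0 = do {
     let \<tau> = \<epsilon> / (4 * \<zeta>);
     let \<gamma>' = \<gamma>h - \<xi> / 2;
     let \<gamma>'' = \<gamma>h + \<xi> / 2;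
     charge 10;
     (x', \<nu>') \<leftarrow> approx_nu S P \<zeta> (\<xi> / 2) \<tau> \<gamma>';
     (x'', \<nu>'') \<leftarrow> approx_nu S P \<zeta> (\<xi> / 2) \<tau> \<gamma>'';
     if \<nu>' - \<tau> > 0 \<and> 0 > \<nu>'' + \<tau> then ret (Regular \<gamma>' \<gamma>'' (\<xi> / 2))
     else ret (MaybeRegular x0)
   }"

definition construct_reform ::
  "('s, 'n::finite) solvers \<Rightarrow> 'n gtrs \<Rightarrow> real \<Rightarrow> real \<Rightarrow> real \<Rightarrow> real \<Rightarrow> real
    \<Rightarrow> (nat \<times> nat \<Rightarrow> 's) \<Rightarrow> 'n reform run" where
  "construct_reform S P \<xi> \<zeta> \<gamma>h \<epsilon> p \<omega> = do {
     let \<tau> = \<epsilon> / (4 * \<zeta>);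
     charge 10;
     (x0, \<nu>0) \<leftarrow> approx_nu S P \<zeta> \<xi> \<tau> \<gamma>h;
     if \<nu>0 + \<tau> < 0 then cr_side S P \<xi> \<zeta> \<gamma>h \<epsilon> p LeftSide \<omega>
     else if \<nu>0 - \<tau> > 0 then cr_side S P \<xi> \<zeta> \<gamma>h \<epsilon> p RightSide \<omega>
     else cr_mid S P \<xi> \<zeta> \<gamma>h \<epsilon> x0
   }"

definition solve_regular ::
  "('s, 'n::finite) solvers \<Rightarrow> 'n gtrs \<Rightarrow> real \<Rightarrow> real \<Rightarrow> real \<Rightarrow> real \<Rightarrow> real
    \<Rightarrow> (real^'n) run" where
  "solve_regular S P \<zeta> \<epsilon> \<gamma>1 \<gamma>2 m = do {
     charge (2 * ops_pencil P + 20);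
     call (acc_minimax S (Apen P \<gamma>1) (bpen P \<gamma>1) (cpen P \<gamma>1) (Apen P \<gamma>2) (bpen P \<gamma>2) (cpen P \<gamma>2)
       m (2 * \<zeta>) (m * (\<epsilon> * m / (10 * \<zeta>))\<^sup>2))
   }"

definition two_stage ::
  "('s, 'n::finite) solvers \<Rightarrow> 'n gtrs \<Rightarrow> real \<Rightarrow> real \<Rightarrow> real \<Rightarrow> real \<Rightarrow> real
    \<Rightarrow> (nat \<times> nat \<Rightarrow> 's) \<Rightarrow> (real^'n) run" where
  "two_stage S P \<xi> \<zeta> \<gamma>h \<epsilon> p \<omega> = do {
     out \<leftarrow> construct_reform S P \<xi> \<zeta> \<gamma>h \<epsilon> p \<omega>;
     (case out of
        Regular \<gamma>1 \<gamma>2 m \<Rightarrow> solve_regular S P \<zeta> \<epsilon> \<gamma>1 \<gamma>2 m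
      | MaybeRegular x \<Rightarrow> ret x
      | NotRegular x \<Rightarrow> ret x)
   }"


section \<open>The running time bound\<close>

definition phi :: "'n::finite gtrs \<Rightarrow> real \<Rightarrow> real \<Rightarrow> real \<Rightarrow> real" where
  "phi P \<xi> \<zeta> \<epsilon> = max (min (mu_star P) \<xi>) (\<epsilon> * \<xi> ^ 4 / \<zeta> ^ 4)"

text \<open>The dimension is a type parameter, so an existentially quantified constant could depend on
  it. To make the bound uniform in the dimension and in all other data, the absolute constant is
  given explicitly; it depends only on the constant \<open>K\<close> of the subroutines. The last factor is the
  double logarithm hidden in the soft-O. The summand 1 in \<open>1 + log 2 (1 / \<phi>)\<close> is needed because
  \<open>\<phi>\<close> can be arbitrarily close to 1; the other logarithms are at least 1 under the standing
  assumptions.\<close>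

definition time_bound ::
  "real \<Rightarrow> 'n::finite gtrs \<Rightarrow> real \<Rightarrow> real \<Rightarrow> real \<Rightarrow> real \<Rightarrow> real" where
  "time_bound K P \<xi> \<zeta> \<epsilon> p =
    10 ^ 9 * (1 + K) *
    (real (nnz (A0 P) + nnz (A1 P)) * sqrt \<zeta> / sqrt (phi P \<xi> \<zeta> \<epsilon>)
      * (1 + log 2 (1 / phi P \<xi> \<zeta> \<epsilon>))
      * log 2 (real CARD('n) / p)
      * log 2 (\<zeta> / (\<epsilon> * \<xi>)))
    * (1 + log 2 (log 2 (\<zeta> / (\<epsilon> * \<xi>))))"

end

theory Submission
  imports Defs
begin

text \<open>For \<open>\<gamma>\<close> with \<open>A(\<gamma>)\<close> positive definite, the derivative of the concave dual function is
  \<open>nu \<gamma> = q1 (xc \<gamma>)\<close>, where \<open>xc \<gamma>\<close> minimizes \<open>q(\<gamma>, \<cdot>)\<close>. If \<open>nu\<close> changes sign between two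
  points, the minimizer of the maximum of the two quadratics there is an exact optimizer; if \<open>nu\<close>
  nearly vanishes at \<open>\<gamma>\<close>, then \<open>xc \<gamma>\<close> is nearly optimal by weak duality. Otherwise the search moves
  towards the end of \<open>\<Gamma>\<close> until \<open>mu \<gamma>\<close> is so small that a step along an approximate bottom
  eigenvector of \<open>A(\<gamma>)\<close>, which restores \<open>q1 = 0\<close>, hardly changes \<open>q(\<gamma>, \<cdot>)\<close>.

  A stage works at the level \<open>mu \<gamma> \<approx> \<xi> / 2 ^ t\<close>. As the dual optimum lies beyond every point visited
  so far, the level never drops much below \<open>\<phi>\<close>, and the costs of the stages form a geometric series
  dominated by the last one. Since every call of the eigenvector routine uses a fresh independent
  seed, a union bound over the calls applies although their arguments depend on earlier outcomes.\<close>

section \<open>Symmetric matrices\<close>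

text \<open>The levels stop near \<open>\<epsilon> * \<xi>^4 / (3200 * \<zeta>^4)\<close> because
  the final step along a bottom vector may be as long as \<open>35 * (\<zeta> / \<xi>)^2\<close>,
  and its square multiplies the remaining curvature. Up to a constant this threshold is the floor in
  \<open>phi\<close>. The other term of \<open>phi\<close>, \<open>mu_star P\<close>, is accessible
  only where the dual maximizer is known to be unique. A nonzero \<open>nu \<gamma>h\<close>
  guarantees this; the remaining case never searches and works at level \<xi>, which
  \<open>phi\<close> does not exceed. Randomness is isolated in one event on the seeds, fixed in
  advance by the exact sign of \<open>nu \<gamma>h\<close>; on it everything else is deterministic.
  Parameter ratios are bounded by powers of \<open>R = \<zeta> / (\<epsilon> * \<xi>)\<close>, and
  numeric constants too since \<open>2 \<le> R\<close>: \<open>mu\<close> falls from at least \<xi>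
  at \<open>\<gamma>h\<close> to at most 0 at both 0 and \<zeta>. The double logarithm comes from
  splitting the failure probability over about \<open>Lg^2\<close> calls.\<close>

lemma symmetric_inner:
  fixes A :: "real^'n^'n"
  assumes "transpose A = A"
  shows "(A *v x) \<bullet> y = x \<bullet> (A *v y)"
  by (metis assms dot_lmul_matrix vector_transpose_matrix)

lemma mat_mult_vec: "mat (c::real) *v x = c *\<^sub>R x"
  by (simp add: vec_eq_iff matrix_vector_mult_def mat_def if_distrib if_distribR sum.delta cong: if_cong)

lemma loewner_mat_le_iff: "mat m \<preceq> A \<longleftrightarrow> (\<forall>x. m * (x \<bullet> x) \<le> x \<bullet> (A *v x))"
  by (simp add: loewner_le_def matrix_vector_mult_diff_rdistrib inner_diff_right mat_mult_vec)

lemma loewner_le_mat_iff: "A \<preceq> mat m \<longleftrightarrow> (\<forall>x. x \<bullet> (A *v x) \<le> m * (x \<bullet> x))"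
  by (simp add: loewner_le_def matrix_vector_mult_diff_rdistrib inner_diff_right mat_mult_vec)

lemma loewner_0_le_iff: "0 \<preceq> A \<longleftrightarrow> (\<forall>x. 0 \<le> x \<bullet> (A *v x))"
  by (simp add: loewner_le_def)

text \<open>Expanding \<open>(v + t Bv)\<bullet>B(v + t Bv) \<ge> 0\<close> for small negative \<open>t\<close>.\<close>

lemma psd_null_vector:
  fixes B :: "real^'n^'n"
  assumes sym: "transpose B = B" and psd: "\<And>x. 0 \<le> x \<bullet> (B *v x)" and v: "v \<bullet> (B *v v) = 0"
  shows "B *v v = 0"
proof (rule ccontr)
  define w where "w = B *v v"
  assume "B *v v \<noteq> 0"
  then have w: "w \<bullet> w > 0" by (simp add: w_def)
  define c where "c = w \<bullet> (B *v w)"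
  have exp: "0 \<le> 2 * t * (w \<bullet> w) + t\<^sup>2 * c" for t
  proof -
    have "(v + t *\<^sub>R w) \<bullet> (B *v (v + t *\<^sub>R w))
        = v \<bullet> (B *v v) + t * (v \<bullet> (B *v w)) + t * (w \<bullet> (B *v v)) + t\<^sup>2 * c"
      by (simp add: matrix_vector_right_distrib matrix_vector_mult_scaleR inner_add_left inner_add_right
          c_def power2_eq_square algebra_simps)
    also have "v \<bullet> (B *v w) = w \<bullet> w"
      using symmetric_inner[OF sym, of v w] by (simp add: w_def)
    finally show ?thesis
      using psd[of "v + t *\<^sub>R w"] v by (simp add: w_def)
  qed
  have c: "0 \<le> c" unfolding c_def by (rule psd)
  \<comment> \<open>At \<open>t = - k\<close> the expression in \<open>exp\<close> is negative
    because \<open>k * c < w \<bullet> w\<close>; the summand 1 covers \<open>c = 0\<close>.\<close>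
  define k where "k = (w \<bullet> w) / (c + 1)"
  have k: "0 < k" and kc: "k * (c + 1) = w \<bullet> w" using c w by (simp_all add: k_def)
  have kc2: "k * c < w \<bullet> w" using k unfolding kc[symmetric] by (simp add: algebra_simps)
  have "k * (k * c) < k * (2 * (w \<bullet> w))" by (rule mult_strict_left_mono[OF _ k]) (use kc2 w in linarith)
  then show False using exp[of "- k"] by (simp add: power2_eq_square algebra_simps)
qed

lemma continuous_on_matrix_vector [continuous_intros]:
  fixes A :: "real^'n^'m"
  assumes "continuous_on S f"
  shows "continuous_on S (\<lambda>x. A *v f x)"
  by (rule bounded_linear.continuous_on[OF matrix_vector_mul_bounded_linear assms])

text \<open>Compactness of the sphere yields a minimizer \<open>v\<close> of the form. With
  \<open>l\<close> its value, \<open>A - mat l\<close> is positive semidefinite and its form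
  vanishes at \<open>v\<close>, so \<open>psd_null_vector\<close> makes \<open>v\<close> an
  eigenvector.\<close>

lemma rayleigh:
  fixes A :: "real^'n^'n"
  assumes sym: "transpose A = A"
  obtains l v where "norm v = 1" "A *v v = l *\<^sub>R v" "\<And>x. l * (x \<bullet> x) \<le> x \<bullet> (A *v x)"
proof -
  have "\<exists>v\<in>sphere 0 1. \<forall>x\<in>sphere 0 1. v \<bullet> (A *v v) \<le> x \<bullet> (A *v x)"
  proof (rule continuous_attains_inf)
    show "continuous_on (sphere 0 1) (\<lambda>x. x \<bullet> (A *v x))"
      by (intro continuous_intros)
  qed auto
  then obtain v where v: "norm v = 1" and min: "\<And>x. norm x = 1 \<Longrightarrow> v \<bullet> (A *v v) \<le> x \<bullet> (A *v x)"
    by auto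
  define l where "l = v \<bullet> (A *v v)"
  have ray: "l * (x \<bullet> x) \<le> x \<bullet> (A *v x)" for x
  proof (cases "x = 0")
    case False
    define u where "u = x /\<^sub>R norm x"
    have "norm u = 1" using False by (simp add: u_def)
    from min[OF this] have "l \<le> u \<bullet> (A *v u)" by (simp add: l_def)
    also have "\<dots> = (x \<bullet> (A *v x)) / (x \<bullet> x)"
      using False by (simp add: u_def matrix_vector_mult_scaleR field_simps power2_norm_eq_inner[symmetric] power2_eq_square)
    finally show ?thesis using False by (simp add: field_simps)
  qed simp
  define B where "B = A - mat l"
  have symB: "transpose B = B"
    using sym by (simp add: B_def transpose_def vec_eq_iff mat_def)
  have "B *v x = A *v x - l *\<^sub>R x" for x
    by (simp add: B_def matrix_vector_mult_diff_rdistrib mat_mult_vec)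
  moreover from this have "B *v v = 0"
    using ray v by (intro psd_null_vector symB)
      (auto simp: inner_diff_right l_def power2_norm_eq_inner[symmetric])
  ultimately show ?thesis using v ray that[of v l] by simp
qed

text \<open>\<open>LEAST\<close> says nothing until a least eigenvalue is known to exist;
  \<open>rayleigh\<close> supplies it. From here on \<open>lambda_min\<close> is handled as the
  minimum of the Rayleigh quotient.\<close>

lemma
  fixes A :: "real^'n^'n"
  assumes sym: "transpose A = A"
  shows lambda_min_le: "lambda_min A * (x \<bullet> x) \<le> x \<bullet> (A *v x)"
    and lambda_min_attained: "\<exists>v. norm v = 1 \<and> v \<bullet> (A *v v) = lambda_min A"
proof -
  obtain l v where v: "norm v = 1" "A *v v = l *\<^sub>R v" and ray: "\<And>x. l * (x \<bullet> x) \<le> x \<bullet> (A *v x)"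
    using rayleigh[OF sym] by blast
  have "lambda_min A = l"
    unfolding lambda_min_def
  proof (rule Least_equality)
    show "eigenvalue A l" using v unfolding eigenvalue_def by (metis norm_zero zero_neq_one)
    fix y assume "eigenvalue A y"
    then obtain u where "u \<noteq> 0" "A *v u = y *\<^sub>R u" by (auto simp: eigenvalue_def)
    then show "l \<le> y" using ray[of u] by simp
  qed
  then show "lambda_min A * (x \<bullet> x) \<le> x \<bullet> (A *v x)"
    and "\<exists>v. norm v = 1 \<and> v \<bullet> (A *v v) = lambda_min A"
    using ray v by (auto intro!: exI[of _ v] simp: power2_norm_eq_inner[symmetric])
qed

lemma le_lambda_min_iff:
  fixes A :: "real^'n^'n"
  assumes sym: "transpose A = A"
  shows "m \<le> lambda_min A \<longleftrightarrow> mat m \<preceq> A"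
proof
  assume "m \<le> lambda_min A"
  then show "mat m \<preceq> A"
    unfolding loewner_mat_le_iff
    by (meson lambda_min_le[OF sym] inner_ge_zero mult_right_mono order_trans)
next
  assume "mat m \<preceq> A"
  with lambda_min_attained[OF sym] show "m \<le> lambda_min A"
    unfolding loewner_mat_le_iff by (metis mult.right_neutral norm_eq_1)
qed

lemma lambda_min_neg:
  fixes A :: "real^'n^'n"
  assumes sym: "transpose A = A" and "\<exists>l<0. eigenvalue A l"
  shows "lambda_min A < 0"
proof -
  obtain l v where "l < 0" "v \<noteq> 0" "A *v v = l *\<^sub>R v"
    using assms(2) by (auto simp: eigenvalue_def)
  then have "lambda_min A * (v \<bullet> v) \<le> l * (v \<bullet> v)"
    using lambda_min_le[OF sym, of v] by simp
  with \<open>l < 0\<close> \<open>v \<noteq> 0\<close> show ?thesis by simp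
qed

lemma norm_matrix_vector_le:
  fixes A :: "real^'n^'n"
  assumes "spectral_norm A \<le> r"
  shows "norm (A *v x) \<le> r * norm x"
proof -
  have "norm (A *v x) \<le> spectral_norm A * norm x"
    unfolding spectral_norm_def by (rule onorm) simp
  also have "\<dots> \<le> r * norm x" using assms by (rule mult_right_mono) simp
  finally show ?thesis .
qed

lemma abs_quadratic_form_le:
  fixes A :: "real^'n^'n"
  assumes "spectral_norm A \<le> r"
  shows "\<bar>x \<bullet> (A *v x)\<bar> \<le> r * (x \<bullet> x)"
proof -
  have "\<bar>x \<bullet> (A *v x)\<bar> \<le> norm x * norm (A *v x)" by (rule Cauchy_Schwarz_ineq2)
  also have "\<dots> \<le> norm x * (r * norm x)"
    by (intro mult_left_mono norm_matrix_vector_le assms) simp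
  finally show ?thesis by (simp add: power2_norm_eq_inner[symmetric] power2_eq_square mult_ac)
qed

lemma matrix_inv_solves:
  fixes A :: "real^'n^'n"
  assumes "0 < m" "mat m \<preceq> A"
  shows "A *v (matrix_inv A *v b) = b"
proof -
  have "x = 0" if "A *v x = 0" for x
  proof -
    have "m * (x \<bullet> x) \<le> 0" using assms(2) that by (auto simp: loewner_mat_le_iff dest: spec[of _ x])
    then have "x \<bullet> x \<le> 0" using assms(1) by (simp add: mult_le_0_iff)
    then show ?thesis using inner_gt_zero_iff[of x] by linarith
  qed
  then have "inj ((*v) A)" by (simp add: linear_injective_0)
  then have "invertible A"
    using invertible_left_inverse matrix_left_invertible_injective by blast
  then have "A ** matrix_inv A = mat 1"
    unfolding invertible_def matrix_inv_def by (metis (mono_tags, lifting) someI_ex)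
  then show ?thesis by (simp add: matrix_vector_mul_assoc)
qed

section \<open>Quadratic functions\<close>

lemma quad_add:
  fixes A :: "real^'n^'n"
  assumes sym: "transpose A = A"
  shows "quad A b c (x + d) = quad A b c x + 2 * ((A *v x + b) \<bullet> d) + d \<bullet> (A *v d)"
proof -
  have "x \<bullet> (A *v d) = d \<bullet> (A *v x)"
    using symmetric_inner[OF sym, of x d] by (simp add: inner_commute)
  then show ?thesis
    by (simp add: quad_def matrix_vector_right_distrib inner_add_left inner_add_right inner_commute)
qed

lemma quad_perturbation:
  fixes A :: "real^'n^'n"
  assumes "transpose A = A" "spectral_norm A \<le> 1" "norm b \<le> 1"
  shows "\<bar>quad A b c y - quad A b c x\<bar> \<le> 2 * (norm x + 1) * norm (y - x) + (norm (y - x))\<^sup>2"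
proof -
  define d where "d = y - x"
  have y: "y = x + d" by (simp add: d_def)
  have "\<bar>(A *v x + b) \<bullet> d\<bar> \<le> norm (A *v x + b) * norm d" by (rule Cauchy_Schwarz_ineq2)
  also have "\<dots> \<le> (norm x + 1) * norm d"
    using norm_triangle_ineq[of "A *v x" b] norm_matrix_vector_le[OF assms(2), of x] assms(3)
    by (intro mult_right_mono) auto
  finally have "\<bar>2 * ((A *v x + b) \<bullet> d)\<bar> \<le> 2 * (norm x + 1) * norm d"
    by linarith
  moreover have "\<bar>d \<bullet> (A *v d)\<bar> \<le> (norm d)\<^sup>2"
    using abs_quadratic_form_le[OF assms(2), of d] by (simp add: power2_norm_eq_inner)
  ultimately show ?thesis
    unfolding y quad_add[OF assms(1)] by simp
qed

lemma positive_root_ex: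
  fixes a b c :: real
  assumes "0 < a" "0 < c"
  shows "\<exists>t>0. a * t\<^sup>2 + 2 * b * t = c"
proof -
  define s where "s = sqrt (b\<^sup>2 + a * c)"
  have s: "s\<^sup>2 = b\<^sup>2 + a * c" using assms by (simp add: s_def)
  have "\<bar>b\<bar> < s"
    unfolding s_def using assms by (intro real_less_rsqrt) simp
  then have "0 < (s - b) / a" using assms by simp
  moreover have "a * (a * ((s - b) / a)\<^sup>2 + 2 * b * ((s - b) / a)) = a * c"
    using s assms by (simp add: power2_eq_square field_simps)
  then have "a * ((s - b) / a)\<^sup>2 + 2 * b * ((s - b) / a) = c" using assms by simp
  ultimately show ?thesis by blast
qed

section \<open>The pencil\<close>

lemma quad_at_zero_of_grad:
  fixes A :: "real^'n^'n"
  assumes "transpose A = A" "A *v x + b = 0"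
  shows "quad A b c y = quad A b c x + (y - x) \<bullet> (A *v (y - x))"
  using quad_add[OF assms(1), of b c x "y - x"] assms(2) by simp

lemma convex_coeff:
  fixes a b g :: real
  assumes "a < g" "g < b"
  obtains s where "0 < s" "s < 1" "g = (1 - s) * a + s * b"
proof
  define s where "s = (g - a) / (b - a)"
  show "0 < s" "s < 1" using assms by (auto simp: s_def)
  have "s * (b - a) = g - a" using assms by (simp add: s_def)
  then show "g = (1 - s) * a + s * b" by (simp add: algebra_simps)
qed

locale gtrs_instance =
  fixes P :: "'n::finite gtrs" and \<xi> \<zeta> \<gamma>h :: real
  assumes sym0: "transpose (A0 P) = A0 P" and sym1: "transpose (A1 P) = A1 P"
    and neg0: "\<exists>l<0. eigenvalue (A0 P) l" and neg1: "\<exists>l<0. eigenvalue (A1 P) l"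
    and A0_le: "spectral_norm (A0 P) \<le> 1" and A1_le: "spectral_norm (A1 P) \<le> 1"
    and b0_le: "norm (b0 P) \<le> 1" and b1_le: "norm (b1 P) \<le> 1"
    and c0_le: "\<bar>c0 P\<bar> \<le> 1" and c1_le: "\<bar>c1 P\<bar> \<le> 1"
    and \<gamma>h_nonneg: "0 \<le> \<gamma>h" and gamma_plus_le: "gamma_plus P \<le> \<zeta>"
    and \<xi>_le: "mat \<xi> \<preceq> Apen P \<gamma>h"
    and \<xi>_pos: "0 < \<xi>" and \<xi>_le_1: "\<xi> \<le> 1" and \<zeta>_ge_1: "1 \<le> \<zeta>"
begin

lemma sym_Apen: "transpose (Apen P \<gamma>) = Apen P \<gamma>"
  using sym0 sym1 by (simp add: Apen_def transpose_def vec_eq_iff)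

lemma Apen_vec: "Apen P \<gamma> *v x = A0 P *v x + \<gamma> *\<^sub>R (A1 P *v x)"
  by (simp add: Apen_def matrix_vector_mult_add_rdistrib scaleR_matrix_vector_assoc)

lemma Apen_form: "x \<bullet> (Apen P \<gamma> *v x) = x \<bullet> (A0 P *v x) + \<gamma> * (x \<bullet> (A1 P *v x))"
  by (simp add: Apen_vec inner_add_right)

lemma qpen_eq_quad: "qpen P \<gamma> x = quad (Apen P \<gamma>) (bpen P \<gamma>) (cpen P \<gamma>) x"
  by (simp add: qpen_def q0_def q1_def quad_def Apen_form bpen_def cpen_def inner_add_left algebra_simps)

lemma qpen_shift: "qpen P \<gamma>' x = qpen P \<gamma> x + (\<gamma>' - \<gamma>) * q1 P x"
  by (simp add: qpen_def algebra_simps)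

section \<open>The smallest eigenvalue along the pencil\<close>

lemma le_mu_iff: "m \<le> mu P \<gamma> \<longleftrightarrow> mat m \<preceq> Apen P \<gamma>"
  unfolding mu_def by (rule le_lambda_min_iff[OF sym_Apen])

lemma mu_form_le: "m \<le> mu P \<gamma> \<Longrightarrow> m * (norm x)\<^sup>2 \<le> x \<bullet> (Apen P \<gamma> *v x)"
  by (simp add: le_mu_iff loewner_mat_le_iff power2_norm_eq_inner)

lemma mu_attained: obtains v where "norm v = 1" "v \<bullet> (Apen P \<gamma> *v v) = mu P \<gamma>"
  using lambda_min_attained[OF sym_Apen, of \<gamma>] unfolding mu_def by blast

lemma mu_le_form: "norm v = 1 \<Longrightarrow> mu P \<gamma> \<le> v \<bullet> (Apen P \<gamma> *v v)"
  using mu_form_le[of "mu P \<gamma>" \<gamma> v] by simp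

lemma A1_form_le: "norm v = 1 \<Longrightarrow> \<bar>v \<bullet> (A1 P *v v)\<bar> \<le> 1"
  using abs_quadratic_form_le[OF A1_le, of v] by (simp add: power2_norm_eq_inner[symmetric])

text \<open>On unit vectors the form of \<open>A1\<close> lies in \<open>[-1, 1]\<close>, so testing
  \<open>A(\<gamma>)\<close> with a bottom vector of \<open>A(\<gamma>')\<close> loses at most the
  distance. This drives both the termination of the bisection and the safety of shifts such as
  \<open>m / 4\<close>.\<close>

lemma mu_lipschitz: "mu P \<gamma> \<le> mu P \<gamma>' + \<bar>\<gamma> - \<gamma>'\<bar>"
proof -
  obtain v where v: "norm v = 1" "v \<bullet> (Apen P \<gamma>' *v v) = mu P \<gamma>'" using mu_attained .
  have "mu P \<gamma> \<le> v \<bullet> (Apen P \<gamma> *v v)" using v by (intro mu_le_form)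
  also have "\<dots> = mu P \<gamma>' + (\<gamma> - \<gamma>') * (v \<bullet> (A1 P *v v))"
    unfolding v(2)[symmetric] Apen_form by (simp add: algebra_simps)
  also have "(\<gamma> - \<gamma>') * (v \<bullet> (A1 P *v v)) \<le> \<bar>\<gamma> - \<gamma>'\<bar> * 1"
    using A1_form_le[OF v(1)] by (metis abs_ge_self abs_ge_zero abs_mult mult_left_mono order_trans)
  finally show ?thesis by simp
qed

text \<open>For fixed \<open>v\<close> the form of \<open>A(\<gamma>)\<close> is affine in \<gamma>,
  and a minimum of affine functions is concave.\<close>

lemma mu_concave:
  assumes "0 \<le> s" "s \<le> 1"
  shows "(1 - s) * mu P a + s * mu P b \<le> mu P ((1 - s) * a + s * b)"
proof -
  obtain v where v: "norm v = 1" and eq: "v \<bullet> (Apen P ((1 - s) * a + s * b) *v v) = mu P ((1 - s) * a + s * b)"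
    using mu_attained .
  have "(1 - s) * mu P a + s * mu P b
      \<le> (1 - s) * (v \<bullet> (Apen P a *v v)) + s * (v \<bullet> (Apen P b *v v))"
    using assms v by (intro add_mono mult_left_mono mu_le_form) auto
  also have "\<dots> = v \<bullet> (Apen P ((1 - s) * a + s * b) *v v)"
    unfolding Apen_form by (simp add: algebra_simps)
  finally show ?thesis unfolding eq .
qed

lemma mu_min_le:
  assumes "a \<le> g" "g \<le> b"
  shows "min (mu P a) (mu P b) \<le> mu P g"
proof (cases "a < g \<and> g < b")
  case True
  then obtain s where s: "0 < s" "s < 1" "g = (1 - s) * a + s * b" using convex_coeff[of a g b] by blast
  have "min (mu P a) (mu P b) = (1 - s) * min (mu P a) (mu P b) + s * min (mu P a) (mu P b)"
    by (simp add: algebra_simps)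
  also have "\<dots> \<le> (1 - s) * mu P a + s * mu P b"
    using s by (intro add_mono mult_left_mono) auto
  also have "\<dots> \<le> mu P g" using mu_concave[of s a b] s by simp
  finally show ?thesis .
qed (use assms in \<open>auto simp: not_less intro: min.coboundedI1 min.coboundedI2\<close>)

section \<open>Position of the semidefinite interval and of \<open>\<gamma>h\<close> inside
  \<open>[0, \<zeta>]\<close>\<close>

lemma mu_0: "mu P 0 < 0"
  using lambda_min_neg[OF sym0 neg0] by (simp add: mu_def Apen_def)

lemma mu_\<gamma>h: "\<xi> \<le> mu P \<gamma>h"
  using \<xi>_le by (simp add: le_mu_iff)

lemma Gamma_set_iff: "\<gamma> \<in> Gamma_set P \<longleftrightarrow> 0 \<le> \<gamma> \<and> 0 \<le> mu P \<gamma>"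
  by (simp add: Gamma_set_def le_mu_iff loewner_mat_le_iff loewner_0_le_iff)

text \<open>A direction of negative curvature of \<open>A1\<close>, oriented so that the linear term
  is nonpositive, leads into the strictly feasible set; \<open>t\<close> is scaled to outweigh
  \<open>c1\<close>. The point makes \<open>Opt\<close> an infimum over a nonempty set and bounds
  the dual for large multipliers.\<close>

lemma slater: obtains x where "q1 P x < 0"
proof -
  obtain l v where l: "l < 0" and v: "v \<noteq> 0" "A1 P *v v = l *\<^sub>R v"
    using neg1 by (auto simp: eigenvalue_def)
  define u where "u = (if b1 P \<bullet> v \<le> 0 then v else - v)"
  have u: "u \<noteq> 0" "A1 P *v u = l *\<^sub>R u" "b1 P \<bullet> u \<le> 0"
    using v by (auto simp: u_def linear_neg)
  define k where "k = - l * (u \<bullet> u)"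
  have k: "0 < k" using l u by (simp add: k_def mult_neg_pos)
  define t where "t = 1 + 2 / k"
  have t: "1 < t" "k * t = k + 2" using k by (simp_all add: t_def field_simps)
  have "q1 P (t *\<^sub>R u) = - (k * t) * t + 2 * t * (b1 P \<bullet> u) + c1 P"
    by (simp add: q1_def quad_def matrix_vector_mult_scaleR u k_def algebra_simps)
  also have "\<dots> \<le> - (k + 2) * t + c1 P"
    using u t by (simp add: mult_nonneg_nonpos)
  also have "\<dots> < 0"
  proof -
    have "2 * 1 < (k + 2) * t" using k t by (intro mult_strict_mono) auto
    with c1_le show ?thesis by (simp add: algebra_simps)
  qed
  finally show ?thesis by (rule that)
qed

text \<open>\<open>Sup\<close> is an upper bound of a real set only if the set is bounded above.
  Here a unit vector with negative \<open>A1\<close>-form gives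
  \<open>0 \<le> 1 - \<gamma> * k\<close> throughout the set.\<close>

lemma Gamma_set_bdd: "bdd_above (Gamma_set P)"
proof -
  obtain v where v: "norm v = 1" "v \<bullet> (A1 P *v v) < 0"
    using lambda_min_attained[OF sym1] lambda_min_neg[OF sym1 neg1] by metis
  define k where "k = - (v \<bullet> (A1 P *v v))"
  have "\<gamma> \<le> 1 / k" if "\<gamma> \<in> Gamma_set P" for \<gamma>
  proof -
    have "0 \<le> v \<bullet> (Apen P \<gamma> *v v)"
      using that v mu_le_form[of v \<gamma>] unfolding Gamma_set_iff by linarith
    also have "\<dots> \<le> 1 - \<gamma> * k"
      using abs_quadratic_form_le[OF A0_le, of v] v
      by (simp add: Apen_form k_def power2_norm_eq_inner[symmetric])
    finally show ?thesis using v by (simp add: k_def field_simps)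
  qed
  then show ?thesis by (rule bdd_aboveI)
qed

lemma Gamma_set_le: "0 \<le> \<gamma> \<Longrightarrow> 0 \<le> mu P \<gamma> \<Longrightarrow> \<gamma> \<le> \<zeta>"
  using cSup_upper[OF _ Gamma_set_bdd, of \<gamma>] gamma_plus_le by (simp add: gamma_plus_def Gamma_set_iff)

text \<open>Positivity at \<zeta> would leave \<open>mu\<close> nonnegative somewhat beyond \<zeta>
  by the Lipschitz bound, against \<open>gamma_plus P \<le> \<zeta>\<close>.\<close>

lemma mu_\<zeta>: "mu P \<zeta> \<le> 0"
proof (rule ccontr)
  assume *: "\<not> ?thesis"
  have "mu P \<zeta> \<le> mu P (\<zeta> + mu P \<zeta>) + \<bar>\<zeta> - (\<zeta> + mu P \<zeta>)\<bar>" by (rule mu_lipschitz)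
  with * have "0 \<le> mu P (\<zeta> + mu P \<zeta>)" by simp
  with Gamma_set_le[of "\<zeta> + mu P \<zeta>"] * \<zeta>_ge_1 show False by simp
qed

text \<open>A 1-Lipschitz function needs distance \<xi> to fall from \<xi> to 0. Together the two
  bounds give \<open>2 * \<xi> \<le> \<zeta>\<close>, the reason why \<open>R\<close> is at least
  2.\<close>

lemma \<gamma>h_bounds: "\<xi> < \<gamma>h" "\<gamma>h + \<xi> \<le> \<zeta>"
proof -
  show "\<xi> < \<gamma>h" using mu_lipschitz[of \<gamma>h 0] mu_\<gamma>h mu_0 \<gamma>h_nonneg by simp
  have "\<gamma>h \<le> \<zeta>" using Gamma_set_le \<gamma>h_nonneg mu_\<gamma>h \<xi>_pos by simp
  then show "\<gamma>h + \<xi> \<le> \<zeta>" using mu_lipschitz[of \<gamma>h \<zeta>] mu_\<gamma>h mu_\<zeta> by simp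
qed

lemma mu_pos_range:
  assumes "0 < mu P \<gamma>"
  shows "0 < \<gamma>" "\<gamma> < \<zeta>"
proof -
  show "0 < \<gamma>"
  proof (rule ccontr)
    assume "\<not> 0 < \<gamma>"
    then show False using mu_min_le[of \<gamma> 0 \<gamma>h] assms mu_\<gamma>h mu_0 \<xi>_pos \<gamma>h_nonneg by simp
  qed
  show "\<gamma> < \<zeta>"
  proof (rule ccontr)
    assume "\<not> \<gamma> < \<zeta>"
    then show False using Gamma_set_le[of \<gamma>] assms mu_\<zeta> \<zeta>_ge_1 by (cases "\<gamma> = \<zeta>") auto
  qed
qed

section \<open>Uniform bounds on the pencil over \<open>[0, \<zeta>]\<close>\<close>

lemma Apen_spectral_norm:
  assumes "0 \<le> \<gamma>" "\<gamma> \<le> \<zeta>"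
  shows "spectral_norm (Apen P \<gamma>) \<le> 2 * \<zeta>"
  unfolding spectral_norm_def
proof (rule onorm_le)
  fix x
  have "norm (Apen P \<gamma> *v x) \<le> norm (A0 P *v x) + \<gamma> * norm (A1 P *v x)"
    unfolding Apen_vec using norm_triangle_ineq[of "A0 P *v x" "\<gamma> *\<^sub>R (A1 P *v x)"] assms by simp
  also have "\<dots> \<le> norm x + \<zeta> * norm x"
    using norm_matrix_vector_le[OF A0_le, of x] norm_matrix_vector_le[OF A1_le, of x] assms \<zeta>_ge_1
    by (intro add_mono mult_mono) auto
  also have "\<dots> \<le> \<zeta> * norm x + \<zeta> * norm x"
    using \<zeta>_ge_1 by (simp add: mult_le_cancel_right1)
  finally show "norm (Apen P \<gamma> *v x) \<le> 2 * \<zeta> * norm x" by simp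
qed

lemma Apen_form_le:
  assumes "0 \<le> \<gamma>" "\<gamma> \<le> \<zeta>"
  shows "x \<bullet> (Apen P \<gamma> *v x) \<le> 2 * \<zeta> * (norm x)\<^sup>2"
  using abs_quadratic_form_le[OF Apen_spectral_norm[OF assms], of x] by (simp add: power2_norm_eq_inner)

lemma Apen_loewner_le: "0 \<le> \<gamma> \<Longrightarrow> \<gamma> \<le> \<zeta> \<Longrightarrow> Apen P \<gamma> \<preceq> mat (2 * \<zeta>)"
  using Apen_form_le by (simp add: loewner_le_mat_iff power2_norm_eq_inner)

lemma bpen_norm:
  assumes "0 \<le> \<gamma>" "\<gamma> \<le> \<zeta>"
  shows "norm (bpen P \<gamma>) \<le> 2 * \<zeta>"
proof -
  have "norm (bpen P \<gamma>) \<le> norm (b0 P) + \<gamma> * norm (b1 P)"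
    unfolding bpen_def using norm_triangle_ineq[of "b0 P" "\<gamma> *\<^sub>R b1 P"] assms by simp
  also have "\<dots> \<le> 1 + \<zeta> * 1" using assms b0_le b1_le \<zeta>_ge_1 by (intro add_mono mult_mono) auto
  finally show ?thesis using \<zeta>_ge_1 by simp
qed

lemma cpen_abs:
  assumes "0 \<le> \<gamma>" "\<gamma> \<le> \<zeta>"
  shows "\<bar>cpen P \<gamma>\<bar> \<le> 2 * \<zeta>"
proof -
  have "\<bar>\<gamma> * c1 P\<bar> \<le> \<zeta> * 1" unfolding abs_mult using assms c1_le by (intro mult_mono) auto
  then show ?thesis unfolding cpen_def using c0_le \<zeta>_ge_1 by linarith
qed

subsection \<open>The dual path\<close>

definition xc :: "real \<Rightarrow> real^'n" where
  "xc \<gamma> = - (matrix_inv (Apen P \<gamma>) *v bpen P \<gamma>)"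

definition nu :: "real \<Rightarrow> real" where
  "nu \<gamma> = q1 P (xc \<gamma>)"

lemma xc_grad:
  assumes "0 < mu P \<gamma>"
  shows "Apen P \<gamma> *v xc \<gamma> + bpen P \<gamma> = 0"
  using matrix_inv_solves[of "mu P \<gamma>" "Apen P \<gamma>" "bpen P \<gamma>"] assms
    le_mu_iff[THEN iffD1, OF order_refl, of \<gamma>]
  by (simp add: xc_def linear_neg)

lemma qpen_expand:
  assumes "0 < mu P \<gamma>"
  shows "qpen P \<gamma> y = qpen P \<gamma> (xc \<gamma>) + (y - xc \<gamma>) \<bullet> (Apen P \<gamma> *v (y - xc \<gamma>))"
  unfolding qpen_eq_quad by (rule quad_at_zero_of_grad[OF sym_Apen xc_grad[OF assms]])

lemma qpen_lower:
  assumes "0 < m" "m \<le> mu P \<gamma>"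
  shows "qpen P \<gamma> (xc \<gamma>) + m * (norm (y - xc \<gamma>))\<^sup>2 \<le> qpen P \<gamma> y"
  using qpen_expand[of \<gamma> y] mu_form_le[OF assms(2), of "y - xc \<gamma>"] assms by simp

lemma qpen_min: "0 < mu P \<gamma> \<Longrightarrow> qpen P \<gamma> (xc \<gamma>) \<le> qpen P \<gamma> y"
  using qpen_lower[of "mu P \<gamma>" \<gamma> y] by (smt (verit) mult_nonneg_nonneg zero_le_power2)

lemma qpen_upper:
  assumes "0 < mu P \<gamma>"
  shows "qpen P \<gamma> y \<le> qpen P \<gamma> (xc \<gamma>) + 2 * \<zeta> * (norm (y - xc \<gamma>))\<^sup>2"
  using qpen_expand[OF assms, of y] Apen_form_le[of \<gamma> "y - xc \<gamma>"] mu_pos_range[OF assms] by simp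

lemma xc_unique:
  assumes "0 < mu P \<gamma>" "Apen P \<gamma> *v x + bpen P \<gamma> = 0"
  shows "xc \<gamma> = x"
proof -
  have "Apen P \<gamma> *v (x - xc \<gamma>) = 0"
    using xc_grad[OF assms(1)] assms(2) by (simp add: matrix_vector_mult_diff_distrib add_eq_0_iff)
  then have "mu P \<gamma> * (norm (x - xc \<gamma>))\<^sup>2 \<le> 0"
    using mu_form_le[of "mu P \<gamma>" \<gamma> "x - xc \<gamma>"] by simp
  with assms(1) show ?thesis by (simp add: mult_le_0_iff)
qed

text \<open>Pairing the stationarity equation with \<open>xc \<gamma>\<close> itself bounds the
  curvature term by the linear one.\<close>

lemma xc_norm:
  assumes "0 < m" "m \<le> mu P \<gamma>"
  shows "m * norm (xc \<gamma>) \<le> 2 * \<zeta>"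
proof -
  have pos: "0 < mu P \<gamma>" using assms by simp
  have "m * (norm (xc \<gamma>))\<^sup>2 \<le> xc \<gamma> \<bullet> (Apen P \<gamma> *v xc \<gamma>)" using assms by (intro mu_form_le)
  also have "\<dots> = - (xc \<gamma> \<bullet> bpen P \<gamma>)"
    using xc_grad[OF pos] by (metis add_eq_0_iff2 inner_minus_right)
  also have "\<dots> \<le> norm (xc \<gamma>) * norm (bpen P \<gamma>)" using Cauchy_Schwarz_ineq2[of "xc \<gamma>" "bpen P \<gamma>"] by linarith
  also have "\<dots> \<le> norm (xc \<gamma>) * (2 * \<zeta>)"
    using mu_pos_range[OF pos] by (intro mult_left_mono bpen_norm) auto
  finally have "norm (xc \<gamma>) * (m * norm (xc \<gamma>)) \<le> norm (xc \<gamma>) * (2 * \<zeta>)"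
    by (simp add: power2_eq_square mult_ac)
  then show ?thesis using \<zeta>_ge_1 by (cases "xc \<gamma> = 0") auto
qed

lemma weak_duality:
  assumes "0 < mu P \<gamma>"
  shows "qpen P \<gamma> (xc \<gamma>) \<le> Opt P"
  unfolding Opt_def
proof (rule cINF_greatest)
  show "{x. q1 P x \<le> 0} \<noteq> {}" using slater by (auto intro: less_imp_le)
  fix x assume x: "x \<in> {x. q1 P x \<le> 0}"
  have "qpen P \<gamma> (xc \<gamma>) \<le> qpen P \<gamma> x" by (rule qpen_min[OF assms])
  also have "\<dots> \<le> q0 P x"
    using x mu_pos_range[OF assms] by (simp add: qpen_def mult_nonneg_nonpos)
  finally show "qpen P \<gamma> (xc \<gamma>) \<le> q0 P x" .
qed

text \<open>The tolerance is tuned to the size of the minimizer: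
  \<open>m * norm (xc \<gamma>) \<le> 2 * \<zeta>\<close> turns the bound on \<open>d\<close> into
  \<open>norm (xc \<gamma>) * d \<le> \<delta> / 5\<close>, and also
  \<open>d \<le> \<delta> / 10\<close>. The perturbation is therefore at most
  \<open>(0.4 + 0.2 + 0.01) * \<delta>\<close>.\<close>

lemma
  assumes m: "0 < m" "m \<le> mu P \<gamma>" "m \<le> 1" and \<delta>: "0 < \<delta>" "\<delta> \<le> 1"
    and y: "norm (y - xc \<gamma>) \<le> m * \<delta> / (10 * \<zeta>)"
  shows q0_perturbation: "\<bar>q0 P y - q0 P (xc \<gamma>)\<bar> \<le> 7 / 10 * \<delta>"
    and q1_perturbation: "\<bar>q1 P y - q1 P (xc \<gamma>)\<bar> \<le> 7 / 10 * \<delta>"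
proof -
  define d where "d = norm (y - xc \<gamma>)"
  have d0: "0 \<le> d" by (simp add: d_def)
  have d: "10 * \<zeta> * d \<le> m * \<delta>" using y \<zeta>_ge_1 by (simp add: d_def field_simps)
  have "m * \<delta> \<le> 1 * \<delta>" using m \<delta> by (intro mult_right_mono) auto
  moreover have "1 * d \<le> \<zeta> * d" using \<zeta>_ge_1 d0 by (intro mult_right_mono)
  ultimately have d1: "10 * d \<le> \<delta>" using d by linarith
  have "norm (xc \<gamma>) * (10 * \<zeta> * d) \<le> norm (xc \<gamma>) * (m * \<delta>)" using d by (intro mult_left_mono) auto
  also have "\<dots> = (m * norm (xc \<gamma>)) * \<delta>" by simp
  also have "\<dots> \<le> (2 * \<zeta>) * \<delta>" using xc_norm[OF m(1,2)] \<delta> by (intro mult_right_mono) auto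
  finally have "\<zeta> * (10 * (norm (xc \<gamma>) * d)) \<le> \<zeta> * (2 * \<delta>)" by (simp add: mult_ac)
  then have xd: "10 * (norm (xc \<gamma>) * d) \<le> 2 * \<delta>" using \<zeta>_ge_1 by simp
  have "d * d \<le> (1/10) * d" using d1 \<delta> d0 by (intro mult_right_mono) auto
  then have "2 * (norm (xc \<gamma>) + 1) * d + d\<^sup>2 \<le> 7 / 10 * \<delta>"
    using d1 xd \<delta> unfolding power2_eq_square by (simp add: algebra_simps)
  then show "\<bar>q0 P y - q0 P (xc \<gamma>)\<bar> \<le> 7 / 10 * \<delta>" "\<bar>q1 P y - q1 P (xc \<gamma>)\<bar> \<le> 7 / 10 * \<delta>"
    unfolding q0_def q1_def d_def
    using quad_perturbation[OF sym0 A0_le b0_le, of "c0 P" y "xc \<gamma>"]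
      quad_perturbation[OF sym1 A1_le b1_le, of "c1 P" y "xc \<gamma>"] by linarith+
qed

text \<open>Subtracting the stationarity equations shows that \<open>A(a)\<close> maps
  \<open>xc a - xc b\<close> to \<open>b - a\<close> times the gradient part of \<open>q1\<close> at
  \<open>xc b\<close>; strong convexity at \<open>a\<close> inverts this. It serves the continuity
  of \<open>nu\<close>.\<close>

lemma xc_lipschitz:
  assumes "0 < m" "m \<le> mu P a" "m \<le> mu P b"
  shows "m * norm (xc a - xc b) \<le> \<bar>a - b\<bar> * (norm (xc b) + 1)"
proof -
  define d where "d = xc a - xc b"
  have "Apen P a *v d = (b - a) *\<^sub>R (A1 P *v xc b + b1 P)"
  proof -
    have "Apen P a *v d = - bpen P a - Apen P a *v xc b"
      using xc_grad[of a] assms by (simp add: d_def matrix_vector_mult_diff_distrib eq_neg_iff_add_eq_0)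
    also have "Apen P a *v xc b = - bpen P b + (a - b) *\<^sub>R (A1 P *v xc b)"
      using xc_grad[of b] assms by (simp add: Apen_vec algebra_simps add_eq_0_iff2)
    finally show ?thesis by (simp add: bpen_def algebra_simps)
  qed
  then have "norm (Apen P a *v d) = \<bar>a - b\<bar> * norm (A1 P *v xc b + b1 P)"
    by (simp add: abs_minus_commute)
  also have "norm (A1 P *v xc b + b1 P) \<le> norm (xc b) + 1"
    using norm_triangle_ineq[of "A1 P *v xc b" "b1 P"] norm_matrix_vector_le[OF A1_le, of "xc b"] b1_le
    by simp
  finally have *: "norm (Apen P a *v d) \<le> \<bar>a - b\<bar> * (norm (xc b) + 1)" by (simp add: mult_left_mono)
  have "m * (norm d)\<^sup>2 \<le> norm d * norm (Apen P a *v d)"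
    using mu_form_le[OF assms(2), of d] Cauchy_Schwarz_ineq2[of d "Apen P a *v d"] by linarith
  then have "norm d * (m * norm d) \<le> norm d * norm (Apen P a *v d)"
    by (simp add: power2_eq_square mult_ac)
  then have "m * norm d \<le> norm (Apen P a *v d) \<or> d = 0" by auto
  with * show ?thesis unfolding d_def[symmetric] by (auto intro: order_trans)
qed

lemma continuous_on_nu:
  assumes "0 < m" "\<And>\<gamma>. \<gamma> \<in> {a..b} \<Longrightarrow> m \<le> mu P \<gamma>"
  shows "continuous_on {a..b} nu"
proof -
  define L where "L = (2 * \<zeta> / m + 1) / m"
  have L: "0 \<le> L" using assms \<zeta>_ge_1 by (simp add: L_def)
  have "L-lipschitz_on {a..b} xc"
  proof (rule lipschitz_onI[OF _ L])
    fix x y assume xy: "x \<in> {a..b}" "y \<in> {a..b}"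
    have "m * norm (xc x - xc y) \<le> \<bar>x - y\<bar> * (norm (xc y) + 1)"
      using assms xy by (intro xc_lipschitz) auto
    also have "\<dots> \<le> \<bar>x - y\<bar> * (2 * \<zeta> / m + 1)"
      using xc_norm[of m y] assms xy by (intro mult_left_mono add_right_mono) (auto simp: field_simps)
    finally show "dist (xc x) (xc y) \<le> L * dist x y"
      using assms(1) by (simp add: L_def dist_norm field_simps)
  qed
  then have "continuous_on {a..b} xc" by (rule lipschitz_on_continuous_on)
  then show ?thesis unfolding nu_def q1_def quad_def by (intro continuous_intros)
qed

subsection \<open>Approximate optimizers\<close>

text \<open>Weak duality reads
  \<open>q0 P (xc \<gamma>) + \<gamma> * nu \<gamma> \<le> Opt P\<close>, so the failure of
  complementary slackness costs at most
  \<open>\<zeta> * \<bar>nu \<gamma>\<bar> \<le> \<epsilon> / 2\<close>; the other half of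
  \<epsilon> pays for replacing \<open>xc \<gamma>\<close> by \<open>y\<close>.\<close>

lemma approx_optimizer_of_dual:
  assumes mu: "0 < mu P \<gamma>" and nu: "\<bar>nu \<gamma>\<bar> * (2 * \<zeta>) \<le> \<epsilon>"
    and q0: "q0 P y \<le> q0 P (xc \<gamma>) + \<epsilon> / 2" and q1: "q1 P y \<le> \<epsilon>"
  shows "approx_optimizer P \<epsilon> y"
proof -
  have "- (\<gamma> * nu \<gamma>) \<le> \<gamma> * \<bar>nu \<gamma>\<bar>"
    using mu_pos_range[OF mu] by (metis abs_ge_minus_self less_imp_le mult_left_mono mult_minus_right)
  also have "\<dots> \<le> \<zeta> * \<bar>nu \<gamma>\<bar>" using mu_pos_range[OF mu] by (intro mult_right_mono) auto
  also have "\<dots> \<le> \<epsilon> / 2" using nu by (simp add: mult_ac)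
  finally have "- (\<gamma> * nu \<gamma>) \<le> \<epsilon> / 2" .
  moreover have "q0 P (xc \<gamma>) + \<gamma> * nu \<gamma> \<le> Opt P"
    using weak_duality[OF mu] by (simp add: qpen_def nu_def)
  ultimately show ?thesis using q0 q1 by (simp add: approx_optimizer_def)
qed

lemma maybe_regular_correct:
  assumes m: "0 < m" "m \<le> mu P \<gamma>" "m \<le> 1" and \<epsilon>: "0 < \<epsilon>" "\<epsilon> < 1"
    and nu: "\<bar>nu \<gamma>\<bar> \<le> 2 * (\<epsilon> / (4 * \<zeta>))"
    and y: "norm (y - xc \<gamma>) \<le> m * (\<epsilon> / (4 * \<zeta>)) / (10 * \<zeta>)"
  shows "approx_optimizer P \<epsilon> y"
proof (rule approx_optimizer_of_dual)
  define \<tau> where "\<tau> = \<epsilon> / (4 * \<zeta>)"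
  have "\<zeta> * \<tau> = \<epsilon> / 4" using \<zeta>_ge_1 by (simp add: \<tau>_def)
  moreover have "0 < \<tau>" using \<zeta>_ge_1 \<epsilon> by (simp add: \<tau>_def)
  moreover have "1 * \<tau> \<le> \<zeta> * \<tau>" using \<zeta>_ge_1 \<open>0 < \<tau>\<close> by (intro mult_right_mono) auto
  ultimately have \<tau>: "0 < \<tau>" "\<tau> \<le> 1" "4 * \<tau> \<le> \<epsilon>" using \<epsilon> by linarith+
  note pert = q0_perturbation[OF m \<tau>(1,2) y[folded \<tau>_def]] q1_perturbation[OF m \<tau>(1,2) y[folded \<tau>_def]]
  show "0 < mu P \<gamma>" using m by simp
  have "\<bar>nu \<gamma>\<bar> * (2 * \<zeta>) \<le> 2 * (\<epsilon> / (4 * \<zeta>)) * (2 * \<zeta>)"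
    using nu \<zeta>_ge_1 by (intro mult_right_mono) auto
  then show "\<bar>nu \<gamma>\<bar> * (2 * \<zeta>) \<le> \<epsilon>" using \<zeta>_ge_1 by simp
  show "q0 P y \<le> q0 P (xc \<gamma>) + \<epsilon> / 2" using pert \<tau> by linarith
  show "q1 P y \<le> \<epsilon>" using pert \<tau> nu unfolding nu_def \<tau>_def[symmetric] by linarith
qed

text \<open>Where \<open>nu\<close> changes sign, the dual optimum lies in between and its primal point minimizes
  the maximum of the two end quadratics.\<close>

lemma regular_correct:
  assumes m: "0 < m" "m \<le> mu P \<gamma>1" "m \<le> mu P \<gamma>2" "m \<le> 1" and \<epsilon>: "0 < \<epsilon>" "\<epsilon> < 1"
    and le: "\<gamma>1 \<le> \<gamma>2" and nu: "0 < nu \<gamma>1" "nu \<gamma>2 < 0"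
    and y: "\<And>z. max (qpen P \<gamma>1 y) (qpen P \<gamma>2 y)
              \<le> max (qpen P \<gamma>1 z) (qpen P \<gamma>2 z) + m * (\<epsilon> * m / (10 * \<zeta>))\<^sup>2"
  shows "approx_optimizer P \<epsilon> y"
proof -
  have mu: "m \<le> mu P \<gamma>" if "\<gamma> \<in> {\<gamma>1..\<gamma>2}" for \<gamma>
    using mu_min_le[of \<gamma>1 \<gamma> \<gamma>2] that m by auto
  have "\<exists>g\<ge>\<gamma>1. g \<le> \<gamma>2 \<and> nu g = 0"
    using nu le by (intro IVT2' continuous_on_nu[OF m(1) mu]) auto
  then obtain g where g: "\<gamma>1 \<le> g" "g \<le> \<gamma>2" "nu g = 0" by blast
  have mg: "m \<le> mu P g" using mu g by simp
  have q1g: "q1 P (xc g) = 0" using g by (simp add: nu_def)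
  define \<delta> where "\<delta> = \<epsilon> * m / (10 * \<zeta>)"
  \<comment> \<open>\<open>qpen\<close> is affine in the multiplier, so its value at
    \<open>g\<close> is at most the larger of the two end values.\<close>
  have "qpen P g y \<le> max (qpen P \<gamma>1 y) (qpen P \<gamma>2 y)"
  proof (cases "0 \<le> q1 P y")
    case True
    then have "(g - \<gamma>2) * q1 P y \<le> 0" using g by (simp add: mult_nonpos_nonneg)
    then show ?thesis using qpen_shift[of g y \<gamma>2] by simp
  next
    case False
    then have "(g - \<gamma>1) * q1 P y \<le> 0" using g by (simp add: mult_nonneg_nonpos)
    then show ?thesis using qpen_shift[of g y \<gamma>1] by simp
  qed
  \<comment> \<open>Since \<open>q1 P (xc g) = 0\<close>, both end quadratics agree with
    \<open>qpen P g\<close> at \<open>xc g\<close>, which makes it the right comparison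
    point.\<close>
  also have "\<dots> \<le> qpen P g (xc g) + m * \<delta>\<^sup>2"
    using y[of "xc g"] by (simp add: qpen_def q1g \<delta>_def)
  finally have "m * (norm (y - xc g))\<^sup>2 \<le> m * \<delta>\<^sup>2"
    using qpen_lower[OF m(1) mg, of y] by simp
  then have "(norm (y - xc g))\<^sup>2 \<le> \<delta>\<^sup>2" using m by simp
  moreover have "0 \<le> \<delta>" using m \<epsilon> \<zeta>_ge_1 by (simp add: \<delta>_def)
  ultimately have "norm (y - xc g) \<le> \<delta>" by (rule power2_le_imp_le)
  then have close: "norm (y - xc g) \<le> m * \<epsilon> / (10 * \<zeta>)" by (simp add: \<delta>_def mult.commute)
  have \<epsilon>1: "\<epsilon> \<le> 1" using \<epsilon> by simp
  have "q0 P (xc g) \<le> Opt P"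
    using weak_duality[of g] m mg by (simp add: qpen_def q1g)
  with q0_perturbation[OF m(1) mg m(4) \<epsilon>(1) \<epsilon>1 close] q1_perturbation[OF m(1) mg m(4) \<epsilon>(1) \<epsilon>1 close] q1g \<epsilon>
  show ?thesis unfolding approx_optimizer_def by (intro conjI; linarith)
qed

text \<open>Moving the multiplier from \<open>\<gamma>\<close> to \<open>\<gamma>h\<close> does not increase \<open>q\<close> at \<open>xc \<gamma>\<close>, so this point is
  controlled by the strong convexity at \<open>\<gamma>h\<close> rather than by the small \<open>mu P \<gamma>\<close>.\<close>

lemma xc_norm_far:
  assumes mu: "0 < mu P \<gamma>" and le: "(\<gamma>h - \<gamma>) * nu \<gamma> \<le> 0"
  shows "norm (xc \<gamma>) \<le> 5 * (\<zeta> / \<xi>)"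
proof (rule ccontr)
  define r where "r = norm (xc \<gamma>)"
  define k where "k = \<zeta> / \<xi>"
  have \<gamma>h: "0 \<le> \<gamma>h" "\<gamma>h \<le> \<zeta>" using \<gamma>h_nonneg \<gamma>h_bounds \<xi>_pos by auto
  have k: "1 \<le> k" "\<xi> * k = \<zeta>" using \<xi>_pos \<xi>_le_1 \<zeta>_ge_1 by (simp_all add: k_def)
  assume "\<not> norm (xc \<gamma>) \<le> 5 * (\<zeta> / \<xi>)"
  then have r: "5 * k < r" by (simp add: r_def k_def)
  have "\<xi> * r\<^sup>2 \<le> xc \<gamma> \<bullet> (Apen P \<gamma>h *v xc \<gamma>)" unfolding r_def by (rule mu_form_le[OF mu_\<gamma>h])
  moreover have "- (2 * \<zeta> * r) \<le> bpen P \<gamma>h \<bullet> xc \<gamma>"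
    using Cauchy_Schwarz_ineq2[of "bpen P \<gamma>h" "xc \<gamma>"] mult_right_mono[OF bpen_norm[OF \<gamma>h], of r]
    by (simp add: r_def)
  ultimately have "\<xi> * r\<^sup>2 - 4 * \<zeta> * r - 2 * \<zeta> \<le> qpen P \<gamma>h (xc \<gamma>)"
    using cpen_abs[OF \<gamma>h] by (simp add: qpen_eq_quad quad_def)
  also have "\<dots> \<le> qpen P \<gamma> (xc \<gamma>)"
    using qpen_shift[of \<gamma>h "xc \<gamma>" \<gamma>] le by (simp add: nu_def)
  also have "\<dots> \<le> qpen P \<gamma> 0" by (rule qpen_min[OF mu])
  also have "\<dots> \<le> 2 * \<zeta>"
    using cpen_abs[of \<gamma>] mu_pos_range[OF mu] by (simp add: qpen_eq_quad quad_def)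
  \<comment> \<open>With \<open>r > 5 * k\<close> the left side exceeds
    \<open>5 * \<zeta> * r\<close>, which would force \<open>r < 4\<close>, although
    \<open>r > 5\<close>.\<close>
  finally have "\<xi> * r\<^sup>2 \<le> 4 * \<zeta> * r + 4 * \<zeta>" by simp
  moreover have "\<xi> * (5 * k) * r < \<xi> * r * r"
    using r k \<xi>_pos by (intro mult_strict_right_mono mult_strict_left_mono) auto
  moreover have "\<xi> * (5 * k) * r = 5 * \<zeta> * r" using k(2) by simp
  moreover have "\<zeta> * (5 * 1) \<le> \<zeta> * r" using r k \<zeta>_ge_1 by (intro mult_left_mono) auto
  ultimately show False using \<zeta>_ge_1 by (simp add: power2_eq_square)
qed

text \<open>The vector \<open>v\<close> has curvature at most \<open>M\<close> for
  \<open>A(\<gamma>)\<close> but at least \<xi> for \<open>A(\<gamma>h)\<close>, so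
  \<open>A1\<close>, taken with the sign \<sigma>, curves by at least
  \<open>\<xi> / (2 * \<zeta>)\<close> along \<open>v\<close>: the step back to
  \<open>q1 = 0\<close> exists and is of controlled length. At its end \<open>q0\<close> equals
  \<open>qpen P \<gamma>\<close>, the linear term has the right sign, and the step loses only
  \<open>\<alpha>^2 * M\<close>. The sign \<sigma> treats both sides of \<open>\<gamma>h\<close> at
  once.\<close>

lemma not_regular_correct:
  assumes m: "0 < m" "m \<le> mu P \<gamma>" "m \<le> 1" and \<epsilon>: "0 < \<epsilon>" "\<epsilon> < 1"
    and \<sigma>: "\<sigma> = 1 \<or> \<sigma> = -1" and h: "0 \<le> \<sigma> * (\<gamma>h - \<gamma>)" and nu: "\<sigma> * nu \<gamma> < 0"
    and q1x: "\<sigma> * q1 P x < 0"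
    and x: "norm (x - xc \<gamma>) \<le> m * (\<epsilon> / (4 * \<zeta>)) / (10 * \<zeta>)"
    and M: "0 < M" "M \<le> \<xi> / 2" "M \<le> \<epsilon> * \<xi> ^ 4 / (3200 * \<zeta> ^ 4)"
    and v: "norm v = 1" "v \<bullet> (Apen P \<gamma> *v v) \<le> M" "v \<bullet> (Apen P \<gamma> *v x + bpen P \<gamma>) \<le> 0"
  shows "\<exists>\<alpha>>0. q1 P (x + \<alpha> *\<^sub>R v) = 0"
    and "0 < \<alpha> \<Longrightarrow> q1 P (x + \<alpha> *\<^sub>R v) = 0 \<Longrightarrow> approx_optimizer P \<epsilon> (x + \<alpha> *\<^sub>R v)"
proof -
  have pos: "0 < mu P \<gamma>" using m by simp
  have \<gamma>h: "0 \<le> \<gamma>h" "\<gamma>h \<le> \<zeta>" using \<gamma>h_nonneg \<gamma>h_bounds \<xi>_pos by auto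
  define k where "k = \<zeta> / \<xi>"
  have k: "1 \<le> k" "\<xi> * k = \<zeta>" using \<xi>_pos \<xi>_le_1 \<zeta>_ge_1 by (simp_all add: k_def)
  define a where "a = \<sigma> * (v \<bullet> (A1 P *v v))"
  define b where "b = \<sigma> * ((A1 P *v x + b1 P) \<bullet> v)"
  define c where "c = - \<sigma> * q1 P x"
  have c: "0 < c" using q1x by (simp add: c_def)
  have root: "q1 P (x + t *\<^sub>R v) = 0 \<longleftrightarrow> a * t\<^sup>2 + 2 * b * t = c" for t
  proof -
    have "\<sigma> * q1 P (x + t *\<^sub>R v) = a * t\<^sup>2 + 2 * b * t - c"
      unfolding q1_def quad_add[OF sym1]
      by (simp add: a_def b_def c_def q1_def matrix_vector_mult_scaleR power2_eq_square algebra_simps)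
    with \<sigma> show ?thesis by auto
  qed
  have a: "\<xi> \<le> 2 * \<zeta> * a"
  proof -
    have "\<xi> \<le> v \<bullet> (Apen P \<gamma>h *v v)" using mu_form_le[OF mu_\<gamma>h, of v] v by simp
    then have "\<xi> - M \<le> (\<gamma>h - \<gamma>) * (v \<bullet> (A1 P *v v))"
      using v(2) unfolding Apen_form by (simp add: algebra_simps)
    also have "\<dots> = \<sigma> * (\<gamma>h - \<gamma>) * a" using \<sigma> by (auto simp: a_def)
    finally have ha: "\<xi> / 2 \<le> \<sigma> * (\<gamma>h - \<gamma>) * a" using M by simp
    have "0 < a"
    proof (rule ccontr)
      assume "\<not> 0 < a"
      then have "\<sigma> * (\<gamma>h - \<gamma>) * a \<le> 0" using h by (intro mult_nonneg_nonpos) auto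
      with ha \<xi>_pos show False by linarith
    qed
    moreover have "\<sigma> * (\<gamma>h - \<gamma>) \<le> \<zeta>" using \<sigma> mu_pos_range[OF pos] \<gamma>h by auto
    ultimately have "\<sigma> * (\<gamma>h - \<gamma>) * a \<le> \<zeta> * a" by (intro mult_right_mono) auto
    with ha show ?thesis by simp
  qed
  then have "0 < 2 * \<zeta> * a" using \<xi>_pos by linarith
  then have a0: "0 < a" using \<zeta>_ge_1 by (simp add: zero_less_mult_iff)
  show "\<exists>\<alpha>>0. q1 P (x + \<alpha> *\<^sub>R v) = 0"
    unfolding root by (rule positive_root_ex[OF a0 c])
  define d where "d = norm (x - xc \<gamma>)"
  have d: "40 * \<zeta>\<^sup>2 * d \<le> \<epsilon>"
  proof -
    have "40 * \<zeta>\<^sup>2 * d \<le> m * \<epsilon>" using x \<zeta>_ge_1 by (simp add: d_def field_simps power2_eq_square)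
    also have "\<dots> \<le> 1 * \<epsilon>" using m \<epsilon> by (intro mult_right_mono) auto
    finally show ?thesis by simp
  qed
  have d0: "0 \<le> d" by (simp add: d_def)
  have z2: "1 \<le> \<zeta>\<^sup>2" using \<zeta>_ge_1 by simp
  have "1 * d \<le> \<zeta>\<^sup>2 * d" using z2 d0 by (intro mult_right_mono)
  with d \<epsilon> have d1: "d \<le> 1 / 40" by simp
  have "(\<gamma>h - \<gamma>) * nu \<gamma> \<le> 0"
    using \<sigma> h nu by (auto simp: mult_le_0_iff zero_le_mult_iff)
  from xc_norm_far[OF pos this] have "norm x \<le> 5 * k + d"
    using norm_triangle_ineq[of "xc \<gamma>" "x - xc \<gamma>"] by (simp add: k_def d_def)
  define R where "R = 7 * k"
  have R: "norm x + 1 \<le> R" using \<open>norm x \<le> 5 * k + d\<close> d1 k by (simp add: R_def)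
  have bR: "\<bar>b\<bar> \<le> R"
  proof -
    have "\<bar>b\<bar> = \<bar>(A1 P *v x + b1 P) \<bullet> v\<bar>" using \<sigma> by (auto simp: b_def)
    also have "\<dots> \<le> norm (A1 P *v x + b1 P)"
      using Cauchy_Schwarz_ineq2[of "A1 P *v x + b1 P" v] v by simp
    also have "\<dots> \<le> norm x + 1"
      using norm_triangle_ineq[of "A1 P *v x" "b1 P"] norm_matrix_vector_le[OF A1_le, of x] b1_le by simp
    finally show ?thesis using R by simp
  qed
  have cR: "c \<le> R\<^sup>2"
  proof -
    have "c \<le> \<bar>q1 P x - q1 P 0\<bar> + 1" using \<sigma> c1_le by (auto simp: c_def q1_def quad_def)
    also have "\<dots> \<le> 2 * norm x + (norm x)\<^sup>2 + 1"
      using quad_perturbation[OF sym1 A1_le b1_le, of "c1 P" x 0] by (simp add: q1_def)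
    also have "\<dots> = (norm x + 1)\<^sup>2" by (simp add: power2_sum)
    also have "\<dots> \<le> R\<^sup>2" using R by (intro power_mono) auto
    finally show ?thesis .
  qed
  have R0: "0 < R" using k by (simp add: R_def)
  assume \<alpha>: "0 < \<alpha>" "q1 P (x + \<alpha> *\<^sub>R v) = 0"
  have ak: "1 \<le> 2 * k * a"
  proof -
    have "\<xi> * 1 \<le> \<xi> * (2 * k * a)" using a unfolding k(2)[symmetric] by (simp add: mult_ac)
    then show ?thesis using \<xi>_pos by simp
  qed
  \<comment> \<open>As \<open>1 / a \<le> 2 * k\<close>, \<open>\<bar>b\<bar> \<le> R\<close> and
    \<open>c \<le> R^2\<close>, the root satisfies
    \<open>\<alpha>^2 \<le> 2 * k * R^2 + 4 * k * R * \<alpha>\<close>. A root beyond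
    \<open>5 * k * R\<close> would leave \<open>\<alpha> < 2 * R\<close>, impossible since
    \<open>1 \<le> k\<close>.\<close>
  have "\<alpha> \<le> 5 * k * R"
  proof (rule ccontr)
    assume "\<not> \<alpha> \<le> 5 * k * R"
    then have big: "5 * k * R < \<alpha>" by simp
    have "\<alpha>\<^sup>2 \<le> 2 * k * a * \<alpha>\<^sup>2" using ak by (simp add: mult_le_cancel_right1)
    also have "\<dots> = 2 * k * (a * \<alpha>\<^sup>2)" by simp
    also have "a * \<alpha>\<^sup>2 = c - 2 * b * \<alpha>" using \<alpha>(2) unfolding root by simp
    also have "2 * k * (c - 2 * b * \<alpha>) \<le> 2 * k * (R\<^sup>2 + 2 * R * \<alpha>)"
    proof (intro mult_left_mono)
      have "- b * \<alpha> \<le> R * \<alpha>" using bR \<alpha> by (intro mult_right_mono) auto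
      with cR show "c - 2 * b * \<alpha> \<le> R\<^sup>2 + 2 * R * \<alpha>" by simp
    qed (use k in simp)
    finally have 1: "\<alpha>\<^sup>2 \<le> 2 * k * R\<^sup>2 + 4 * k * R * \<alpha>" by (simp add: algebra_simps)
    have "5 * k * R * \<alpha> < \<alpha> * \<alpha>" using big \<alpha> by (intro mult_strict_right_mono)
    with 1 have 2: "k * R * \<alpha> < 2 * k * R\<^sup>2" by (simp add: power2_eq_square)
    then have "k * R * \<alpha> < k * R * (2 * R)" by (simp add: power2_eq_square)
    then have "\<alpha> < 2 * R" using k R0 by simp
    moreover have "1 * R \<le> k * R" using k R0 by (intro mult_right_mono) auto
    ultimately show False using big R0 by linarith
  qed
  also have "\<dots> = 35 * k\<^sup>2" by (simp add: R_def power2_eq_square)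
  \<comment> \<open>The bound on \<open>M\<close> cancels \<open>k^4\<close>, and
    \<open>1225 / 3200 < 1 / 2\<close>: here the fourth powers and the 3200 of the threshold are
    consumed.\<close>
  finally have "\<alpha>\<^sup>2 \<le> (35 * k\<^sup>2)\<^sup>2" using \<alpha> by (intro power_mono) auto
  then have "\<alpha>\<^sup>2 * M \<le> 1225 * k ^ 4 * (\<epsilon> * \<xi> ^ 4 / (3200 * \<zeta> ^ 4))"
    using M by (intro mult_mono) (auto simp: power_mult_distrib)
  also have "\<dots> = 1225 / 3200 * \<epsilon>"
    using \<xi>_pos \<zeta>_ge_1 by (simp add: k_def power_divide)
  finally have \<alpha>M: "\<alpha>\<^sup>2 * M \<le> \<epsilon> / 2" using \<epsilon> by simp
  have "q0 P (x + \<alpha> *\<^sub>R v) = qpen P \<gamma> (x + \<alpha> *\<^sub>R v)" using \<alpha> by (simp add: qpen_def)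
  also have "\<dots> = qpen P \<gamma> x + 2 * \<alpha> * (v \<bullet> (Apen P \<gamma> *v x + bpen P \<gamma>)) + \<alpha>\<^sup>2 * (v \<bullet> (Apen P \<gamma> *v v))"
    unfolding qpen_eq_quad quad_add[OF sym_Apen]
    by (simp add: matrix_vector_mult_scaleR power2_eq_square inner_commute mult.assoc)
  also have "\<dots> \<le> qpen P \<gamma> x + 0 + \<alpha>\<^sup>2 * M"
    using v \<alpha> by (intro add_mono mult_left_mono) (auto simp: mult_nonneg_nonpos)
  also have "qpen P \<gamma> x \<le> Opt P + 2 * \<zeta> * d\<^sup>2"
    using qpen_upper[OF pos, of x] weak_duality[OF pos] by (simp add: d_def)
  also have "2 * \<zeta> * d\<^sup>2 \<le> 2 * \<zeta>\<^sup>2 * d\<^sup>2"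
    using \<zeta>_ge_1 by (intro mult_right_mono) (auto simp: power2_eq_square)
  also have "2 * \<zeta>\<^sup>2 * d\<^sup>2 \<le> \<epsilon> * (1 / 40)"
  proof -
    have "40 * \<zeta>\<^sup>2 * d * d \<le> \<epsilon> * (1 / 40)" using d d1 d0 \<epsilon> by (intro mult_mono) auto
    moreover have "0 \<le> \<zeta>\<^sup>2 * d\<^sup>2" by simp
    ultimately show ?thesis by (simp add: power2_eq_square mult_ac)
  qed
  finally show "approx_optimizer P \<epsilon> (x + \<alpha> *\<^sub>R v)"
    using \<alpha>M \<alpha>(2) \<epsilon> by (simp add: approx_optimizer_def)
qed

subsection \<open>The dual maximizer\<close>

lemma dual_le: "dual P \<gamma> \<le> ereal (qpen P \<gamma> x)"
  unfolding dual_def by (rule INF_lower) simp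

lemma dual_eq:
  assumes "0 < mu P \<gamma>"
  shows "dual P \<gamma> = ereal (qpen P \<gamma> (xc \<gamma>))"
  unfolding dual_def using qpen_min[OF assms] by (intro antisym INF_lower INF_greatest) auto

text \<open>\<open>xc \<gamma>\<close> is a test point for every multiplier, and its value is affine
  in \<open>\<gamma>'\<close> with slope \<open>nu \<gamma>\<close>. This one-sided estimate stands
  in for differentiability of the dual.\<close>

lemma dual_supergradient:
  assumes "0 < mu P \<gamma>"
  shows "dual P \<gamma>' \<le> ereal (qpen P \<gamma> (xc \<gamma>) + (\<gamma>' - \<gamma>) * nu \<gamma>)"
  using dual_le[of \<gamma>' "xc \<gamma>"] by (simp add: qpen_shift[of \<gamma>' _ \<gamma>] nu_def)

text \<open>An infimum of affine functions is only upper semicontinuous, so a maximizing sequence in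
  the compact \<open>{0..B}\<close> is passed to the limit for each \<open>x\<close> separately.
  Beyond \<open>B\<close> the strictly feasible point keeps the dual from exceeding its value at
  \<open>\<gamma>h\<close>.\<close>

lemma dual_argmax_nonempty: "\<exists>\<gamma>. \<gamma> \<in> dual_argmax P"
proof -
  obtain x0 where x0: "q1 P x0 < 0" using slater .
  define D where "D = qpen P \<gamma>h (xc \<gamma>h)"
  have Dh: "dual P \<gamma>h = ereal D" using mu_\<gamma>h \<xi>_pos by (simp add: D_def dual_eq)
  define B where "B = max \<gamma>h ((q0 P x0 - D) / - q1 P x0)"
  have far: "dual P \<gamma> \<le> ereal D" if "B \<le> \<gamma>" for \<gamma>
  proof -
    have "(q0 P x0 - D) / - q1 P x0 \<le> \<gamma>" using that by (simp add: B_def)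
    then have "qpen P \<gamma> x0 \<le> D" using x0 by (simp add: qpen_def field_simps)
    then show ?thesis using dual_le[of \<gamma> x0] by (meson ereal_less_eq(3) order_trans)
  qed
  define S where "S = {0..B}"
  have hS: "\<gamma>h \<in> S" using \<gamma>h_nonneg by (simp add: S_def B_def)
  obtain f where f: "incseq f" "range f \<subseteq> dual P ` S" "Sup (dual P ` S) = (SUP i. f i)"
    using Sup_countable_SUP[of "dual P ` S"] hS by blast
  then have "\<forall>n. \<exists>\<gamma>. \<gamma> \<in> S \<and> f n = dual P \<gamma>" by blast
  then obtain g where g: "\<And>n. g n \<in> S" "\<And>n. f n = dual P (g n)" by metis
  have "compact S" by (simp add: S_def)
  then obtain l r where l: "l \<in> S" "strict_mono r" "(g \<circ> r) \<longlonglongrightarrow> l"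
    using g unfolding compact_def by (metis (no_types, lifting))
  have "(SUP i. f i) \<le> ereal (qpen P l x)" for x
  proof (rule LIMSEQ_le)
    show "(f \<circ> r) \<longlonglongrightarrow> (SUP i. f i)"
      by (rule LIMSEQ_subseq_LIMSEQ[OF LIMSEQ_SUP[OF f(1)] l(2)])
    show "(\<lambda>n. ereal (qpen P ((g \<circ> r) n) x)) \<longlonglongrightarrow> ereal (qpen P l x)"
      unfolding qpen_def by (intro tendsto_ereal tendsto_intros l)
    show "\<exists>N. \<forall>n\<ge>N. (f \<circ> r) n \<le> ereal (qpen P ((g \<circ> r) n) x)"
      using g dual_le by auto
  qed
  then have "(SUP i. f i) \<le> dual P l" unfolding dual_def by (rule INF_greatest)
  then have max: "dual P \<gamma> \<le> dual P l" if "\<gamma> \<in> S" for \<gamma>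
    using that f(3) by (metis SUP_upper order_trans)
  have "dual P \<gamma> \<le> dual P l" if "0 \<le> \<gamma>" for \<gamma>
  proof (cases "\<gamma> \<le> B")
    case False
    then show ?thesis using far[of \<gamma>] max[OF hS] Dh by simp
  qed (use that max in \<open>simp add: S_def\<close>)
  then show ?thesis using l(1) by (auto simp: dual_argmax_def S_def)
qed

text \<open>With a negative eigenvalue the quadratic falls without bound along a suitably oriented
  bottom vector; \<open>t\<close> is chosen to push it below \<open>D\<close>.\<close>

lemma mu_nonneg_of_dual:
  assumes "ereal D \<le> dual P \<gamma>"
  shows "0 \<le> mu P \<gamma>"
proof (rule ccontr)
  assume neg: "\<not> 0 \<le> mu P \<gamma>"
  obtain v where v: "norm v = 1" "v \<bullet> (Apen P \<gamma> *v v) = mu P \<gamma>" using mu_attained .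
  define u where "u = (if bpen P \<gamma> \<bullet> v \<le> 0 then v else - v)"
  have u: "u \<bullet> (Apen P \<gamma> *v u) = mu P \<gamma>" "bpen P \<gamma> \<bullet> u \<le> 0"
    using v by (auto simp: u_def linear_neg)
  define k where "k = - mu P \<gamma>"
  have k: "0 < k" using neg by (simp add: k_def)
  define t where "t = 1 + (\<bar>cpen P \<gamma>\<bar> + \<bar>D\<bar>) / k"
  have t: "1 \<le> t" "k * t = k + (\<bar>cpen P \<gamma>\<bar> + \<bar>D\<bar>)" using k by (simp_all add: t_def field_simps)
  have "D \<le> qpen P \<gamma> (t *\<^sub>R u)"
    using assms dual_le[of \<gamma> "t *\<^sub>R u"] by (metis ereal_less_eq(3) order_trans)
  also have "\<dots> = - (k * t) * t + 2 * t * (bpen P \<gamma> \<bullet> u) + cpen P \<gamma>"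
    by (simp add: qpen_eq_quad quad_def matrix_vector_mult_scaleR u k_def algebra_simps)
  also have "\<dots> \<le> - (k + (\<bar>cpen P \<gamma>\<bar> + \<bar>D\<bar>)) * 1 + 0 + cpen P \<gamma>"
  proof (intro add_mono)
    have "(k * t) * 1 \<le> (k * t) * t" using t k by (intro mult_left_mono) auto
    then show "- (k * t) * t \<le> - (k + (\<bar>cpen P \<gamma>\<bar> + \<bar>D\<bar>)) * 1" unfolding t(2) by linarith
  qed (use u t in \<open>auto simp: mult_nonneg_nonpos\<close>)
  finally show False using k by simp
qed

text \<open>Two maximizers force \<open>nu = 0\<close> between them; then one point is stationary for the whole
  pencil and \<open>nu\<close> vanishes identically.\<close>

lemma dual_argmax_unique:
  assumes nu: "nu \<gamma>h \<noteq> 0"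
  shows "\<exists>!\<gamma>. \<gamma> \<in> dual_argmax P"
proof -
  have False if a: "a \<in> dual_argmax P" and b: "b \<in> dual_argmax P" and ab: "a < b" for a b
  proof -
    have ab0: "0 \<le> a" "0 \<le> b" using a b by (auto simp: dual_argmax_def)
    have eq: "dual P b = dual P a" using a b by (auto simp: dual_argmax_def intro: antisym)
    have ge: "dual P \<gamma> \<le> dual P a" if "0 \<le> \<gamma>" for \<gamma> using a that by (simp add: dual_argmax_def)
    have "ereal (qpen P \<gamma>h (xc \<gamma>h)) \<le> dual P a"
      using ge[OF \<gamma>h_nonneg] mu_\<gamma>h \<xi>_pos by (simp add: dual_eq)
    then have mu_ab: "0 \<le> mu P a" "0 \<le> mu P b"
      using mu_nonneg_of_dual[of _ a] mu_nonneg_of_dual[of _ b] eq by auto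
    \<comment> \<open>At \<open>a\<close> and \<open>b\<close> themselves \<open>mu\<close> is only
      known to be nonnegative; but a point strictly between them is \<open>\<gamma>h\<close> or a
      proper convex combination of \<open>\<gamma>h\<close> with one of them.\<close>
    have mu: "0 < mu P \<gamma>" if "a < \<gamma>" "\<gamma> < b" for \<gamma>
    proof -
      have comb: "0 < mu P ((1 - s) * c + s * d)" if "0 < s" "s < 1" "0 \<le> mu P c" "0 \<le> mu P d"
        "0 < mu P c \<or> 0 < mu P d" for s c d
      proof -
        have "0 < (1 - s) * mu P c + s * mu P d"
          using that by (auto intro: add_pos_nonneg add_nonneg_pos)
        also have "\<dots> \<le> mu P ((1 - s) * c + s * d)" using that by (intro mu_concave) auto
        finally show ?thesis .
      qed
      consider "\<gamma> < \<gamma>h" | "\<gamma> = \<gamma>h" | "\<gamma>h < \<gamma>" by linarith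
      then show ?thesis
      proof cases
        case 1
        obtain s where "0 < s" "s < 1" "\<gamma> = (1 - s) * a + s * \<gamma>h" using convex_coeff[OF \<open>a < \<gamma>\<close> 1] .
        then show ?thesis using comb[of s a \<gamma>h] mu_ab mu_\<gamma>h \<xi>_pos by simp
      next
        case 2 then show ?thesis using mu_\<gamma>h \<xi>_pos by simp
      next
        case 3
        obtain s where "0 < s" "s < 1" "\<gamma> = (1 - s) * \<gamma>h + s * b" using convex_coeff[OF 3 \<open>\<gamma> < b\<close>] .
        then show ?thesis using comb[of s \<gamma>h b] mu_ab mu_\<gamma>h \<xi>_pos by simp
      qed
    qed
    have flat: "nu \<gamma> = 0" if "a < \<gamma>" "\<gamma> < b" for \<gamma>
    proof -
      note m = mu[OF that]
      have "ereal (qpen P \<gamma> (xc \<gamma>)) \<le> dual P a" "ereal (qpen P \<gamma> (xc \<gamma>)) \<le> dual P b"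
        using ge[of \<gamma>] mu_pos_range[OF m] dual_eq[OF m] eq by auto
      \<comment> \<open>The maximizers lie on opposite sides of \<gamma>, so the two supergradient
        inequalities force the slope to vanish.\<close>
      then have "0 \<le> (a - \<gamma>) * nu \<gamma>" "0 \<le> (b - \<gamma>) * nu \<gamma>"
        using order_trans[OF _ dual_supergradient[OF m]] by fastforce+
      with that show ?thesis by (auto simp: zero_le_mult_iff)
    qed
    obtain g where g: "a < g" "g < b" using dense[OF ab] by blast
    obtain g' where g': "g < g'" "g' < b" using dense[OF g(2)] by blast
    have mg: "0 < mu P g" "0 < mu P g'" using mu g g' by auto
    have q: "q1 P (xc g) = 0" "q1 P (xc g') = 0" using flat g g' by (auto simp: nu_def)
    \<comment> \<open>Where \<open>q1 = 0\<close>, the value of \<open>qpen\<close> does not depend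
      on the multiplier; so \<open>xc g\<close> is also minimal at \<open>g'\<close>, and strong
      convexity identifies the two points.\<close>
    have "qpen P g' (xc g) \<le> qpen P g' (xc g')"
      using qpen_min[OF mg(1), of "xc g'"] q by (simp add: qpen_def)
    then have "mu P g' * (norm (xc g - xc g'))\<^sup>2 \<le> 0"
      using qpen_lower[OF mg(2) order_refl, of "xc g"] by simp
    then have x: "xc g' = xc g" using mg by (simp add: mult_le_0_iff)
    \<comment> \<open>The gradient at this fixed point is affine in the multiplier and vanishes at
      two values, hence at all, including \<open>\<gamma>h\<close>.\<close>
    have E: "A0 P *v xc g + b0 P + s *\<^sub>R (A1 P *v xc g + b1 P) = Apen P s *v xc g + bpen P s" for s
      by (simp add: Apen_vec bpen_def algebra_simps)
    have "(g' - g) *\<^sub>R (A1 P *v xc g + b1 P)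
        = (Apen P g' *v xc g + bpen P g') - (Apen P g *v xc g + bpen P g)"
      unfolding E[symmetric] by (simp add: algebra_simps)
    also have "\<dots> = 0" using xc_grad[OF mg(1)] xc_grad[OF mg(2)] x by simp
    finally have z1: "A1 P *v xc g + b1 P = 0" using g' by simp
    then have "A0 P *v xc g + b0 P = 0" using xc_grad[OF mg(1)] unfolding E[symmetric] by simp
    then have "Apen P \<gamma>h *v xc g + bpen P \<gamma>h = 0" unfolding E[symmetric] using z1 by simp
    then have "xc \<gamma>h = xc g" using mu_\<gamma>h \<xi>_pos by (intro xc_unique) auto
    with q(1) nu show False by (simp add: nu_def)
  qed
  then have "a = b" if "a \<in> dual_argmax P" "b \<in> dual_argmax P" for a b
    using that by (cases a b rule: linorder_cases) auto
  then show ?thesis using dual_argmax_nonempty by blast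
qed

text \<open>By the supergradient inequality the sign of \<open>nu \<gamma>\<close> puts
  \<open>gamma_star P\<close> at or beyond \<gamma> as seen from \<open>\<gamma>h\<close>; concavity
  then bounds \<open>mu P \<gamma>\<close> below by the smaller end value. The sign at
  \<open>\<gamma>h\<close> gives uniqueness, so the first branch of \<open>gamma_star\<close>
  applies.\<close>

lemma mu_star_le:
  assumes \<sigma>: "\<sigma> = 1 \<or> \<sigma> = -1" and nuh: "\<sigma> * nu \<gamma>h < 0"
    and \<gamma>: "0 < mu P \<gamma>" "\<sigma> * nu \<gamma> < 0" "0 \<le> \<sigma> * (\<gamma>h - \<gamma>)"
  shows "min (mu_star P) \<xi> \<le> mu P \<gamma>"
proof -
  have "nu \<gamma>h \<noteq> 0" using nuh by auto
  then have ex: "\<exists>!\<gamma>. \<gamma> \<in> dual_argmax P" by (rule dual_argmax_unique)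
  then have "gamma_star P = (THE \<gamma>. \<gamma> \<in> dual_argmax P)" by (simp add: gamma_star_def)
  then have arg: "gamma_star P \<in> dual_argmax P" using theI'[OF ex] by simp
  have "ereal (qpen P \<gamma> (xc \<gamma>)) \<le> dual P (gamma_star P)"
    using arg mu_pos_range[OF \<gamma>(1)] dual_eq[OF \<gamma>(1)] by (auto simp: dual_argmax_def dest!: spec[of _ \<gamma>])
  also have "\<dots> \<le> ereal (qpen P \<gamma> (xc \<gamma>) + (gamma_star P - \<gamma>) * nu \<gamma>)"
    by (rule dual_supergradient[OF \<gamma>(1)])
  finally have "0 \<le> (gamma_star P - \<gamma>) * nu \<gamma>" by simp
  with \<sigma> \<gamma>(2) have "0 \<le> \<sigma> * (\<gamma> - gamma_star P)" by (auto simp: zero_le_mult_iff)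
  with \<sigma> \<gamma>(3) have "gamma_star P \<le> \<gamma> \<and> \<gamma> \<le> \<gamma>h \<or> \<gamma>h \<le> \<gamma> \<and> \<gamma> \<le> gamma_star P" by auto
  then show ?thesis
    using mu_min_le[of "gamma_star P" \<gamma> \<gamma>h] mu_min_le[of \<gamma>h \<gamma> "gamma_star P"] mu_\<gamma>h
    unfolding mu_star_def by auto
qed

end

section \<open>Reasoning about runs\<close>

text \<open>A total-correctness triple with a cost budget: failure is excluded. The sequencing rules
  below hand each continuation what remains of the budget.\<close>

definition run_sat :: "'a run \<Rightarrow> ('a \<Rightarrow> bool) \<Rightarrow> real \<Rightarrow> bool" where
  "run_sat m Q B \<longleftrightarrow> (\<exists>x k. m = (Some x, k) \<and> Q x \<and> real k \<le> B)"

lemma run_sat_ret: "Q x \<Longrightarrow> 0 \<le> B \<Longrightarrow> run_sat (ret x) Q B"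
  by (simp add: run_sat_def ret_def)

lemma run_sat_call: "Q (fst y) \<Longrightarrow> real (snd y) \<le> B \<Longrightarrow> run_sat (call y) Q B"
  by (simp add: run_sat_def call_def)

lemma run_sat_charge: "real k \<le> B1 \<Longrightarrow> run_sat (f ()) Q (B - B1) \<Longrightarrow> run_sat (run_bind (charge k) f) Q B"
  by (auto simp: run_sat_def charge_def run_bind_def)

lemma run_sat_bind:
  assumes "run_sat m Q' B1" "\<And>x. Q' x \<Longrightarrow> run_sat (f x) Q (B - B1)"
  shows "run_sat (run_bind m f) Q B"
proof -
  obtain x k where m: "m = (Some x, k)" "Q' x" "real k \<le> B1"
    using assms(1) by (auto simp: run_sat_def)
  obtain y j where "f x = (Some y, j)" "Q y" "real j \<le> B - B1"
    using assms(2)[OF m(2)] by (auto simp: run_sat_def)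
  with m show ?thesis by (auto simp: run_sat_def run_bind_def)
qed

lemma run_sat_bind_pair:
  assumes "run_sat m (\<lambda>(x, y). Q' x y) B1" "\<And>x y. Q' x y \<Longrightarrow> run_sat (f x y) Q (B - B1)"
  shows "run_sat (run_bind m (\<lambda>(x, y). f x y)) Q B"
  using assms(1) by (rule run_sat_bind) (use assms(2) in auto)

lemma run_sat_mono: "run_sat m Q B \<Longrightarrow> (\<And>x. Q x \<Longrightarrow> Q' x) \<Longrightarrow> B \<le> B' \<Longrightarrow> run_sat m Q' B'"
  by (force simp: run_sat_def)

section \<open>Adaptive bisection with independent seeds\<close>

text \<open>Overwriting coordinate \<open>i\<close> by a fresh draw preserves the product
  distribution, and under this map the event pulls back to \<open>X \<times> F\<close> when
  \<open>F\<close> ignores that coordinate. In the bisection, \<open>F\<close> is the success of the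
  remaining calls.\<close>

lemma PiM_resample_coordinate:
  fixes M :: "'s measure" and i :: 'i
  defines "PM \<equiv> PiM UNIV (\<lambda>_::'i. M)"
  assumes M: "prob_space M" and X: "X \<in> sets M" and F: "F \<in> sets PM"
    and indep: "\<And>\<omega> x. \<omega> \<in> space PM \<Longrightarrow> x \<in> space M \<Longrightarrow> fun_upd \<omega> i x \<in> F \<longleftrightarrow> \<omega> \<in> F"
  shows "measure PM ({\<omega> \<in> space PM. \<omega> i \<in> X} \<inter> F) = measure M X * measure PM F"
proof -
  interpret M: prob_space M by fact
  interpret Pi: prob_space PM unfolding PM_def by (intro prob_space_PiM M)
  let ?f = "\<lambda>(x, \<omega>::'i \<Rightarrow> 's). fun_upd \<omega> i x"
  let ?G = "{\<omega> \<in> space PM. \<omega> i \<in> X} \<inter> F"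
  have distr: "distr (M \<Otimes>\<^sub>M PM) PM ?f = PM"
    using distr_pair_PiM_eq_PiM[of UNIV "\<lambda>_::'i. M" i] M by (simp add: PM_def)
  have f: "?f \<in> (M \<Otimes>\<^sub>M PM) \<rightarrow>\<^sub>M PM"
    unfolding PM_def using measurable_add_dim[of i UNIV "\<lambda>_::'i. M"]
    by (subst measurable_pair_swap_iff) (simp add: split_def)
  have "{\<omega> \<in> space PM. \<omega> i \<in> X} \<in> sets PM"
    unfolding PM_def using X by measurable
  then have G: "?G \<in> sets PM" using F by auto
  have "?f -` ?G \<inter> space (M \<Otimes>\<^sub>M PM) = X \<times> F"
  proof -
    have "fun_upd \<omega> i x \<in> space PM" if "x \<in> space M" "\<omega> \<in> space PM" for x \<omega>
      using that by (auto simp: PM_def space_PiM)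
    then show ?thesis
      using indep sets.sets_into_space[OF X, THEN subsetD] sets.sets_into_space[OF F, THEN subsetD]
      by (auto simp: space_pair_measure)
  qed
  then have "measure PM ?G = measure (M \<Otimes>\<^sub>M PM) (X \<times> F)"
    by (subst distr[symmetric]) (simp add: measure_distr[OF f G])
  also have "\<dots> = measure M X * measure PM F"
    using Pi.emeasure_pair_measure_Times[OF X F] by (simp add: measure_def enn2real_mult)
  finally show ?thesis .
qed

text \<open>\<open>G\<close> says that the call at a point is good, \<open>U\<close> and \<open>L\<close> that it replaces the upper, resp. lower
  end of the interval. The seed with index \<open>k\<close> is consumed when \<open>k\<close> steps are left.\<close>

primrec bisect_good :: "(real \<Rightarrow> 's \<Rightarrow> bool) \<Rightarrow> (real \<Rightarrow> 's \<Rightarrow> bool) \<Rightarrow> (real \<Rightarrow> 's \<Rightarrow> bool)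
    \<Rightarrow> nat \<Rightarrow> real \<Rightarrow> real \<Rightarrow> (nat \<Rightarrow> 's) \<Rightarrow> bool" where
  "bisect_good G U L 0 l r s = True"
| "bisect_good G U L (Suc k) l r s =
    (let \<gamma> = (l + r) / 2; y = s (Suc k) in
      G \<gamma> y \<and> (U \<gamma> y \<longrightarrow> bisect_good G U L k l \<gamma> s) \<and> (L \<gamma> y \<longrightarrow> bisect_good G U L k \<gamma> r s))"

lemma bisect_good_cong:
  "(\<And>j. j \<le> k \<Longrightarrow> s j = s' j) \<Longrightarrow> bisect_good G U L k l r s = bisect_good G U L k l r s'"
  by (induction k arbitrary: l r) (simp_all add: Let_def)

text \<open>Split by the answer of the first call: upper end replaced, lower end replaced, or
  neither. In the first two classes the next interval is fixed and the remaining success event reads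
  only seeds of smaller index, so it is independent of the class; then
  \<open>(1 - q) * (1 - k * q) \<ge> 1 - (k + 1) * q\<close>. Measurability is asked only on
  \<open>{a..b}\<close>, where the contract of the eigenvector routine applies.\<close>

lemma bisect_good_prob:
  fixes M :: "'s measure" and \<iota> :: "nat \<Rightarrow> 'i"
  defines "PM \<equiv> PiM UNIV (\<lambda>_::'i. M)"
  assumes M: "prob_space M" and \<iota>: "inj \<iota>" and q: "0 \<le> q"
    and meas: "\<And>\<gamma>. \<gamma> \<in> {a..b} \<Longrightarrow> {s \<in> space M. G \<gamma> s} \<in> sets M"
      "\<And>\<gamma>. \<gamma> \<in> {a..b} \<Longrightarrow> {s \<in> space M. U \<gamma> s} \<in> sets M"
      "\<And>\<gamma>. \<gamma> \<in> {a..b} \<Longrightarrow> {s \<in> space M. L \<gamma> s} \<in> sets M"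
    and prob: "\<And>\<gamma>. \<gamma> \<in> {a..b} \<Longrightarrow> 1 - q \<le> measure M {s \<in> space M. G \<gamma> s}"
    and disj: "\<And>\<gamma> s. \<not> (U \<gamma> s \<and> L \<gamma> s)"
    and lr: "a \<le> l" "l \<le> r" "r \<le> b"
  defines "E \<equiv> \<lambda>k l r. {\<omega> \<in> space PM. bisect_good G U L k l r (\<lambda>j. \<omega> (\<iota> j))}"
  shows "E k l r \<in> sets PM \<and> 1 - real k * q \<le> measure PM (E k l r)"
  using lr
proof (induction k arbitrary: l r)
  interpret M: prob_space M by fact
  interpret Pi: prob_space PM unfolding PM_def by (intro prob_space_PiM M)
  case 0
  then show ?case by (simp add: E_def Pi.prob_space)
next
  case (Suc k l r)
  interpret M: prob_space M by fact
  interpret Pi: prob_space PM unfolding PM_def by (intro prob_space_PiM M)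
  define \<gamma> where "\<gamma> = (l + r) / 2"
  have \<gamma>: "a \<le> \<gamma>" "l \<le> \<gamma>" "\<gamma> \<le> r" "\<gamma> \<le> b" using Suc.prems by (auto simp: \<gamma>_def)
  define i where "i = \<iota> (Suc k)"
  define XU where "XU = {s \<in> space M. G \<gamma> s} \<inter> {s \<in> space M. U \<gamma> s}"
  define XL where "XL = {s \<in> space M. G \<gamma> s} \<inter> {s \<in> space M. L \<gamma> s}"
  define XN where "XN = {s \<in> space M. G \<gamma> s} - {s \<in> space M. U \<gamma> s} - {s \<in> space M. L \<gamma> s}"
  have X: "XU \<in> sets M" "XL \<in> sets M" "XN \<in> sets M"
    unfolding XU_def XL_def XN_def using meas[of \<gamma>] \<gamma> by auto
  have F: "E k l \<gamma> \<in> sets PM" "1 - real k * q \<le> measure PM (E k l \<gamma>)"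
    "E k \<gamma> r \<in> sets PM" "1 - real k * q \<le> measure PM (E k \<gamma> r)"
    using Suc.IH[of l \<gamma>] Suc.IH[of \<gamma> r] Suc.prems \<gamma> by auto
  let ?C = "\<lambda>X. {\<omega> \<in> space PM. \<omega> i \<in> X}"
  have C: "?C X \<in> sets PM" if "X \<in> sets M" for X
    unfolding PM_def using that by measurable
  have upd: "fun_upd \<omega> i x \<in> E k l' r' \<longleftrightarrow> \<omega> \<in> E k l' r'" if "\<omega> \<in> space PM" "x \<in> space M" for \<omega> x l' r'
  proof -
    have "fun_upd \<omega> i x \<in> space PM" using that by (auto simp: PM_def space_PiM)
    moreover have "bisect_good G U L k l' r' (\<lambda>j. (fun_upd \<omega> i x) (\<iota> j)) = bisect_good G U L k l' r' (\<lambda>j. \<omega> (\<iota> j))"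
      using \<iota> by (intro bisect_good_cong) (auto simp: i_def inj_eq)
    ultimately show ?thesis using that by (simp add: E_def)
  qed
  have mul: "measure PM (?C X \<inter> H) = measure M X * measure PM H"
    if "X \<in> sets M" "H \<in> sets PM" "\<And>\<omega> x. \<omega> \<in> space PM \<Longrightarrow> x \<in> space M \<Longrightarrow> fun_upd \<omega> i x \<in> H \<longleftrightarrow> \<omega> \<in> H" for X H
    using PiM_resample_coordinate[OF M, of X H i] that unfolding PM_def by blast
  define EU where "EU = ?C XU \<inter> E k l \<gamma>"
  define EL where "EL = ?C XL \<inter> E k \<gamma> r"
  define EN where "EN = ?C XN \<inter> space PM"
  have sets: "EU \<in> sets PM" "EL \<in> sets PM" "EN \<in> sets PM"
    unfolding EU_def EL_def EN_def using C X F by auto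
  have mE: "measure PM EU = measure M XU * measure PM (E k l \<gamma>)"
    "measure PM EL = measure M XL * measure PM (E k \<gamma> r)"
    unfolding EU_def EL_def by (intro mul X F upd; assumption)+
  have "measure PM EN = measure M XN * measure PM (space PM)"
    unfolding EN_def by (rule mul[OF X(3) sets.top]) (auto simp: PM_def space_PiM)
  then have mN: "measure PM EN = measure M XN" by (simp add: Pi.prob_space)
  have sp: "\<omega> j \<in> space M" if "\<omega> \<in> space PM" for \<omega> j
    using that by (auto simp: PM_def space_PiM)
  have eq: "E (Suc k) l r = EU \<union> EL \<union> EN"
    using sp disj[of \<gamma>]
    by (auto simp: E_def EU_def EL_def EN_def XU_def XL_def XN_def Let_def \<gamma>_def[symmetric] i_def)
  have "measure PM (EU \<union> EL \<union> EN) = measure PM (EU \<union> EL) + measure PM EN"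
    using sets disj[of \<gamma>] by (intro Pi.finite_measure_Union) (auto simp: EU_def EL_def EN_def XU_def XL_def XN_def)
  also have "measure PM (EU \<union> EL) = measure PM EU + measure PM EL"
    using sets disj[of \<gamma>] by (intro Pi.finite_measure_Union) (auto simp: EU_def EL_def XU_def XL_def)
  finally have mE': "measure PM (E (Suc k) l r) = measure PM EU + measure PM EL + measure PM EN"
    unfolding eq .
  have mG: "measure M {s \<in> space M. G \<gamma> s} = measure M XU + measure M XL + measure M XN"
  proof -
    have "{s \<in> space M. G \<gamma> s} = XU \<union> XL \<union> XN" by (auto simp: XU_def XL_def XN_def)
    moreover have "measure M (XU \<union> XL \<union> XN) = measure M (XU \<union> XL) + measure M XN"
      using X by (intro M.finite_measure_Union) (auto simp: XU_def XL_def XN_def)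
    moreover have "measure M (XU \<union> XL) = measure M XU + measure M XL"
      using X disj[of \<gamma>] by (intro M.finite_measure_Union) (auto simp: XU_def XL_def)
    ultimately show ?thesis by simp
  qed
  have "1 - real (Suc k) * q \<le> measure PM (E (Suc k) l r)"
  \<comment> \<open>Multiplying by this factor preserves inequalities only if it is nonnegative;
    otherwise the claimed lower bound is at most 0.\<close>
  proof (cases "0 \<le> 1 - real k * q")
    case True
    have "0 \<le> real k * q * q" using q by simp
    then have "1 - real (Suc k) * q \<le> (1 - q) * (1 - real k * q)" by (simp add: algebra_simps)
    also have "\<dots> \<le> measure M {s \<in> space M. G \<gamma> s} * (1 - real k * q)"
      using prob[of \<gamma>] \<gamma> True by (intro mult_right_mono) auto
    also have "\<dots> = measure M XU * (1 - real k * q) + measure M XL * (1 - real k * q) + measure M XN * (1 - real k * q)"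
      unfolding mG by (simp add: algebra_simps)
    also have "\<dots> \<le> measure PM EU + measure PM EL + measure PM EN"
        unfolding mE mN using F q True by (intro add_mono mult_left_mono mult_right_le_one_le) (auto simp: True)
    finally show ?thesis unfolding mE' .
  next
    case False
    then have "1 - real (Suc k) * q \<le> 0" using q by (simp add: algebra_simps)
    then show ?thesis by (meson measure_nonneg order_trans)
  qed
  then show ?case unfolding eq using sets by auto
qed

section \<open>Correctness and cost of the procedures\<close>

lemma one_le_mult: "1 \<le> (a::real) \<Longrightarrow> 1 \<le> b \<Longrightarrow> 1 \<le> a * b"
  using mult_mono[of 1 a 1 b] by simp

lemma nat_ceiling_log:
  fixes X :: real
  assumes "1 < X"
  defines "T \<equiv> nat \<lceil>log 2 X\<rceil>"
  shows "1 \<le> T" "X \<le> 2 ^ T" "2 ^ T \<le> 2 * X" "real T \<le> log 2 X + 1"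
proof -
  have l: "0 < log 2 X" using assms by simp
  then show "1 \<le> T" by (simp add: T_def Suc_le_eq)
  have le: "log 2 X \<le> real T" "real T \<le> log 2 X + 1"
    using l by (auto simp: T_def intro: of_nat_ceiling)
  show "real T \<le> log 2 X + 1" by fact
  show "X \<le> 2 ^ T" using le assms(1) by (simp add: log_le_iff powr_realpow)
  have "2 ^ T = 2 powr real T" by (simp add: powr_realpow)
  also have "\<dots> \<le> 2 powr (log 2 X + 1)" using le by (intro powr_mono) auto
  also have "\<dots> = 2 * X" using assms by (simp add: powr_add)
  finally show "2 ^ T \<le> 2 * X" .
qed

locale gtrs_algorithm = gtrs_instance P \<xi> \<zeta> \<gamma>h
  for P :: "'n::finite gtrs" and \<xi> \<zeta> \<gamma>h :: real +
  fixes M :: "'s measure" and S :: "('s, 'n) solvers" and K \<epsilon> p :: real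
  assumes M: "prob_space M" and K_pos: "0 < K" and spec: "solvers_spec K M S"
    and dim_le: "CARD('n) \<le> nnz (A0 P) + nnz (A1 P)"
    and \<epsilon>: "0 < \<epsilon>" "\<epsilon> < 1" and p: "0 < p" "p < 1"
begin

text \<open>Up to its absolute constant and the factor \<open>1 + log 2 (1 / \<phi>)\<close>, the claimed time bound is
  \<open>U * w \<phi>\<close>; the routines called at level \<open>mu \<gamma> \<approx> m\<close> cost a multiple of \<open>U * w m\<close>.\<close>

definition N :: real where "N = real (nnz (A0 P) + nnz (A1 P))"
definition R :: real where "R = \<zeta> / (\<epsilon> * \<xi>)"
definition Lg :: real where "Lg = log 2 R"
definition Lp :: real where "Lp = log 2 (real CARD('n) / p)"
definition LL :: real where "LL = 1 + log 2 Lg"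
definition U :: real where "U = (1 + K) * (N * Lp * Lg * LL)"
definition \<tau> :: real where "\<tau> = \<epsilon> / (4 * \<zeta>)"
definition w :: "real \<Rightarrow> real" where "w m = sqrt (\<zeta> / m)"

text \<open>In dimension one a pencil of two negative numbers cannot be positive definite.\<close>

lemma dim_ge_2: "2 \<le> CARD('n)"
proof (rule ccontr)
  assume "\<not> ?thesis"
  moreover have "0 < CARD('n)" by simp
  ultimately have "CARD('n) = 1" by linarith
  then obtain i :: 'n where i: "UNIV = {i}" by (rule card_1_singletonE)
  have form: "x \<bullet> (A *v x) = A $ i $ i * (x $ i)\<^sup>2" for A :: "real^'n^'n" and x
    by (simp add: inner_vec_def matrix_vector_mult_def i power2_eq_square)
  have neg: "A $ i $ i < 0" if A: "transpose A = A" "\<exists>l<0. eigenvalue A l" for A :: "real^'n^'n"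
  proof -
    obtain v where "v \<bullet> (A *v v) < 0"
      using lambda_min_attained[OF A(1)] lambda_min_neg[OF A] by metis
    then show ?thesis unfolding form by (metis mult_less_0_iff not_less zero_le_power2)
  qed
  have "\<xi> * (norm (axis i (1::real) :: real^'n))\<^sup>2 \<le> axis i 1 \<bullet> (Apen P \<gamma>h *v axis i 1)"
    by (rule mu_form_le[OF mu_\<gamma>h])
  then have "\<xi> \<le> A0 P $ i $ i + \<gamma>h * A1 P $ i $ i"
    unfolding form by (simp add: Apen_def)
  also have "\<dots> < 0"
    using neg[OF sym0 neg0] neg[OF sym1 neg1] \<gamma>h_nonneg
    by (intro add_neg_nonpos mult_nonneg_nonpos) auto
  finally show False using \<xi>_pos by simp
qed

section \<open>Absorption of parameters and logarithms into \<open>R\<close> and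
  \<open>Lg\<close>\<close>

lemma N_ge_2: "2 \<le> N" and dim_le_N: "real CARD('n) \<le> N"
  using dim_ge_2 dim_le by (auto simp: N_def)

lemma R_bounds: "2 \<le> R" "\<zeta> \<le> R" "1 / \<xi> \<le> R" "1 / \<epsilon> \<le> R"
proof -
  have ex: "\<epsilon> * \<xi> \<le> 1" "\<epsilon> * \<xi> \<le> \<xi>" "\<epsilon> * \<xi> \<le> \<epsilon>" "0 < \<epsilon> * \<xi>"
    using \<epsilon> \<xi>_pos \<xi>_le_1 by (auto intro: mult_le_one simp: mult_left_le_one_le mult_left_le)
  have "2 * (\<epsilon> * \<xi>) \<le> \<zeta>" using ex \<gamma>h_bounds by linarith
  then show "2 \<le> R" using ex by (simp add: R_def field_simps)
  have "\<zeta> * (\<epsilon> * \<xi>) \<le> \<zeta> * 1" using ex \<zeta>_ge_1 by (intro mult_left_mono) auto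
  then show "\<zeta> \<le> R" using ex by (simp add: R_def field_simps)
  have "1 / \<xi> \<le> \<zeta> / \<xi>" using \<xi>_pos \<zeta>_ge_1 by (simp add: divide_right_mono)
  also have "\<dots> \<le> R" unfolding R_def using ex \<zeta>_ge_1 by (intro divide_left_mono) auto
  finally show "1 / \<xi> \<le> R" .
  have "1 / \<epsilon> \<le> \<zeta> / \<epsilon>" using \<epsilon> \<zeta>_ge_1 by (simp add: divide_right_mono)
  also have "\<dots> \<le> R" unfolding R_def using ex \<zeta>_ge_1 \<epsilon> by (intro divide_left_mono) auto
  finally show "1 / \<epsilon> \<le> R" .
qed

lemma numeral_power_le_R: "2 ^ k * R ^ j \<le> R ^ (k + j)"
  unfolding power_add using R_bounds by (intro mult_right_mono power_mono) auto

lemma R_power_ge_1: "1 \<le> R ^ j"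
  using R_bounds by (intro one_le_power) simp

text \<open>As \<open>2 \<le> R\<close>, powers of two count as further powers of \<open>R\<close>;
  so only exponents have to be tracked when a logarithm is bounded by a multiple of
  \<open>Lg\<close>.\<close>

lemma log_le_Lg:
  assumes "0 < X" "X \<le> 2 ^ k * R ^ j"
  shows "log 2 X \<le> real (k + j) * Lg"
proof -
  have "log 2 X \<le> log 2 (R ^ (k + j))"
    using assms numeral_power_le_R[of k j] R_power_ge_1 by (intro log_mono) auto
  also have "\<dots> = real (k + j) * Lg" using R_bounds by (simp add: Lg_def log_nat_power)
  finally show ?thesis .
qed

lemma Lg_ge_1: "1 \<le> Lg"
  using R_bounds by (simp add: Lg_def le_log_iff)

lemma Lp_ge_1: "1 \<le> Lp"
proof -
  have "2 * p \<le> 2 * 1" using p by (intro mult_left_mono) auto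
  then have "2 \<le> real CARD('n) / p" using dim_ge_2 p by (simp add: field_simps)
  then show ?thesis by (simp add: Lp_def le_log_iff)
qed

lemma LL_ge_1: "1 \<le> LL"
  using Lg_ge_1 by (simp add: LL_def)

lemma U_bounds:
  "N \<le> U" "N * Lg \<le> U" "K * (N * Lg) \<le> U"
  "N * Lp * Lg * LL \<le> U" "K * (N * Lp * Lg * LL) \<le> U" "2 \<le> U"
proof -
  define X where "X = N * Lp * Lg * LL"
  have N0: "0 \<le> N" using N_ge_2 by simp
  have "N * Lg * 1 \<le> N * Lg * (Lp * LL)"
    using N0 Lg_ge_1 Lp_ge_1 LL_ge_1 by (intro mult_left_mono one_le_mult) auto
  then have 1: "N * Lg \<le> X" by (simp add: X_def mult_ac)
  have 2: "N \<le> N * Lg" using N0 Lg_ge_1 by (simp add: mult_left_le mult_le_cancel_left1)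
  have X0: "0 \<le> X" using 1 2 N0 by linarith
  have U: "U = X + K * X" by (simp add: U_def X_def algebra_simps)
  have KX: "0 \<le> K * X" "K * (N * Lg) \<le> K * X" using K_pos X0 1 by auto
  show "N \<le> U" "N * Lg \<le> U" "K * (N * Lg) \<le> U" "N * Lp * Lg * LL \<le> U" "K * (N * Lp * Lg * LL) \<le> U" "2 \<le> U"
    unfolding X_def[symmetric] using 1 2 X0 KX U N_ge_2 by linarith+
qed

lemma nnz_Apen: "nnz (Apen P \<gamma>) \<le> nnz (A0 P) + nnz (A1 P)"
proof -
  have "{(i, j). Apen P \<gamma> $ i $ j \<noteq> 0} \<subseteq> {(i, j). A0 P $ i $ j \<noteq> 0} \<union> {(i, j). A1 P $ i $ j \<noteq> 0}"
    by (auto simp: Apen_def)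
  then have "nnz (Apen P \<gamma>) \<le> card ({(i, j). A0 P $ i $ j \<noteq> 0} \<union> {(i, j). A1 P $ i $ j \<noteq> 0})"
    unfolding nnz_def by (intro card_mono) auto
  also have "\<dots> \<le> nnz (A0 P) + nnz (A1 P)" unfolding nnz_def by (rule card_Un_le)
  finally show ?thesis .
qed

lemma max_nnz_le: "real (max CARD('n) (nnz (Apen P \<gamma>))) \<le> N"
  using nnz_Apen[of \<gamma>] dim_le by (simp add: N_def)

lemma ops_le: "real (ops_pencil P) \<le> 4 * N" "real (ops_quad (Apen P \<gamma>)) \<le> 8 * N" "real (ops_quad (A1 P)) \<le> 8 * N"
  using nnz_Apen[of \<gamma>] dim_le dim_ge_2 by (auto simp: ops_pencil_def ops_quad_def N_def)

lemma \<tau>_bounds: "0 < \<tau>" "\<tau> \<le> 1"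
proof -
  show "0 < \<tau>" using \<epsilon> \<zeta>_ge_1 by (simp add: \<tau>_def)
  show "\<tau> \<le> 1" unfolding \<tau>_def using \<epsilon> \<zeta>_ge_1 by (subst divide_le_eq_1) auto
qed

lemma w_nonneg: "0 < m \<Longrightarrow> 0 \<le> w m"
  using \<zeta>_ge_1 by (simp add: w_def)

lemma w_ge_1: "0 < m \<Longrightarrow> m \<le> 1 \<Longrightarrow> 1 \<le> w m"
  using \<zeta>_ge_1 by (simp add: w_def)

lemma mult_weight: "0 \<le> X \<Longrightarrow> X \<le> U \<Longrightarrow> 1 \<le> v \<Longrightarrow> X \<le> U * v"
  using mult_mono[of X U 1 v] by simp

text \<open>The weight \<open>v\<close> is kept separate from \<open>m\<close> so that calls at
  \<open>m / 2\<close> and \<open>m / 4\<close> can be charged in the units of stage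
  \<open>m\<close>. The 170 covers \<open>3 * 49\<close> for conjugate gradients, where
  \<open>49 = 37 + 12\<close> is the exponent total in the logarithm, and 17 for the charged
  operations.\<close>

lemma approx_nu_sat:
  assumes m: "0 < m" "m \<le> mu P \<gamma>" "m \<le> 1" and inv: "1 / m \<le> 2 ^ 15 * R ^ 4"
    and sq: "sqrt (2 * \<zeta> / m) \<le> 3 * v" and v: "1 \<le> v"
  shows "run_sat (approx_nu S P \<zeta> m \<tau> \<gamma>)
    (\<lambda>(x, \<nu>). norm (x - xc \<gamma>) \<le> m * \<tau> / (10 * \<zeta>) \<and> \<nu> = q1 P x \<and> \<bar>\<nu> - nu \<gamma>\<bar> \<le> \<tau>) (170 * (U * v))"
proof -
  have pos: "0 < mu P \<gamma>" using m by simp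
  have range: "0 \<le> \<gamma>" "\<gamma> \<le> \<zeta>" using mu_pos_range[OF pos] by auto
  define \<delta> where "\<delta> = m * \<tau> / (10 * \<zeta>)"
  have \<delta>: "0 < \<delta>" using m \<tau>_bounds \<zeta>_ge_1 by (simp add: \<delta>_def)
  define y where "y = conj_grad S (Apen P \<gamma>) (bpen P \<gamma>) m (2 * \<zeta>) \<delta>"
  have "conj_grad_spec K (conj_grad S)" using spec by (simp add: solvers_spec_def)
  then have y: "norm (fst y + matrix_inv (Apen P \<gamma>) *v bpen P \<gamma>) \<le> \<delta>"
    "real (snd y) \<le> K * real (max CARD('n) (nnz (Apen P \<gamma>))) * sqrt (2 * \<zeta> / m)
      * log 2 (2 + norm (bpen P \<gamma>) / (m * \<delta>))"
    using sym_Apen m \<delta> le_mu_iff[THEN iffD1, OF m(2)] Apen_loewner_le[OF range]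
    unfolding conj_grad_spec_def y_def by blast+
  have L: "log 2 (2 + norm (bpen P \<gamma>) / (m * \<delta>)) \<le> 49 * Lg"
  proof -
    have "norm (bpen P \<gamma>) / (m * \<delta>) \<le> 2 * \<zeta> / (m * \<delta>)"
      using bpen_norm[OF range] m \<delta> by (intro divide_right_mono) auto
    also have "\<dots> = 80 * \<zeta> ^ 3 * (1 / \<epsilon>) * (1 / m)\<^sup>2"
      using m \<epsilon> \<zeta>_ge_1 by (simp add: \<delta>_def \<tau>_def field_simps power2_eq_square power3_eq_cube)
    also have "\<dots> \<le> 80 * R ^ 3 * R * (2 ^ 15 * R ^ 4)\<^sup>2"
      using R_bounds inv \<zeta>_ge_1 \<epsilon> m by (intro mult_mono power_mono) auto
    also have "\<dots> = 80 * 2 ^ 30 * R ^ (3 + (1 + 4 * 2))"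
      by (simp only: power_mult_distrib power_mult[symmetric] power_add power_one_right mult_ac) simp
    also have "R ^ (3 + (1 + 4 * 2)) = R ^ 12" by simp
    finally have "2 + norm (bpen P \<gamma>) / (m * \<delta>) \<le> 2 * 1 + 80 * 2 ^ 30 * R ^ 12" by simp
    also have "\<dots> \<le> 2 * R ^ 12 + 80 * 2 ^ 30 * R ^ 12" using R_power_ge_1 by (intro add_right_mono mult_left_mono) auto
    also have "\<dots> \<le> 2 ^ 37 * R ^ 12" using R_power_ge_1[of 12] by simp
    finally have "log 2 (2 + norm (bpen P \<gamma>) / (m * \<delta>)) \<le> real (37 + 12) * Lg"
      using m \<delta> by (intro log_le_Lg) (auto simp: add_pos_nonneg)
    then show ?thesis by simp
  qed
  have "0 \<le> log 2 (2 + norm (bpen P \<gamma>) / (m * \<delta>))" using m \<delta> by (intro zero_le_log_cancel_iff[THEN iffD2]) (auto simp: add_pos_nonneg)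
  then have "real (snd y) \<le> K * N * (3 * v) * (49 * Lg)"
    using y(2) max_nnz_le[of \<gamma>] K_pos sq L N_ge_2 v \<zeta>_ge_1 m Lg_ge_1
    by (elim order_trans, intro mult_mono) auto
  also have "\<dots> = 147 * (K * (N * Lg) * v)" by simp
  also have "\<dots> \<le> 147 * (U * v)" using U_bounds v by (intro mult_left_mono mult_right_mono) auto
  finally have cost: "real (snd y) \<le> 147 * (U * v)" .
  have dist: "norm (fst y - xc \<gamma>) \<le> m * \<tau> / (10 * \<zeta>)" using y(1) by (simp add: xc_def \<delta>_def)
  have "N \<le> U * v" using U_bounds N_ge_2 v by (intro mult_weight) auto
  then have rest: "0 \<le> 170 * (U * v) - 17 * N - 147 * (U * v)" using N_ge_2 by linarith
  show ?thesis
    unfolding approx_nu_def \<delta>_def[symmetric]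
    apply (intro run_sat_charge[where ?B1.0 = "17 * N"])
    subgoal using ops_le N_ge_2 by simp
    apply (rule run_sat_bind[where Q' = "\<lambda>x. x = fst y" and ?B1.0 = "147 * (U * v)"])
    subgoal unfolding y_def[symmetric] by (intro run_sat_call cost) simp
    subgoal for x
      using dist[folded \<delta>_def] q1_perturbation[OF m \<tau>_bounds dist] \<tau>_bounds(1)
      by (intro run_sat_ret[OF _ rest]) (auto simp: nu_def)
    done
qed

subsection \<open>Bisection\<close>

definition eig_call :: "real \<Rightarrow> real \<Rightarrow> real \<Rightarrow> 's \<Rightarrow> (real^'n) \<times> nat" where
  "eig_call m q \<gamma> s = approx_eig S (Apen P \<gamma>) (2 * \<zeta>) (m / 8) q s"

definition ray :: "real \<Rightarrow> real \<Rightarrow> real \<Rightarrow> 's \<Rightarrow> real" where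
  "ray m q \<gamma> s = fst (eig_call m q \<gamma> s) \<bullet> (Apen P \<gamma> *v fst (eig_call m q \<gamma> s))"

definition eig_cost :: "real \<Rightarrow> real \<Rightarrow> real" where
  "eig_cost m q = K * N * sqrt (2 * \<zeta> / (m / 8)) * log 2 (2 + real CARD('n) / q)"

definition good_call :: "real \<Rightarrow> real \<Rightarrow> real \<Rightarrow> 's \<Rightarrow> bool" where
  "good_call m q \<gamma> s \<longleftrightarrow> norm (fst (eig_call m q \<gamma> s)) = 1 \<and> ray m q \<gamma> s \<le> mu P \<gamma> + m / 8 \<and>
    real (snd (eig_call m q \<gamma> s)) \<le> eig_cost m q"

definition upd_hi :: "side \<Rightarrow> real \<Rightarrow> real \<Rightarrow> real \<Rightarrow> 's \<Rightarrow> bool" where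
  "upd_hi d m q \<gamma> s = (case d of LeftSide \<Rightarrow> m < ray m q \<gamma> s
     | RightSide \<Rightarrow> \<not> m < ray m q \<gamma> s \<and> ray m q \<gamma> s < 5 / 8 * m)"

definition upd_lo :: "side \<Rightarrow> real \<Rightarrow> real \<Rightarrow> real \<Rightarrow> 's \<Rightarrow> bool" where
  "upd_lo d m q \<gamma> s = (case d of LeftSide \<Rightarrow> \<not> m < ray m q \<gamma> s \<and> ray m q \<gamma> s < 5 / 8 * m
     | RightSide \<Rightarrow> m < ray m q \<gamma> s)"

definition stage_good :: "side \<Rightarrow> real \<Rightarrow> real \<Rightarrow> nat \<Rightarrow> real \<Rightarrow> real \<Rightarrow> (nat \<Rightarrow> 's) \<Rightarrow> bool" where
  "stage_good d m q = bisect_good (good_call m q) (upd_hi d m q) (upd_lo d m q)"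

lemma
  assumes m: "0 < m" "m \<le> 1" and q: "0 < q" "q < 1" and \<gamma>: "\<gamma> \<in> {0..\<zeta>}"
  shows eig_call_measurable: "eig_call m q \<gamma> \<in> M \<rightarrow>\<^sub>M borel \<Otimes>\<^sub>M count_space UNIV"
    and good_call_prob: "1 - q \<le> measure M {s \<in> space M. good_call m q \<gamma> s}"
proof -
  have sp: "spectral_norm (Apen P \<gamma>) \<le> 2 * \<zeta>" using \<gamma> by (intro Apen_spectral_norm) auto
  have \<delta>: "0 < m / 8" "m / 8 \<le> 2 * \<zeta>" using m \<zeta>_ge_1 by auto
  let ?e = "eig_call m q \<gamma>"
  have "approx_eig_spec K M (approx_eig S)" using spec by (simp add: solvers_spec_def)
  then have *: "?e \<in> M \<rightarrow>\<^sub>M borel \<Otimes>\<^sub>M count_space UNIV \<and>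
    1 - q \<le> measure M {s \<in> space M. norm (fst (?e s)) = 1 \<and>
        fst (?e s) \<bullet> (Apen P \<gamma> *v fst (?e s)) \<le> lambda_min (Apen P \<gamma>) + m / 8 \<and>
        real (snd (?e s)) \<le> K * real (max CARD('n) (nnz (Apen P \<gamma>))) * sqrt (2 * \<zeta> / (m / 8))
          * log 2 (2 + real CARD('n) / q)}" (is "_ \<and> _ \<le> measure M ?A")
    unfolding approx_eig_spec_def eig_call_def using sym_Apen sp \<delta> q by blast
  then show meas: "?e \<in> M \<rightarrow>\<^sub>M borel \<Otimes>\<^sub>M count_space UNIV" by simp
  interpret M: prob_space M by (rule M)
  have [measurable]: "(\<lambda>x. Apen P \<gamma> *v x) \<in> borel_measurable borel"
    by (intro borel_measurable_continuous_onI continuous_intros)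
  note meas[measurable]
  have "?A \<subseteq> {s \<in> space M. good_call m q \<gamma> s}"
  proof clarsimp
    fix s
    assume "real (snd (?e s)) \<le> K * real (max CARD('n) (nnz (Apen P \<gamma>))) * sqrt (16 * \<zeta> / m) * log 2 (2 + real CARD('n) / q)"
      and "norm (fst (?e s)) = 1" "fst (?e s) \<bullet> (Apen P \<gamma> *v fst (?e s)) \<le> lambda_min (Apen P \<gamma>) + m / 8"
    moreover have "K * real (max CARD('n) (nnz (Apen P \<gamma>))) * sqrt (16 * \<zeta> / m) * log 2 (2 + real CARD('n) / q) \<le> eig_cost m q"
      unfolding eig_cost_def using max_nnz_le[of \<gamma>] K_pos \<zeta>_ge_1 m q
      by (simp, intro mult_right_mono mult_left_mono) (auto simp: add_pos_nonneg)
    ultimately show "good_call m q \<gamma> s" by (simp add: good_call_def ray_def mu_def)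
  qed
  moreover have "{s \<in> space M. good_call m q \<gamma> s} \<in> sets M"
    unfolding good_call_def ray_def by measurable
  ultimately have "measure M ?A \<le> measure M {s \<in> space M. good_call m q \<gamma> s}"
    by (intro M.finite_measure_mono) auto
  with * show "1 - q \<le> measure M {s \<in> space M. good_call m q \<gamma> s}" by linarith
qed

lemma stage_good_prob:
  fixes \<iota> :: "nat \<Rightarrow> 'i"
  defines "PM \<equiv> PiM UNIV (\<lambda>_::'i. M)"
  assumes m: "0 < m" "m \<le> 1" and q: "0 < q" "q < 1" and lr: "0 \<le> l" "l \<le> r" "r \<le> \<zeta>" and \<iota>: "inj \<iota>"
  shows "{\<omega> \<in> space PM. stage_good d m q k l r (\<lambda>j. \<omega> (\<iota> j))} \<in> sets PM \<and>
    1 - real k * q \<le> measure PM {\<omega> \<in> space PM. stage_good d m q k l r (\<lambda>j. \<omega> (\<iota> j))}"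
  unfolding PM_def stage_good_def
proof (rule bisect_good_prob[OF M \<iota> _ _ _ _ good_call_prob[OF m q] _ lr])
  fix \<gamma> assume \<gamma>: "\<gamma> \<in> {0..\<zeta>}"
  note [measurable] = eig_call_measurable[OF m q \<gamma>]
  have [measurable]: "(\<lambda>x. Apen P \<gamma> *v x) \<in> borel_measurable borel"
    by (intro borel_measurable_continuous_onI continuous_intros)
  show "{s \<in> space M. good_call m q \<gamma> s} \<in> sets M"
    unfolding good_call_def ray_def by measurable
  show "{s \<in> space M. upd_hi d m q \<gamma> s} \<in> sets M"
    unfolding upd_hi_def ray_def by (cases d) (simp_all, measurable)
  show "{s \<in> space M. upd_lo d m q \<gamma> s} \<in> sets M"
    unfolding upd_lo_def ray_def by (cases d) (simp_all, measurable)
next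
  show "\<not> (upd_hi d m q \<gamma> s \<and> upd_lo d m q \<gamma> s)" for \<gamma> s
    by (cases d) (auto simp: upd_hi_def upd_lo_def)
qed (use q in auto)

text \<open>The end nearer to \<open>\<gamma>h\<close> is the one with large \<open>mu\<close>. A
  Rayleigh value above \<open>m\<close> has error at most \<open>m / 8\<close> and certifies
  \<open>7 / 8 * m\<close>; a value below \<open>5 / 8 * m\<close> certifies itself, because
  Rayleigh quotients never undershoot \<open>mu\<close>.\<close>

definition ends :: "side \<Rightarrow> real \<Rightarrow> real \<Rightarrow> real \<Rightarrow> bool" where
  "ends d m l r = (case d of
     LeftSide \<Rightarrow> 0 \<le> l \<and> l \<le> r \<and> r \<le> \<gamma>h \<and> mu P l < 5 / 8 * m \<and> 7 / 8 * m < mu P r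
   | RightSide \<Rightarrow> \<gamma>h \<le> l \<and> l \<le> r \<and> r \<le> \<zeta> \<and> 7 / 8 * m < mu P l \<and> mu P r < 5 / 8 * m)"

definition bracket :: "side \<Rightarrow> real \<Rightarrow> real \<times> (real^'n) \<Rightarrow> bool" where
  "bracket d m y = (case y of (\<gamma>, x) \<Rightarrow> m / 2 \<le> mu P \<gamma> \<and> mu P \<gamma> \<le> m \<and> norm x = 1 \<and>
     x \<bullet> (Apen P \<gamma> *v x) \<le> m \<and> 0 \<le> sgn_side d * (\<gamma>h - \<gamma>))"

text \<open>The \<open>mu\<close> values at the ends differ by more than \<open>m / 4\<close>, so by
  the Lipschitz bound the interval is always longer than \<open>m / 4\<close>. Halving down to
  \<open>m / 5\<close> is therefore impossible, and the search stops before its steps run out. On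
  stopping, the error \<open>m / 8\<close> turns \<open>5 / 8 * m\<close> into
  \<open>m / 2\<close>.\<close>

lemma bisect_loop_sat:
  assumes m: "0 < m" and C: "17 * N + eig_cost m q \<le> C"
  shows "ends d m l r \<Longrightarrow> r - l \<le> m / 5 * 2 ^ k \<Longrightarrow> stage_good d m q k l r s \<Longrightarrow>
    run_sat (bisect_loop S P \<zeta> d m q s k l r) (bracket d m) (real k * C)"
proof (induction k arbitrary: l r)
  case 0
  then have "m < 4 * (r - l)"
    using mu_lipschitz[of r l] mu_lipschitz[of l r] by (auto simp: ends_def split: side.splits)
  with 0 m show ?case by simp
next
  case (Suc k)
  define \<gamma> where "\<gamma> = (l + r) / 2"
  define y where "y = s (Suc k)"
  define x where "x = fst (eig_call m q \<gamma> y)"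
  have good: "good_call m q \<gamma> y"
    and hi: "upd_hi d m q \<gamma> y \<Longrightarrow> stage_good d m q k l \<gamma> s"
    and lo: "upd_lo d m q \<gamma> y \<Longrightarrow> stage_good d m q k \<gamma> r s"
    using Suc.prems(3) by (auto simp: stage_good_def Let_def \<gamma>_def y_def)
  have ray: "ray m q \<gamma> y = x \<bullet> (Apen P \<gamma> *v x)" by (simp add: ray_def x_def)
  have x1: "norm x = 1" and ub: "ray m q \<gamma> y \<le> mu P \<gamma> + m / 8"
    and cost: "real (snd (eig_call m q \<gamma> y)) \<le> eig_cost m q"
    using good by (auto simp: good_call_def x_def)
  have lb: "mu P \<gamma> \<le> ray m q \<gamma> y" unfolding ray by (rule mu_le_form[OF x1])
  have len: "\<gamma> - l \<le> m / 5 * 2 ^ k" "r - \<gamma> \<le> m / 5 * 2 ^ k"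
    using Suc.prems(2) by (auto simp: \<gamma>_def field_simps)
  have budget: "real k * C \<le> real (Suc k) * C - 9 * N - eig_cost m q - 8 * N"
    using C by (simp add: algebra_simps)
  have go_hi: "run_sat (bisect_loop S P \<zeta> d m q s k l \<gamma>) (bracket d m) (real (Suc k) * C - 9 * N - eig_cost m q - 8 * N)"
    if "upd_hi d m q \<gamma> y"
  proof (rule run_sat_mono[OF _ _ budget])
    have "ends d m l \<gamma>"
      using Suc.prems(1) that ub lb m by (cases d) (auto simp: ends_def upd_hi_def \<gamma>_def)
    then show "run_sat (bisect_loop S P \<zeta> d m q s k l \<gamma>) (bracket d m) (real k * C)"
      by (rule Suc.IH[OF _ len(1) hi[OF that]])
  qed
  have go_lo: "run_sat (bisect_loop S P \<zeta> d m q s k \<gamma> r) (bracket d m) (real (Suc k) * C - 9 * N - eig_cost m q - 8 * N)"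
    if "upd_lo d m q \<gamma> y"
  proof (rule run_sat_mono[OF _ _ budget])
    have "ends d m \<gamma> r"
      using Suc.prems(1) that ub lb m by (cases d) (auto simp: ends_def upd_lo_def \<gamma>_def)
    then show "run_sat (bisect_loop S P \<zeta> d m q s k \<gamma> r) (bracket d m) (real k * C)"
      by (rule Suc.IH[OF _ len(2) lo[OF that]])
  qed
  have C0: "0 \<le> real k * C"
  proof -
    have "0 \<le> eig_cost m q" using cost by linarith
    then show ?thesis using C N_ge_2 by simp
  qed
  have stop: "run_sat (ret (\<gamma>, x)) (bracket d m) (real (Suc k) * C - 9 * N - eig_cost m q - 8 * N)"
    if "\<not> m < ray m q \<gamma> y" "\<not> ray m q \<gamma> y < 5 / 8 * m"
  proof (rule run_sat_ret)
    have "0 \<le> sgn_side d * (\<gamma>h - \<gamma>)" using Suc.prems(1) by (cases d) (auto simp: ends_def \<gamma>_def)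
    then show "bracket d m (\<gamma>, x)" using that ub lb x1 by (simp add: bracket_def ray[symmetric])
  qed (use C0 budget in linarith)
  show ?case
    unfolding bisect_loop.simps Let_def \<gamma>_def[symmetric] y_def[symmetric] eig_call_def[symmetric]
    apply (rule run_sat_charge[where ?B1.0 = "9 * N"])
    subgoal using ops_le N_ge_2 by simp
    apply (rule run_sat_bind[where Q' = "\<lambda>z. z = x" and ?B1.0 = "eig_cost m q"])
    subgoal unfolding x_def by (intro run_sat_call cost) simp
    apply (rule run_sat_charge[where ?B1.0 = "8 * N"])
    subgoal using ops_le by simp
    subgoal for z
      using go_hi go_lo stop unfolding ray upd_hi_def upd_lo_def
      by (cases d) (auto simp: ray)
    done
qed

subsection \<open>The stages\<close>

definition Tmax :: nat where "Tmax = nat \<lceil>log 2 (3200 * \<zeta> ^ 4 / (\<epsilon> * \<xi> ^ 3))\<rceil>"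
definition stage :: "nat \<Rightarrow> real" where "stage t = \<xi> / 2 ^ t"
definition Tb :: "real \<Rightarrow> nat" where "Tb m = nat \<lceil>log 2 (5 * \<zeta> / m)\<rceil>"
definition qb :: "real \<Rightarrow> real" where "qb m = p / real Tmax / real (Tb m)"
definition l0 :: "side \<Rightarrow> real" where "l0 d = (case d of LeftSide \<Rightarrow> 0 | RightSide \<Rightarrow> \<gamma>h)"
definition r0 :: "side \<Rightarrow> real" where "r0 d = (case d of LeftSide \<Rightarrow> \<gamma>h | RightSide \<Rightarrow> \<zeta>)"

lemma ratio_bounds:
  "1 \<le> \<zeta> ^ 4 / (\<epsilon> * \<xi> ^ 3)" "\<zeta> ^ 4 / (\<epsilon> * \<xi> ^ 3) \<le> R ^ 4" "\<zeta> ^ 4 / (\<epsilon> * \<xi> ^ 4) \<le> R ^ 4"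
proof -
  have z: "1 \<le> \<zeta> ^ 4" using \<zeta>_ge_1 by (rule one_le_power)
  have x: "0 < \<xi> ^ 3" "\<xi> ^ 3 \<le> 1" "\<xi> ^ 4 \<le> \<xi> ^ 3"
    using \<xi>_pos \<xi>_le_1 by (auto intro: power_le_one power_decreasing)
  have e: "\<epsilon> ^ 4 \<le> \<epsilon> ^ 1" using \<epsilon> by (intro power_decreasing) auto
  have ex: "\<epsilon> * \<xi> ^ 3 \<le> 1" using \<epsilon> x by (intro mult_le_one) auto
  then have "\<epsilon> * \<xi> ^ 3 \<le> \<zeta> ^ 4" using z by linarith
  then show "1 \<le> \<zeta> ^ 4 / (\<epsilon> * \<xi> ^ 3)" using \<epsilon> x by (subst le_divide_eq_1_pos) auto
  have pos: "0 < \<epsilon> * \<xi> ^ 4" "0 < \<epsilon> * \<xi> ^ 3" "0 < \<epsilon> ^ 4 * \<xi> ^ 4" using \<epsilon> \<xi>_pos by auto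
  have "\<zeta> ^ 4 / (\<epsilon> * \<xi> ^ 3) \<le> \<zeta> ^ 4 / (\<epsilon> * \<xi> ^ 4)"
    using z x pos \<epsilon> by (intro divide_left_mono mult_left_mono mult_pos_pos) auto
  also show *: "\<zeta> ^ 4 / (\<epsilon> * \<xi> ^ 4) \<le> R ^ 4"
    unfolding R_def power_divide power_mult_distrib
    using z e pos \<epsilon> \<xi>_pos by (intro divide_left_mono mult_right_mono mult_pos_pos) auto
  finally show "\<zeta> ^ 4 / (\<epsilon> * \<xi> ^ 3) \<le> R ^ 4" .
qed

lemma Tmax_bounds: "1 \<le> Tmax" "real Tmax \<le> 17 * Lg"
    "3200 * \<zeta> ^ 4 / (\<epsilon> * \<xi> ^ 3) \<le> 2 ^ Tmax" "2 ^ Tmax \<le> 6400 * \<zeta> ^ 4 / (\<epsilon> * \<xi> ^ 3)"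
proof -
  define X where "X = 3200 * (\<zeta> ^ 4 / (\<epsilon> * \<xi> ^ 3))"
  have X1: "1 < X" using ratio_bounds by (simp add: X_def)
  have X: "X = 3200 * \<zeta> ^ 4 / (\<epsilon> * \<xi> ^ 3)" by (simp add: X_def)
  note T = nat_ceiling_log[OF X1, unfolded X, folded Tmax_def]
  show "1 \<le> Tmax" "3200 * \<zeta> ^ 4 / (\<epsilon> * \<xi> ^ 3) \<le> 2 ^ Tmax" "2 ^ Tmax \<le> 6400 * \<zeta> ^ 4 / (\<epsilon> * \<xi> ^ 3)"
    using T by simp_all
  have "X \<le> 2 ^ 12 * R ^ 4" using ratio_bounds R_power_ge_1[of 4] by (simp add: X_def)
  then have "log 2 X \<le> real (12 + 4) * Lg" using X1 by (intro log_le_Lg) auto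
  then show "real Tmax \<le> 17 * Lg" using T(4) Lg_ge_1 unfolding X by simp
qed

lemma stage_pos: "0 < stage t"
  using \<xi>_pos by (simp add: stage_def)

lemma stage_le_half: "1 \<le> t \<Longrightarrow> stage t \<le> \<xi> / 2"
proof -
  assume "1 \<le> t"
  then have "(2::real) ^ 1 \<le> 2 ^ t" by (intro power_increasing) auto
  then show ?thesis using \<xi>_pos by (simp add: stage_def field_simps)
qed

lemma stage_Suc: "stage (Suc t) = stage t / 2"
  by (simp add: stage_def)

text \<open>Rounding \<open>Tmax\<close> up at most doubles the power of two, so 3200 becomes 6400.
  This lets the second term of \<open>phi\<close> control the levels when \<open>mu_star P\<close>
  is very small.\<close>

lemma stage_lower:
  assumes "t \<le> Tmax"
  shows "\<epsilon> * \<xi> ^ 4 / \<zeta> ^ 4 \<le> 6400 * stage t"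
proof -
  have "2 ^ t \<le> (2::real) ^ Tmax" using assms by (intro power_increasing) auto
  with Tmax_bounds(4) have "2 ^ t \<le> 6400 * \<zeta> ^ 4 / (\<epsilon> * \<xi> ^ 3)" by linarith
  then have "2 ^ t * (\<epsilon> * \<xi> ^ 3) \<le> 6400 * \<zeta> ^ 4" using \<epsilon> \<xi>_pos by (simp add: field_simps)
  then have "\<xi> * (2 ^ t * (\<epsilon> * \<xi> ^ 3)) \<le> \<xi> * (6400 * \<zeta> ^ 4)" using \<xi>_pos by (intro mult_left_mono) auto
  then show ?thesis using \<zeta>_ge_1 \<xi>_pos
    by (simp add: stage_def field_simps power_numeral_reduce)
qed

lemma inverse_stage:
  assumes "t \<le> Tmax"
  shows "1 / stage t \<le> 6400 * R ^ 4"
proof -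
  have pos: "0 < \<epsilon> * \<xi> ^ 4 / \<zeta> ^ 4" using \<epsilon> \<xi>_pos \<zeta>_ge_1 by simp
  have "1 / stage t = 6400 / (6400 * stage t)" by simp
  also have "\<dots> \<le> 6400 / (\<epsilon> * \<xi> ^ 4 / \<zeta> ^ 4)"
    using stage_lower[OF assms] pos stage_pos[of t] by (intro divide_left_mono mult_pos_pos) auto
  also have "\<dots> = 6400 * (\<zeta> ^ 4 / (\<epsilon> * \<xi> ^ 4))" by simp
  also have "\<dots> \<le> 6400 * R ^ 4" using ratio_bounds by (intro mult_left_mono) auto
  finally show ?thesis .
qed

lemma stage_Tmax: "stage Tmax \<le> \<epsilon> * \<xi> ^ 4 / (3200 * \<zeta> ^ 4)"
proof -
  have "3200 * \<zeta> ^ 4 \<le> 2 ^ Tmax * (\<epsilon> * \<xi> ^ 3)"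
    using Tmax_bounds(3) \<epsilon> \<xi>_pos by (simp add: field_simps)
  then have "\<xi> * (3200 * \<zeta> ^ 4) \<le> \<xi> * (2 ^ Tmax * (\<epsilon> * \<xi> ^ 3))" using \<xi>_pos by (intro mult_left_mono) auto
  then show ?thesis using \<zeta>_ge_1 by (simp add: stage_def field_simps power_numeral_reduce)
qed

lemma Tb_bounds:
  assumes m: "0 < m" "m \<le> 1" "1 / m \<le> 6400 * R ^ 4"
  shows "1 \<le> Tb m" "real (Tb m) \<le> 21 * Lg" "5 * \<zeta> / m \<le> 2 ^ Tb m"
proof -
  have "m < 5 * \<zeta>" using m \<zeta>_ge_1 by linarith
  then have X1: "1 < 5 * \<zeta> / m" using m by simp
  note T = nat_ceiling_log[OF X1, folded Tb_def]
  show "1 \<le> Tb m" "5 * \<zeta> / m \<le> 2 ^ Tb m" using T by simp_all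
  have "5 * \<zeta> / m = 5 * \<zeta> * (1 / m)" by simp
  also have "\<dots> \<le> 5 * R * (6400 * R ^ 4)" using R_bounds m \<zeta>_ge_1 by (intro mult_mono) auto
  also have "\<dots> \<le> 2 ^ 15 * R ^ 5" using R_power_ge_1[of 5] by (simp add: power_numeral_reduce)
  finally have "log 2 (5 * \<zeta> / m) \<le> real (15 + 5) * Lg" using X1 by (intro log_le_Lg) auto
  then show "real (Tb m) \<le> 21 * Lg" using T(4) Lg_ge_1 by simp
qed

lemma qb_bounds:
  assumes m: "0 < m" "m \<le> 1" "1 / m \<le> 6400 * R ^ 4"
  shows "0 < qb m" "qb m < 1"
proof -
  have T: "1 \<le> real Tmax" "1 \<le> real (Tb m)" using Tmax_bounds(1) Tb_bounds(1)[OF m] by simp_all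
  show "0 < qb m" using T p by (simp add: qb_def)
  have "1 * 1 \<le> real Tmax * real (Tb m)" using T by (intro mult_mono) auto
  then have "p < real Tmax * real (Tb m)" using p by linarith
  then show "qb m < 1" using T by (simp add: qb_def)
qed

text \<open>The failure probability is split over at most \<open>17 * Lg * (21 * Lg)\<close> calls.
  Inside the logarithm this adds a constant plus \<open>2 * log 2 Lg\<close>, which is where the
  factor \<open>LL\<close> comes from; \<open>2^9\<close> absorbs \<open>1 + 357\<close>.\<close>

lemma eig_cost_le:
  assumes m: "0 < m" "m \<le> 1" "1 / m \<le> 6400 * R ^ 4"
  shows "eig_cost m (qb m) \<le> K * N * (4 * w m) * (10 * (Lp * LL))"
proof -
  define T where "T = real Tmax * real (Tb m)"
  have T1: "1 * 1 \<le> T"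
    unfolding T_def using Tmax_bounds(1) Tb_bounds(1)[OF m] by (intro mult_mono) auto
  have T: "T \<le> 17 * Lg * (21 * Lg)"
    unfolding T_def using Tmax_bounds(2) Tb_bounds(2)[OF m] Lg_ge_1 by (intro mult_mono) auto
  have LL2: "1 * 1 \<le> Lg * Lg" using Lg_ge_1 by (intro mult_mono) auto
  define y where "y = real CARD('n) / p"
  have "2 * p \<le> 2 * 1" using p by (intro mult_left_mono) auto
  then have y: "2 \<le> y" using dim_ge_2 p by (simp add: field_simps y_def)
  have "2 + real CARD('n) / qb m = 2 + y * T" by (simp add: qb_def y_def T_def)
  also have "\<dots> \<le> y * (1 + T)" using y by (simp add: algebra_simps)
  also have "\<dots> \<le> y * (2 ^ 9 * Lg\<^sup>2)"
    using y T LL2 by (intro mult_left_mono) (auto simp: power2_eq_square)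
  finally have "log 2 (2 + real CARD('n) / qb m) \<le> log 2 (y * (2 ^ 9 * Lg\<^sup>2))"
    using qb_bounds[OF m] by (intro log_mono) (auto simp: add_pos_nonneg)
  also have "\<dots> = Lp + (9 + 2 * log 2 Lg)"
    using log_nat_power[of 2 2 9] y Lg_ge_1 by (simp add: log_mult log_nat_power Lp_def y_def[symmetric])
  also have "\<dots> \<le> Lp + 9 * LL" using Lg_ge_1 by (simp add: LL_def)
  also have "\<dots> \<le> 10 * (Lp * LL)"
  proof -
    have "Lp * 1 \<le> Lp * LL" "1 * LL \<le> Lp * LL"
      using Lp_ge_1 LL_ge_1 by (auto intro!: mult_left_mono mult_right_mono)
    then show ?thesis by simp
  qed
  finally have L: "log 2 (2 + real CARD('n) / qb m) \<le> 10 * (Lp * LL)" .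
  have s: "sqrt (2 * \<zeta> / (m / 8)) = 4 * w m"
  proof -
    have "2 * \<zeta> / (m / 8) = 4\<^sup>2 * (\<zeta> / m)" by simp
    then show ?thesis unfolding w_def by (simp only: real_sqrt_mult real_sqrt_abs)
  qed
  show ?thesis
    unfolding eig_cost_def s using L K_pos N_ge_2 w_nonneg[OF m(1)]
    by (intro mult_left_mono) auto
qed

text \<open>The initial interval has length at most \<zeta>, so \<open>Tb m\<close> halvings reach
  \<open>m / 5\<close>. The factor \<open>Lg\<close> is the number of steps, and 1250 covers
  \<open>21 * 17 + 21 * 40\<close> for the steps and 26 for the preparation.\<close>

lemma approx_gamma_sat:
  assumes m: "0 < m" "m \<le> \<xi>" "1 / m \<le> 6400 * R ^ 4"
    and good: "stage_good d m (qb m) (Tb m) (l0 d) (r0 d) s"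
  shows "run_sat (approx_gamma S P \<zeta> \<gamma>h d m (p / real Tmax) s) (bracket d m) (1250 * (U * w m))"
proof -
  have m1: "m \<le> 1" using m \<xi>_le_1 by simp
  note mb = m(1) m1 m(3)
  define V where "V = w m"
  have V: "1 \<le> V" unfolding V_def using m(1) m1 by (rule w_ge_1)
  define C where "C = 17 * N + K * N * (4 * V) * (10 * (Lp * LL))"
  have C: "17 * N + eig_cost m (qb m) \<le> C"
    using eig_cost_le[OF mb] by (simp add: C_def V_def)
  have "ends d m (l0 d) (r0 d)"
    using mu_0 mu_\<gamma>h mu_\<zeta> m \<gamma>h_nonneg \<gamma>h_bounds \<xi>_pos
    by (cases d) (auto simp: ends_def l0_def r0_def)
  moreover have "r0 d - l0 d \<le> m / 5 * 2 ^ Tb m"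
  proof -
    have "r0 d - l0 d \<le> \<zeta>" using \<gamma>h_nonneg \<gamma>h_bounds \<xi>_pos by (cases d) (auto simp: r0_def l0_def)
    also have "\<zeta> = m / 5 * (5 * \<zeta> / m)" using m by simp
    also have "\<dots> \<le> m / 5 * 2 ^ Tb m" using Tb_bounds(3)[OF mb] m by (intro mult_left_mono) auto
    finally show ?thesis .
  qed
  ultimately have loop: "run_sat (bisect_loop S P \<zeta> d m (qb m) s (Tb m) (l0 d) (r0 d)) (bracket d m) (real (Tb m) * C)"
    using good by (intro bisect_loop_sat[OF m(1) C])
  have C0: "0 \<le> C" using N_ge_2 K_pos V Lp_ge_1 LL_ge_1 by (simp add: C_def)
  have "real (Tb m) * C \<le> 21 * Lg * C" using Tb_bounds(2)[OF mb] C0 by (rule mult_right_mono)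
  also have "\<dots> = 357 * (N * Lg) + 840 * (K * (N * Lp * Lg * LL) * V)" by (simp add: C_def algebra_simps)
  also have "\<dots> \<le> 357 * (U * V) + 840 * (U * V)"
    using U_bounds V N_ge_2 Lg_ge_1 by (intro add_mono mult_left_mono mult_weight mult_right_mono) auto
  finally have cost: "real (Tb m) * C \<le> 1197 * (U * V)" by linarith
  have "2 * real (Tb m) + 10 \<le> 52 * Lg" using Tb_bounds(2)[OF mb] Lg_ge_1 by simp
  also have "\<dots> \<le> 26 * (N * Lg)" using N_ge_2 Lg_ge_1 by simp
  also have "\<dots> \<le> 26 * (U * V)"
    using U_bounds V N_ge_2 Lg_ge_1 by (intro mult_left_mono mult_weight) auto
  finally have head: "real (2 * Tb m + 10) \<le> 26 * (U * V)" by simp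
  have "0 \<le> U * V" using U_bounds V by simp
  with cost have rest: "real (Tb m) * C \<le> 1250 * (U * V) - 26 * (U * V)" by linarith
  show ?thesis
    unfolding approx_gamma_def Let_def Tb_def[symmetric] qb_def[symmetric] V_def[symmetric]
    using run_sat_mono[OF loop _ rest]
    by (intro run_sat_charge[OF head], cases d) (auto simp: l0_def r0_def)
qed

subsection \<open>Constructing the reformulation\<close>

definition \<phi> :: real where "\<phi> = phi P \<xi> \<zeta> \<epsilon>"
definition W :: real where "W = w \<phi>"
text \<open>80 is the square root of 6400: a level \<open>m\<close> with
  \<open>\<phi> \<le> 6400 * m\<close> has weight at most \<open>V\<close>.\<close>

definition V :: real where "V = 80 * W"

lemma \<phi>_bounds: "0 < \<phi>" "\<phi> \<le> \<xi>"
proof -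
  have pos: "0 < \<epsilon> * \<xi> ^ 4 / \<zeta> ^ 4" using \<epsilon> \<xi>_pos \<zeta>_ge_1 by simp
  then show "0 < \<phi>" by (simp add: \<phi>_def phi_def less_max_iff_disj)
  have "\<xi> ^ 4 \<le> \<xi> ^ 1" using \<xi>_pos \<xi>_le_1 by (intro power_decreasing) auto
  then have "\<epsilon> * \<xi> ^ 4 \<le> 1 * \<xi>" using \<epsilon> \<xi>_pos by (intro mult_mono) auto
  moreover have "\<epsilon> * \<xi> ^ 4 / \<zeta> ^ 4 \<le> \<epsilon> * \<xi> ^ 4 / 1"
    using \<epsilon> \<xi>_pos one_le_power[OF \<zeta>_ge_1, of 4] by (intro divide_left_mono) auto
  ultimately show "\<phi> \<le> \<xi>" by (simp add: \<phi>_def phi_def)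
qed

lemma W_ge_1: "1 \<le> W"
  unfolding W_def using \<phi>_bounds \<xi>_le_1 by (intro w_ge_1) auto

lemma w_mono: "0 < a \<Longrightarrow> a \<le> b \<Longrightarrow> w b \<le> w a"
  unfolding w_def using \<zeta>_ge_1 by (intro real_sqrt_le_mono divide_left_mono) auto

lemma w_scale: "0 \<le> c \<Longrightarrow> 0 < m \<Longrightarrow> sqrt (c * (\<zeta> / m)) = sqrt c * w m"
  unfolding w_def by (rule real_sqrt_mult)

lemma w_le_V:
  assumes "\<phi> \<le> 6400 * m"
  shows "w m \<le> V"
proof -
  have "w m \<le> w (\<phi> / 6400)" using assms \<phi>_bounds by (intro w_mono) auto
  also have "\<dots> = sqrt (80\<^sup>2 * (\<zeta> / \<phi>))" by (simp add: w_def)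
  also have "\<dots> = V" unfolding V_def W_def w_def by (simp only: real_sqrt_mult real_sqrt_abs)
  finally show ?thesis .
qed

lemma sqrt_le_w:
  assumes "0 < m" "0 \<le> c" "c \<le> 9"
  shows "sqrt (c * (\<zeta> / m)) \<le> 3 * w m"
proof -
  have "sqrt c \<le> 3" by (rule real_le_lsqrt) (use assms in auto)
  then show ?thesis using w_nonneg[OF assms(1)] w_scale[of c m] assms by (simp add: mult_right_mono)
qed

text \<open>For a \<open>Regular\<close> result this collects what the second stage relies on: a
  sign change of \<open>nu\<close>, strong convexity at both ends, and the two bounds that control
  the cost of the minimax routine.\<close>

definition outcome :: "'n reform \<Rightarrow> bool" where
  "outcome out = (case out of
     Regular a b m \<Rightarrow> 0 < m \<and> m \<le> 1 \<and> m \<le> mu P a \<and> m \<le> mu P b \<and> a \<le> b \<and> 0 < nu a \<and> nu b < 0 \<and>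
       1 / m \<le> 2 ^ 15 * R ^ 4 \<and> sqrt (2 * \<zeta> / m) \<le> 3 * V
   | MaybeRegular x \<Rightarrow> approx_optimizer P \<epsilon> x
   | NotRegular x \<Rightarrow> approx_optimizer P \<epsilon> x)"

lemma outcome_regular_on:
  assumes m: "0 < m" "m \<le> \<xi>" "m \<le> mu P \<gamma>" "1 / m \<le> 2 ^ 15 * R ^ 4" "sqrt (2 * \<zeta> / m) \<le> 3 * V"
    and nuh: "sgn_side d * nu \<gamma>h < 0" and h: "0 \<le> sgn_side d * (\<gamma>h - \<gamma>)" and nu: "0 < sgn_side d * nu \<gamma>"
  shows "outcome (regular_on d \<gamma>h \<gamma> m)"
  using assms mu_\<gamma>h \<xi>_le_1 by (cases d) (auto simp: outcome_def)

lemma cr_finish_sat: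
  assumes m: "0 < m" "m / 2 \<le> mu P \<gamma>" "m \<le> \<xi> / 2" "m \<le> \<epsilon> * \<xi> ^ 4 / (3200 * \<zeta> ^ 4)"
    and h: "0 \<le> sgn_side d * (\<gamma>h - \<gamma>)" and nu: "sgn_side d * nu \<gamma> < 0"
    and q1x: "sgn_side d * q1 P x < 0"
    and x: "norm (x - xc \<gamma>) \<le> m / 2 * \<tau> / (10 * \<zeta>)"
    and v: "norm v = 1" "v \<bullet> (Apen P \<gamma> *v v) \<le> m"
  shows "run_sat (cr_finish P \<gamma> x v) outcome (60 * (U * V))"
proof -
  define v' where "v' = (if v \<bullet> (Apen P \<gamma> *v x + bpen P \<gamma>) \<le> 0 then v else - v)"
  have v': "norm v' = 1" "v' \<bullet> (Apen P \<gamma> *v v') \<le> m" "v' \<bullet> (Apen P \<gamma> *v x + bpen P \<gamma>) \<le> 0"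
    using v by (auto simp: v'_def linear_neg)
  have side: "sgn_side d = 1 \<or> sgn_side d = - 1" by (cases d) auto
  have m2: "0 < m / 2" "m / 2 \<le> 1" using m \<xi>_le_1 by auto
  note fin = not_regular_correct[OF m2(1) m(2) m2(2) \<epsilon> side h nu q1x x[unfolded \<tau>_def] m(1,3,4) v']
  define \<alpha> where "\<alpha> = (SOME \<alpha>. 0 < \<alpha> \<and> q1 P (x + \<alpha> *\<^sub>R v') = 0)"
  \<comment> \<open>\<open>SOME\<close> denotes a root because the first part of
    \<open>not_regular_correct\<close> provides one; the second part holds for any positive root, so
    the choice does not matter.\<close>
  have "0 < \<alpha> \<and> q1 P (x + \<alpha> *\<^sub>R v') = 0"
    unfolding \<alpha>_def by (rule someI_ex) (use fin(1) in blast)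
  then have opt: "approx_optimizer P \<epsilon> (x + \<alpha> *\<^sub>R v')" using fin(2) by blast
  have "60 * N \<le> 60 * (U * V)"
    using U_bounds N_ge_2 W_ge_1 by (intro mult_left_mono mult_weight) (auto simp: V_def)
  then have head: "real (ops_pencil P + ops_quad (Apen P \<gamma>) + 3 * ops_quad (A1 P) + 4 * CARD('n) + 20) \<le> 60 * (U * V)"
    using ops_le(1) ops_le(2)[of \<gamma>] ops_le(3) dim_le_N N_ge_2 by simp
  show ?thesis
    unfolding cr_finish_def Let_def v'_def[symmetric] \<alpha>_def[symmetric]
    by (intro run_sat_charge[OF head] run_sat_ret) (simp_all add: outcome_def opt)
qed

definition seeds_good :: "side \<Rightarrow> (nat \<times> nat \<Rightarrow> 's) \<Rightarrow> bool" where
  "seeds_good d \<omega> \<longleftrightarrow> (\<forall>t\<in>{1..Tmax}. stage_good d (stage t) (qb (stage t)) (Tb (stage t)) (l0 d) (r0 d) (\<lambda>j. \<omega> (t, j)))"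

text \<open>The costs of the stages grow at least by the factor \<open>1.4 \<le> sqrt 2\<close>. The subtracted term of
  the bound makes the geometric sum an induction, and the invariant \<open>\<phi> \<le> 6400 * stage t\<close> caps it.\<close>

lemma cr_loop_step:
  assumes nuh: "sgn_side d * nu \<gamma>h < 0" and good: "seeds_good d \<omega>"
    and k: "k < Tmax" and \<phi>: "\<phi> \<le> 6400 * stage (Tmax - k)"
    and IH: "\<And>j. k = Suc j \<Longrightarrow> \<phi> \<le> 6400 * stage (Tmax - j) \<Longrightarrow>
      run_sat (cr_loop S P \<xi> \<zeta> \<gamma>h \<epsilon> p d \<omega> Tmax k) outcome
        (1700 * (U * (7 / 2 * V - 5 / 2 * w (stage (Tmax - j)))) + 60 * (U * V))"
  shows "run_sat (cr_loop S P \<xi> \<zeta> \<gamma>h \<epsilon> p d \<omega> Tmax (Suc k)) outcome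
      (1700 * (U * (7 / 2 * V - 5 / 2 * w (stage (Tmax - k)))) + 60 * (U * V))"
proof -
  define t where "t = Tmax - k"
  have t: "1 \<le> t" "t \<le> Tmax" using k by (auto simp: t_def)
  define m where "m = stage t"
  have m0: "0 < m" and m_half: "m \<le> \<xi> / 2" and inv: "1 / m \<le> 6400 * R ^ 4"
    using stage_pos stage_le_half[OF t(1)] inverse_stage[OF t(2)] by (simp_all add: m_def)
  have m_le: "m \<le> \<xi>" "m \<le> 1" using m_half \<xi>_pos \<xi>_le_1 by auto
  define v where "v = w m"
  have v1: "1 \<le> v" unfolding v_def using m0 m_le by (intro w_ge_1) auto
  have vV: "v \<le> V" unfolding v_def m_def t_def by (rule w_le_V[OF \<phi>])
  have inv4: "1 / (m / 2) \<le> 2 ^ 15 * R ^ 4" "1 / (m / 4) \<le> 2 ^ 15 * R ^ 4"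
    using inv R_power_ge_1[of 4] by simp_all
  have sq: "sqrt (2 * \<zeta> / (m / 2)) \<le> 3 * v" "sqrt (2 * \<zeta> / (m / 4)) \<le> 3 * v"
    using sqrt_le_w[OF m0, of 4] sqrt_le_w[OF m0, of 8] by (simp_all add: v_def mult.commute)
  have sgood: "stage_good d m (qb m) (Tb m) (l0 d) (r0 d) (\<lambda>j. \<omega> (t, j))"
    using good t by (simp add: seeds_good_def m_def)
  \<comment> \<open>The factor \<open>7 / 2\<close> is \<open>1 / (1 - 5 / 7)\<close>, the sum of a
    geometric series of ratio \<open>5 / 7\<close>. The next weight is at least
    \<open>7 / 5 * v\<close>, so the bound for the later stages is at most
    \<open>B - 1700 * (U * v)\<close>, while one stage spends at most
    \<open>10 + 1590 * (U * v)\<close>.\<close>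
  define B where "B = 1700 * (U * (7 / 2 * V - 5 / 2 * v)) + 60 * (U * V)"
  have U0: "0 \<le> U" using U_bounds by simp
  have UvV: "U * v \<le> U * V" "2 \<le> U * v" "U * 1 \<le> U * v"
    using vV v1 U0 U_bounds mult_weight[of 2 v] by (auto intro: mult_left_mono)
  have rest: "60 * (U * V) \<le> B - 10 - 1250 * (U * v) - 170 * (U * v) - 170 * (U * v)"
    "0 \<le> B - 10 - 1250 * (U * v) - 170 * (U * v) - 170 * (U * v)"
    "60 * (U * V) \<le> B - 10 - 1250 * (U * v) - 170 * (U * v)"
    "0 \<le> B - 10 - 1250 * (U * v) - 170 * (U * v)"
    using UvV by (simp_all add: B_def algebra_simps)
  have main: "run_sat
    (if sgn_side d * \<nu> - \<tau> > 0 then ret (regular_on d \<gamma>h \<gamma> (m / 4))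
     else if \<nu> \<in> {- \<tau>..\<tau>} then
       run_bind (approx_nu S P \<zeta> (m / 4) \<tau> (\<gamma> - sgn_side d * (m / 4)))
         (\<lambda>(x', \<nu>'). if sgn_side d * \<nu>' - \<tau> > 0 then ret (regular_on d \<gamma>h (\<gamma> - sgn_side d * (m / 4)) (m / 4))
           else ret (MaybeRegular x))
     else if k = 0 then cr_finish P \<gamma> x u
     else cr_loop S P \<xi> \<zeta> \<gamma>h \<epsilon> p d \<omega> Tmax k) outcome (B - 10 - 1250 * (U * v) - 170 * (U * v))"
    if br: "bracket d m (\<gamma>, u)" and x: "norm (x - xc \<gamma>) \<le> m / 2 * \<tau> / (10 * \<zeta>)"
      and \<nu>: "\<nu> = q1 P x" "\<bar>\<nu> - nu \<gamma>\<bar> \<le> \<tau>" for \<gamma> u x \<nu>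
  proof -
    have mu: "m / 2 \<le> mu P \<gamma>" "mu P \<gamma> \<le> m" and u: "norm u = 1" "u \<bullet> (Apen P \<gamma> *v u) \<le> m"
      and h: "0 \<le> sgn_side d * (\<gamma>h - \<gamma>)"
      using br by (auto simp: bracket_def)
    have side: "sgn_side d = 1 \<or> sgn_side d = - 1" by (cases d) auto
    have sV: "sqrt (2 * \<zeta> / (m / 4)) \<le> 3 * V" using sq(2) vV by linarith
    have m4: "0 < m / 4" "m / 4 \<le> \<xi>" "m / 4 \<le> mu P \<gamma>" "m / 4 \<le> 1" using m0 m_le mu by auto
    consider (reg) "0 < sgn_side d * \<nu> - \<tau>" | (maybe) "\<not> 0 < sgn_side d * \<nu> - \<tau>" "\<nu> \<in> {- \<tau>..\<tau>}"
      | (go) "sgn_side d * \<nu> < - \<tau>" "\<not> 0 < sgn_side d * \<nu> - \<tau>" "\<nu> \<notin> {- \<tau>..\<tau>}"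
      using side by fastforce
    then show ?thesis
    proof cases
      case reg
      then have "0 < sgn_side d * nu \<gamma>" using \<nu> side by auto
      then have "outcome (regular_on d \<gamma>h \<gamma> (m / 4))"
        by (rule outcome_regular_on[OF m4(1-3) inv4(2) sV nuh h])
      then show ?thesis unfolding if_P[OF reg] using rest(4) by (rule run_sat_ret)
    next
      case maybe
      define g where "g = \<gamma> - sgn_side d * (m / 4)"
      \<comment> \<open>A shift by \<open>m / 4\<close> away from \<open>\<gamma>h\<close> uses up
        at most \<open>m / 4\<close> of the guaranteed \<open>m / 2\<close>.\<close>
      have "mu P \<gamma> \<le> mu P g + \<bar>\<gamma> - g\<bar>" by (rule mu_lipschitz)
      then have mg: "m / 4 \<le> mu P g" using mu side m0 by (auto simp: g_def)
      have hg: "0 \<le> sgn_side d * (\<gamma>h - g)" using h side m0 by (auto simp: g_def)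
      have opt: "approx_optimizer P \<epsilon> x"
      proof (rule maybe_regular_correct[of "m / 2" \<gamma>])
        show "\<bar>nu \<gamma>\<bar> \<le> 2 * (\<epsilon> / (4 * \<zeta>))" 
          using maybe(2) \<nu>(2) unfolding \<tau>_def[symmetric] atLeastAtMost_iff by linarith
      qed (use m0 m_le mu \<epsilon> x in \<open>auto simp: \<tau>_def\<close>)
      have "run_sat (run_bind (approx_nu S P \<zeta> (m / 4) \<tau> g)
         (\<lambda>(x', \<nu>'). if sgn_side d * \<nu>' - \<tau> > 0 then ret (regular_on d \<gamma>h g (m / 4))
           else ret (MaybeRegular x))) outcome (B - 10 - 1250 * (U * v) - 170 * (U * v))"
      proof (rule run_sat_bind_pair[OF approx_nu_sat[OF m4(1) mg m4(4) inv4(2) sq(2) v1]], elim conjE)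
        fix y \<nu>' assume \<nu>': "\<bar>\<nu>' - nu g\<bar> \<le> \<tau>"
        have "outcome (regular_on d \<gamma>h g (m / 4))" if "sgn_side d * \<nu>' - \<tau> > 0"
        proof (rule outcome_regular_on[OF m4(1,2) mg inv4(2) sV nuh hg])
          show "0 < sgn_side d * nu g" using \<nu>' side that by auto
        qed
        then show "run_sat (if sgn_side d * \<nu>' - \<tau> > 0 then ret (regular_on d \<gamma>h g (m / 4)) else ret (MaybeRegular x))
          outcome (B - 10 - 1250 * (U * v) - 170 * (U * v) - 170 * (U * v))"
          using rest(2) opt by (auto intro!: run_sat_ret simp: outcome_def)
      qed
      then show ?thesis unfolding if_not_P[OF maybe(1)] if_P[OF maybe(2)] g_def .
    next
      case go
      have nug: "sgn_side d * nu \<gamma> < 0" and q1x: "sgn_side d * q1 P x < 0"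
        using go(1) \<nu> side \<tau>_bounds by auto
      show ?thesis
      proof (cases k)
        case 0
        have "run_sat (cr_finish P \<gamma> x u) outcome (60 * (U * V))"
        proof (rule cr_finish_sat[OF m0 mu(1) m_half _ h nug q1x x u])
          show "m \<le> \<epsilon> * \<xi> ^ 4 / (3200 * \<zeta> ^ 4)" using stage_Tmax 0 by (simp add: m_def t_def)
        qed
        then have "run_sat (cr_finish P \<gamma> x u) outcome (B - 10 - 1250 * (U * v) - 170 * (U * v))"
          using run_sat_mono[OF _ _ rest(3)] by blast
        then show ?thesis unfolding if_not_P[OF go(2)] if_not_P[OF go(3)] if_P[OF 0] .
      next
        case (Suc j)
        have t': "Tmax - j = Suc t" using Suc k by (simp add: t_def)
        have "0 < mu P \<gamma>" using mu m0 by linarith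
        \<comment> \<open>\<open>nu\<close> still has the sign it has at \<open>\<gamma>h\<close>,
          so the dual maximizer lies further out; as \<open>m\<close> is twice the next level, the
          cap carries over.\<close>
        then have "min (mu_star P) \<xi> \<le> m"
          using mu_star_le[OF side nuh _ nug h] mu by linarith
        moreover have "\<epsilon> * \<xi> ^ 4 / \<zeta> ^ 4 \<le> 6400 * stage (Suc t)"
          using Suc k by (intro stage_lower) (simp add: t_def)
        ultimately have "\<phi> \<le> 6400 * stage (Tmax - j)"
          using m0 unfolding t' by (auto simp: \<phi>_def phi_def stage_Suc m_def[symmetric])
        from IH[OF Suc this]
        have "run_sat (cr_loop S P \<xi> \<zeta> \<gamma>h \<epsilon> p d \<omega> Tmax k) outcome (B - 10 - 1250 * (U * v) - 170 * (U * v))"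
        proof (rule run_sat_mono)
          have "7 / 5 \<le> sqrt 2" by (rule real_le_rsqrt) (simp add: power2_eq_square)
          then have "7 / 5 * v \<le> sqrt 2 * v" using v1 by (intro mult_right_mono) auto
          also have "\<dots> = w (stage (Suc t))"
            using w_scale[of 2 m] m0 by (simp add: v_def stage_Suc m_def[symmetric] w_def mult.commute)
          finally have "U * (7 / 5 * v) \<le> U * w (stage (Tmax - j))" using U0 unfolding t' by (rule mult_left_mono)
          then show "1700 * (U * (7 / 2 * V - 5 / 2 * w (stage (Tmax - j)))) + 60 * (U * V)
              \<le> B - 10 - 1250 * (U * v) - 170 * (U * v)"
            using UvV by (simp add: B_def algebra_simps)
        qed
        then show ?thesis unfolding if_not_P[OF go(2)] if_not_P[OF go(3)] using Suc by simp
      qed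
    qed
  qed
  have gam: "run_sat (approx_gamma S P \<zeta> \<gamma>h d m (p / real Tmax) (\<lambda>j. \<omega> (t, j))) (bracket d m) (1250 * (U * v))"
    using approx_gamma_sat[OF m0 m_le(1) inv sgood] by (simp add: v_def)
  have m2: "0 < m / 2" "m / 2 \<le> 1" using m0 m_le by auto
  show ?thesis
    unfolding cr_loop.simps Let_def t_def[symmetric] \<tau>_def[symmetric] stage_def[symmetric] m_def[symmetric]
      v_def[symmetric] B_def[symmetric]
  proof (rule run_sat_charge[where ?B1.0 = 10], simp, rule run_sat_bind[OF gam], clarify)
    fix \<gamma> u assume br: "bracket d m (\<gamma>, u)"
    then have "m / 2 \<le> mu P \<gamma>" by (simp add: bracket_def)
    from approx_nu_sat[OF m2(1) this m2(2) inv4(1) sq(1) v1]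
    show "run_sat (run_bind (approx_nu S P \<zeta> (m / 2) \<tau> \<gamma>) (\<lambda>(x, \<nu>).
       if sgn_side d * \<nu> - \<tau> > 0 then ret (regular_on d \<gamma>h \<gamma> (m / 4))
       else if \<nu> \<in> {- \<tau>..\<tau>} then
       run_bind (approx_nu S P \<zeta> (m / 4) \<tau> (\<gamma> - sgn_side d * (m / 4)))
         (\<lambda>(x', \<nu>'). if sgn_side d * \<nu>' - \<tau> > 0 then ret (regular_on d \<gamma>h (\<gamma> - sgn_side d * (m / 4)) (m / 4))
           else ret (MaybeRegular x))
       else if k = 0 then cr_finish P \<gamma> x u
       else cr_loop S P \<xi> \<zeta> \<gamma>h \<epsilon> p d \<omega> Tmax k)) outcome (B - 10 - 1250 * (U * v))"
      by (rule run_sat_bind_pair) (rule main[OF br]; simp)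
  qed
qed

lemma cr_loop_sat:
  assumes nuh: "sgn_side d * nu \<gamma>h < 0" and good: "seeds_good d \<omega>"
  shows "k < Tmax \<Longrightarrow> \<phi> \<le> 6400 * stage (Tmax - k) \<Longrightarrow>
    run_sat (cr_loop S P \<xi> \<zeta> \<gamma>h \<epsilon> p d \<omega> Tmax (Suc k)) outcome
      (1700 * (U * (7 / 2 * V - 5 / 2 * w (stage (Tmax - k)))) + 60 * (U * V))"
proof (induction k)
  case 0
  then show ?case by (intro cr_loop_step[OF nuh good]) auto
next
  case (Suc k)
  show ?case
  proof (rule cr_loop_step[OF nuh good Suc.prems])
    fix j assume "Suc k = Suc j" and \<phi>: "\<phi> \<le> 6400 * stage (Tmax - j)"
    then have j: "j = k" by simp
    show "run_sat (cr_loop S P \<xi> \<zeta> \<gamma>h \<epsilon> p d \<omega> Tmax (Suc k)) outcome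
        (1700 * (U * (7 / 2 * V - 5 / 2 * w (stage (Tmax - j)))) + 60 * (U * V))"
      unfolding j using Suc.prems \<phi>[unfolded j] by (intro Suc.IH) auto
  qed
qed

lemma cr_side_sat:
  assumes "sgn_side d * nu \<gamma>h < 0" "seeds_good d \<omega>"
  shows "run_sat (cr_side S P \<xi> \<zeta> \<gamma>h \<epsilon> p d \<omega>) outcome (6100 * (U * V))"
proof -
  have T: "1 \<le> Tmax" by (rule Tmax_bounds)
  have "\<phi> \<le> 6400 * stage 1" using \<phi>_bounds \<xi>_pos by (simp add: stage_def)
  then have loop: "run_sat (cr_loop S P \<xi> \<zeta> \<gamma>h \<epsilon> p d \<omega> Tmax Tmax) outcome
      (1700 * (U * (7 / 2 * V - 5 / 2 * w (stage 1))) + 60 * (U * V))"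
    using cr_loop_sat[OF assms, of "Tmax - 1"] T by simp
  have "0 \<le> U * w (stage 1)" using U_bounds w_nonneg[OF stage_pos] by simp
  then have 1: "1700 * (U * (7 / 2 * V - 5 / 2 * w (stage 1))) + 60 * (U * V) \<le> 6010 * (U * V)"
    by (simp add: algebra_simps)
  have V1: "1 \<le> V" using W_ge_1 by (simp add: V_def)
  have "real (2 * Tmax + 20) \<le> 54 * Lg" using Tmax_bounds Lg_ge_1 by simp
  also have "\<dots> \<le> 27 * (N * Lg)" using N_ge_2 Lg_ge_1 by simp
  also have "\<dots> \<le> 27 * (U * V)"
    using U_bounds V1 N_ge_2 Lg_ge_1 by (intro mult_left_mono mult_weight) auto
  finally have head: "real (2 * Tmax + 20) \<le> 27 * (U * V)" .
  have "0 \<le> U * V" using U_bounds V1 by simp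
  with 1 have "1700 * (U * (7 / 2 * V - 5 / 2 * w (stage 1))) + 60 * (U * V) \<le> 6100 * (U * V) - 27 * (U * V)"
    by linarith
  from run_sat_mono[OF loop _ this]
  show ?thesis
    unfolding cr_side_def Let_def Tmax_def[symmetric] by (intro run_sat_charge[OF head]) auto
qed

lemma sqrt_xi_le: "0 \<le> c \<Longrightarrow> c \<le> 9 \<Longrightarrow> sqrt (c * (\<zeta> / \<xi>)) \<le> 3 * W"
  using sqrt_le_w[OF \<xi>_pos, of c] w_mono[OF \<phi>_bounds] by (simp add: W_def)

lemma inverse_xi: "1 / \<xi> \<le> R ^ 4"
proof -
  have "R ^ 1 \<le> R ^ 4" using R_bounds by (intro power_increasing) auto
  then show ?thesis using R_bounds by simp
qed

lemma cr_mid_sat: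
  assumes x0: "norm (x0 - xc \<gamma>h) \<le> \<xi> * \<tau> / (10 * \<zeta>)" and nu: "\<bar>nu \<gamma>h\<bar> \<le> 2 * \<tau>"
  shows "run_sat (cr_mid S P \<xi> \<zeta> \<gamma>h \<epsilon> x0) outcome (400 * (U * W))"
proof -
  have sq: "sqrt (2 * \<zeta> / (\<xi> / 2)) \<le> 3 * W" using sqrt_xi_le[of 4] by (simp add: mult.commute)
  have inv: "1 / (\<xi> / 2) \<le> 2 ^ 15 * R ^ 4" using inverse_xi R_power_ge_1[of 4] by simp
  have x2: "0 < \<xi> / 2" "\<xi> / 2 \<le> 1" using \<xi>_pos \<xi>_le_1 by auto
  have mu: "\<xi> / 2 \<le> mu P (\<gamma>h - \<xi> / 2)" "\<xi> / 2 \<le> mu P (\<gamma>h + \<xi> / 2)"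
    using mu_lipschitz[of \<gamma>h "\<gamma>h - \<xi> / 2"] mu_lipschitz[of \<gamma>h "\<gamma>h + \<xi> / 2"] mu_\<gamma>h \<xi>_pos by auto
  have opt: "approx_optimizer P \<epsilon> x0"
    using x0 nu mu_\<gamma>h \<xi>_pos \<xi>_le_1 \<epsilon> by (intro maybe_regular_correct[of \<xi> \<gamma>h]) (auto simp: \<tau>_def)
  have "2 \<le> U * W" using U_bounds W_ge_1 by (intro mult_weight) auto
  then have rest: "0 \<le> 400 * (U * W) - 10 - 170 * (U * W) - 170 * (U * W)" by linarith
  have reg: "outcome (Regular (\<gamma>h - \<xi> / 2) (\<gamma>h + \<xi> / 2) (\<xi> / 2))"
    if "0 < nu (\<gamma>h - \<xi> / 2)" "nu (\<gamma>h + \<xi> / 2) < 0"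
  proof -
    have "3 * W \<le> 3 * V" using W_ge_1 by (simp add: V_def)
    then have "sqrt (2 * \<zeta> / (\<xi> / 2)) \<le> 3 * V" using sq by linarith
    then show ?thesis using that mu x2 inv by (simp add: outcome_def)
  qed
  show ?thesis
    unfolding cr_mid_def Let_def \<tau>_def[symmetric]
    apply (rule run_sat_charge[where ?B1.0 = 10], simp)
    apply (rule run_sat_bind_pair[OF approx_nu_sat[OF x2(1) mu(1) x2(2) inv sq W_ge_1]], elim conjE)
    apply (rule run_sat_bind_pair[OF approx_nu_sat[OF x2(1) mu(2) x2(2) inv sq W_ge_1]], elim conjE)
    using rest reg opt by (auto intro!: run_sat_ret simp: outcome_def abs_le_iff)
qed

text \<open>Decided by the exact sign of \<open>nu \<gamma>h\<close> rather than the computed value,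
  so that the event on the seeds is fixed in advance. A computed value that passes a test has the
  exact sign, as its error is at most \<tau>; otherwise no seed is read.\<close>

definition main_side :: side where
  "main_side = (if nu \<gamma>h < 0 then LeftSide else RightSide)"

lemma construct_reform_sat:
  assumes good: "seeds_good main_side \<omega>"
  shows "run_sat (construct_reform S P \<xi> \<zeta> \<gamma>h \<epsilon> p \<omega>) outcome (489000 * (U * W))"
proof -
  have sq: "sqrt (2 * \<zeta> / \<xi>) \<le> 3 * W" using sqrt_xi_le[of 2] by simp
  have inv: "1 / \<xi> \<le> 2 ^ 15 * R ^ 4" using inverse_xi R_power_ge_1[of 4] by simp
  have UW: "2 \<le> U * W" using U_bounds W_ge_1 by (intro mult_weight) auto
  have UV: "U * V = 80 * (U * W)" by (simp add: V_def)
  from UW have "6100 * (U * V) \<le> 489000 * (U * W) - 10 - 170 * (U * W)"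
    "400 * (U * W) \<le> 489000 * (U * W) - 10 - 170 * (U * W)" unfolding UV by linarith+
  note mono = run_sat_mono[OF _ _ this(1)] run_sat_mono[OF _ _ this(2)]
  show ?thesis
    unfolding construct_reform_def Let_def \<tau>_def[symmetric]
  proof (rule run_sat_charge[where ?B1.0 = 10], simp,
      rule run_sat_bind_pair[OF approx_nu_sat[OF \<xi>_pos mu_\<gamma>h \<xi>_le_1 inv sq W_ge_1]], elim conjE, hypsubst)
    fix x assume x: "norm (x - xc \<gamma>h) \<le> \<xi> * \<tau> / (10 * \<zeta>)" and \<nu>: "\<bar>q1 P x - nu \<gamma>h\<bar> \<le> \<tau>"
    let ?goal = "run_sat (if q1 P x + \<tau> < 0 then cr_side S P \<xi> \<zeta> \<gamma>h \<epsilon> p LeftSide \<omega>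
      else if q1 P x - \<tau> > 0 then cr_side S P \<xi> \<zeta> \<gamma>h \<epsilon> p RightSide \<omega>
      else cr_mid S P \<xi> \<zeta> \<gamma>h \<epsilon> x) outcome (489000 * (U * W) - 10 - 170 * (U * W))"
    consider (L) "q1 P x + \<tau> < 0" | (R) "\<not> q1 P x + \<tau> < 0" "q1 P x - \<tau> > 0"
      | (M) "\<not> q1 P x + \<tau> < 0" "\<not> q1 P x - \<tau> > 0" by blast
    then show ?goal
    proof cases
      case L
      then have "nu \<gamma>h < 0" using \<nu> by simp
      then have "run_sat (cr_side S P \<xi> \<zeta> \<gamma>h \<epsilon> p LeftSide \<omega>) outcome (6100 * (U * V))"
        using good by (intro cr_side_sat) (auto simp: main_side_def)
      from mono(1)[OF this] L show ?thesis by simp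
    next
      case R
      then have "0 < nu \<gamma>h" using \<nu> by simp
      then have "run_sat (cr_side S P \<xi> \<zeta> \<gamma>h \<epsilon> p RightSide \<omega>) outcome (6100 * (U * V))"
        using good by (intro cr_side_sat) (auto simp: main_side_def)
      from mono(1)[OF this] R show ?thesis by simp
    next
      case M
      then have "run_sat (cr_mid S P \<xi> \<zeta> \<gamma>h \<epsilon> x) outcome (400 * (U * W))"
        using \<nu> by (intro cr_mid_sat x) auto
      from mono(2)[OF this] M show ?thesis by simp
    qed
  qed
qed

text \<open>The 540 inside the cost is \<open>2 * 3 * 90\<close>: two matrices, the weight bound
  \<open>3 * V\<close>, and the exponent total \<open>69 + 21\<close> in the logarithm.\<close>

lemma solve_regular_sat:
  assumes out: "outcome (Regular a b m)"
  shows "run_sat (solve_regular S P \<zeta> \<epsilon> a b m) (approx_optimizer P \<epsilon>) (600 * (U * V))"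
proof -
  have m: "0 < m" "m \<le> 1" "m \<le> mu P a" "m \<le> mu P b" and ab: "a \<le> b" and nu: "0 < nu a" "nu b < 0"
    and inv: "1 / m \<le> 2 ^ 15 * R ^ 4" and sq: "sqrt (2 * \<zeta> / m) \<le> 3 * V"
    using out by (auto simp: outcome_def)
  have V1: "1 \<le> V" using W_ge_1 by (simp add: V_def)
  have pos: "0 < mu P a" "0 < mu P b" using m by auto
  have range: "0 \<le> a" "a \<le> \<zeta>" "0 \<le> b" "b \<le> \<zeta>"
    using mu_pos_range[OF pos(1)] mu_pos_range[OF pos(2)] by auto
  define \<delta> where "\<delta> = m * (\<epsilon> * m / (10 * \<zeta>))\<^sup>2"
  have \<delta>: "0 < \<delta>" using m \<epsilon> \<zeta>_ge_1 by (simp add: \<delta>_def)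
  define y where "y = acc_minimax S (Apen P a) (bpen P a) (cpen P a) (Apen P b) (bpen P b) (cpen P b) m (2 * \<zeta>) \<delta>"
  have acc: "acc_minimax_spec K (acc_minimax S)" using spec by (simp add: solvers_spec_def)
  have y: "\<And>z. max (qpen P a (fst y)) (qpen P b (fst y)) \<le> max (qpen P a z) (qpen P b z) + \<delta>"
    "real (snd y) \<le> K * real (max CARD('n) (nnz (Apen P a) + nnz (Apen P b))) * sqrt (2 * \<zeta> / m)
        * log 2 (2 + 2 * \<zeta> / (\<delta> * m))"
    using acc[unfolded acc_minimax_spec_def, rule_format, of "Apen P a" "Apen P b" m "2 * \<zeta>" "bpen P a" "bpen P b" \<delta> "cpen P a" "cpen P b"]
      sym_Apen m \<delta> le_mu_iff[THEN iffD1, OF m(3)] le_mu_iff[THEN iffD1, OF m(4)]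
      Apen_loewner_le[OF range(1,2)] Apen_loewner_le[OF range(3,4)] bpen_norm[OF range(1,2)] bpen_norm[OF range(3,4)]
    unfolding y_def[symmetric] qpen_eq_quad by (simp_all add: case_prod_unfold Let_def)
  have L: "log 2 (2 + 2 * \<zeta> / (\<delta> * m)) \<le> 90 * Lg"
  proof -
    have "2 * \<zeta> / (\<delta> * m) = 200 * \<zeta> ^ 3 * (1 / \<epsilon>)\<^sup>2 * (1 / m) ^ 4"
      using m \<epsilon> \<zeta>_ge_1 by (simp add: \<delta>_def field_simps power2_eq_square power_numeral_reduce)
    also have "\<dots> \<le> 200 * R ^ 3 * R\<^sup>2 * (2 ^ 15 * R ^ 4) ^ 4"
      using R_bounds inv \<zeta>_ge_1 \<epsilon> m by (intro mult_mono power_mono) auto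
    also have "\<dots> = 200 * 2 ^ 60 * R ^ (3 + (2 + 4 * 4))"
      by (simp only: power_mult_distrib power_mult[symmetric] power_add mult_ac) simp
    also have "R ^ (3 + (2 + 4 * 4)) = R ^ 21" by simp
    finally have "2 + 2 * \<zeta> / (\<delta> * m) \<le> 2 * 1 + 200 * 2 ^ 60 * R ^ 21" by simp
    also have "\<dots> \<le> 2 ^ 69 * R ^ 21" using R_power_ge_1[of 21] by simp
    finally have "log 2 (2 + 2 * \<zeta> / (\<delta> * m)) \<le> real (69 + 21) * Lg"
      using m \<delta> \<zeta>_ge_1 by (intro log_le_Lg) (auto simp: add_pos_nonneg)
    then show ?thesis by simp
  qed
  have nn: "real (max CARD('n) (nnz (Apen P a) + nnz (Apen P b))) \<le> 2 * N"
    using nnz_Apen[of a] nnz_Apen[of b] dim_le by (simp add: N_def)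
  have "0 \<le> log 2 (2 + 2 * \<zeta> / (\<delta> * m))"
    using m \<delta> \<zeta>_ge_1 by (intro zero_le_log_cancel_iff[THEN iffD2]) (auto simp: add_pos_nonneg)
  then have "real (snd y) \<le> K * (2 * N) * (3 * V) * (90 * Lg)"
    using nn K_pos sq L N_ge_2 V1 \<zeta>_ge_1 m Lg_ge_1
    by (intro order_trans[OF y(2)] mult_mono) auto
  also have "\<dots> = 540 * (K * (N * Lg) * V)" by simp
  also have "\<dots> \<le> 540 * (U * V)" using U_bounds V1 by (intro mult_left_mono mult_right_mono) auto
  finally have cost: "real (snd y) \<le> 540 * (U * V)" .
  have opt: "approx_optimizer P \<epsilon> (fst y)"
    by (rule regular_correct[OF m(1,3,4,2) \<epsilon> ab nu y(1)[unfolded \<delta>_def]])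
  have "18 * N \<le> 18 * (U * V)" using U_bounds N_ge_2 V1 by (intro mult_left_mono mult_weight) auto
  moreover have "real (2 * ops_pencil P + 20) \<le> 18 * N" using ops_le(1) N_ge_2 by simp
  ultimately have head: "real (2 * ops_pencil P + 20) \<le> 18 * (U * V)" by linarith
  have "0 \<le> U * V" using U_bounds V1 by simp
  with cost have cost': "real (snd y) \<le> 600 * (U * V) - 18 * (U * V)" by linarith
  show ?thesis
    unfolding solve_regular_def \<delta>_def[symmetric] y_def[symmetric]
    by (intro run_sat_charge[OF head] run_sat_call opt cost')
qed

section \<open>Total cost and success probability\<close>

lemma two_stage_sat:
  assumes good: "seeds_good main_side \<omega>"
  shows "run_sat (two_stage S P \<xi> \<zeta> \<gamma>h \<epsilon> p \<omega>) (approx_optimizer P \<epsilon>) (600000 * (U * W))"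
  unfolding two_stage_def
proof (rule run_sat_bind[OF construct_reform_sat[OF good]])
  fix out assume out: "outcome out"
  have UW: "0 \<le> U * W" using U_bounds W_ge_1 by simp
  have UV: "U * V = 80 * (U * W)" by (simp add: V_def)
  have le: "600 * (U * V) \<le> 600000 * (U * W) - 489000 * (U * W)" unfolding UV using UW by linarith
  have le0: "0 \<le> 600000 * (U * W) - 489000 * (U * W)" using UW by linarith
  show "run_sat (case out of Regular \<gamma>1 \<gamma>2 m \<Rightarrow> solve_regular S P \<zeta> \<epsilon> \<gamma>1 \<gamma>2 m
      | MaybeRegular x \<Rightarrow> ret x | NotRegular x \<Rightarrow> ret x) (approx_optimizer P \<epsilon>)
    (600000 * (U * W) - 489000 * (U * W))"
    using out run_sat_mono[OF solve_regular_sat _ le] run_sat_ret[OF _ le0]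
    by (cases out) (auto simp: outcome_def)
qed

lemma cost_le_time_bound: "600000 * (U * W) \<le> time_bound K P \<xi> \<zeta> \<epsilon> p"
proof -
  have l: "0 \<le> log 2 (1 / \<phi>)" using \<phi>_bounds \<xi>_le_1 by simp
  have UW: "0 \<le> U * W" using U_bounds W_ge_1 by simp
  have "600000 * (U * W) \<le> 10 ^ 9 * (U * W)" using UW by (intro mult_right_mono) auto
  also have "10 ^ 9 * (U * W) = 10 ^ 9 * (U * W) * 1" by simp
  also have "10 ^ 9 * (U * W) * 1 \<le> 10 ^ 9 * (U * W) * (1 + log 2 (1 / \<phi>))"
    using UW l by (intro mult_left_mono) auto
  also have "\<dots> = time_bound K P \<xi> \<zeta> \<epsilon> p"
    unfolding time_bound_def \<phi>_def[symmetric] R_def[symmetric] Lg_def[symmetric] Lp_def[symmetric]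
      LL_def[symmetric] N_def[symmetric] U_def W_def w_def real_sqrt_divide
    by (simp add: mult_ac) (simp add: algebra_simps)
  finally show ?thesis by simp
qed

text \<open>A stage fails with probability at most \<open>Tb * qb = p / Tmax\<close>. The union
  bound runs over all \<open>Tmax\<close> stages, reached or not, which keeps the event independent
  of the course of the run.\<close>

lemma seeds_good_prob:
  fixes d :: side
  defines "PM \<equiv> PiM (UNIV :: (nat \<times> nat) set) (\<lambda>_. M)"
  shows "{\<omega> \<in> space PM. seeds_good d \<omega>} \<in> sets PM"
    and "1 - p \<le> measure PM {\<omega> \<in> space PM. seeds_good d \<omega>}"
proof -
  interpret PM: prob_space PM unfolding PM_def by (intro prob_space_PiM M)
  define G where "G t = {\<omega> \<in> space PM. stage_good d (stage t) (qb (stage t)) (Tb (stage t)) (l0 d) (r0 d) (\<lambda>j. \<omega> (t, j))}" for t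
  have G: "G t \<in> sets PM \<and> 1 - p / real Tmax \<le> measure PM (G t)" if t: "t \<in> {1..Tmax}" for t
  proof -
    have m: "0 < stage t" "stage t \<le> 1" "1 / stage t \<le> 6400 * R ^ 4"
      using stage_pos stage_le_half[of t] inverse_stage[of t] t \<xi>_le_1 by auto
    have "real (Tb (stage t)) * qb (stage t) = p / real Tmax"
      using Tb_bounds(1)[OF m] by (simp add: qb_def)
    moreover have "0 \<le> l0 d" "l0 d \<le> r0 d" "r0 d \<le> \<zeta>"
      using \<gamma>h_nonneg \<gamma>h_bounds \<xi>_pos by (cases d; simp add: l0_def r0_def)+
    ultimately show ?thesis
      using stage_good_prob[OF m(1,2) qb_bounds[OF m], of "l0 d" "r0 d" "Pair t" d "Tb (stage t)"]
      by (simp add: G_def PM_def inj_on_def)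
  qed
  have eq: "{\<omega> \<in> space PM. seeds_good d \<omega>} = space PM - (\<Union>t\<in>{1..Tmax}. space PM - G t)"
    by (auto simp: seeds_good_def G_def)
  have C: "(\<Union>t\<in>{1..Tmax}. space PM - G t) \<in> sets PM" using G by (intro sets.finite_UN) auto
  then show "{\<omega> \<in> space PM. seeds_good d \<omega>} \<in> sets PM" unfolding eq by auto
  have "measure PM (\<Union>t\<in>{1..Tmax}. space PM - G t) \<le> (\<Sum>t\<in>{1..Tmax}. measure PM (space PM - G t))"
    using G by (intro PM.finite_measure_subadditive_finite) auto
  also have "\<dots> \<le> (\<Sum>t\<in>{1..Tmax}. p / real Tmax)"
  proof (intro sum_mono)
    fix t assume "t \<in> {1..Tmax}"
    then show "measure PM (space PM - G t) \<le> p / real Tmax" using G[of t] PM.prob_compl[of "G t"] by auto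
  qed
  also have "\<dots> = p" using Tmax_bounds(1) by simp
  finally show "1 - p \<le> measure PM {\<omega> \<in> space PM. seeds_good d \<omega>}"
    unfolding eq using PM.prob_compl[OF C] by simp
qed

end

theorem theorem1:
  fixes P :: "'n::finite gtrs" and S :: "('s, 'n) solvers" and M :: "'s measure"
    and K \<xi> \<zeta> \<gamma>h \<epsilon> p :: real
  assumes "prob_space M" and "0 < K" and "solvers_spec K M S"
    and "transpose (A0 P) = A0 P" and "transpose (A1 P) = A1 P"
    and "\<exists>l<0. eigenvalue (A0 P) l" and "\<exists>l<0. eigenvalue (A1 P) l"
    and "spectral_norm (A0 P) \<le> 1" and "spectral_norm (A1 P) \<le> 1"
    and "norm (b0 P) \<le> 1" and "norm (b1 P) \<le> 1"
    and "\<bar>c0 P\<bar> \<le> 1" and "\<bar>c1 P\<bar> \<le> 1"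
    and "CARD('n) \<le> nnz (A0 P) + nnz (A1 P)"
    and "0 \<le> \<gamma>h" and "gamma_plus P \<le> \<zeta>" and "mat \<xi> \<preceq> Apen P \<gamma>h"
    and "0 < \<xi>" and "\<xi> \<le> 1" and "1 \<le> \<zeta>"
    and "0 < \<epsilon>" and "\<epsilon> < 1" and "0 < p" and "p < 1"
  shows "\<exists>E \<in> sets (\<Pi>\<^sub>M i\<in>(UNIV :: (nat \<times> nat) set). M).
    measure (\<Pi>\<^sub>M i\<in>(UNIV :: (nat \<times> nat) set). M) E \<ge> 1 - p \<and>
    (\<forall>\<omega>\<in>E. \<exists>x k. two_stage S P \<xi> \<zeta> \<gamma>h \<epsilon> p \<omega> = (Some x, k) \<and>
      approx_optimizer P \<epsilon> x \<and> real k \<le> time_bound K P \<xi> \<zeta> \<epsilon> p)"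
proof -
  interpret gtrs_algorithm P \<xi> \<zeta> \<gamma>h M S K \<epsilon> p
    by (intro gtrs_algorithm.intro gtrs_instance.intro gtrs_algorithm_axioms.intro assms)
  let ?PM = "\<Pi>\<^sub>M i\<in>(UNIV :: (nat \<times> nat) set). M"
  show ?thesis
  proof (intro bexI conjI ballI)
    fix \<omega> assume "\<omega> \<in> {\<omega> \<in> space ?PM. seeds_good main_side \<omega>}"
    then have "run_sat (two_stage S P \<xi> \<zeta> \<gamma>h \<epsilon> p \<omega>) (approx_optimizer P \<epsilon>) (600000 * (U * W))"
      by (intro two_stage_sat) simp
    then show "\<exists>x k. two_stage S P \<xi> \<zeta> \<gamma>h \<epsilon> p \<omega> = (Some x, k) \<and>
        approx_optimizer P \<epsilon> x \<and> real k \<le> time_bound K P \<xi> \<zeta> \<epsilon> p"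
      using cost_le_time_bound unfolding run_sat_def by (meson order_trans)
  qed (use seeds_good_prob[of main_side] in auto)
qed

end
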